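(* Let $(\mathcal{X},d,m,\mathcal{E},\mathcal{F})$ be a metric measure Dirichlet space of pure jump type as described in the context, satisfying (VD), $\mathrm{Cap}(\phi)_\le$ and $\mathbf{J}_\phi$, and let $D\subset\mathcal{X}$ be an Ahlfors regular open set with $\overline D\subsetneq\mathcal{X}$. Let $\mathfrak{E}$ be the extension operator defined in the context. Then $\mathfrak{E}u\in\mathcal{F}$ for each $u\in\bar{\mathcal{F}}$. Moreover, there is a constant $C>0$ depending on the parameters of (VD), $\mathrm{Cap}(\phi)_\le$, $\mathbf{J}_\phi$ and the growth bounds for $\phi$ such that $$\mathcal{E}_1(\mathfrak{E}u,\mathfrak{E}u)\le C\,\bar{\mathcal{E}}_1(u,u)\quad\text{for every }u\in\bar{\mathcal{F}},$$ and $$\int_{B(x_0,r)\times B(x_0,r)}\big(\mathfrak{E}u(x)-\mathfrak{E}u(y)\big)^2J(dx,dy)\le C\int_{(B(x_0,7r)\cap D)\times(B(x_0,14r)\cap D)}\big(u(x)-u(y)\big)^2J(dx,dy)$$ for every $u\in\bar{\mathcal{F}}$, $x_0\in\overline D$ and $0<r<\operatorname{diam}(D)$.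
   Context: Setting. $(\mathcal{X},d)$ is a locally compact separable metric space and $m$ is a Radon measure on $\mathcal{X}$ with full support (atoms are allowed). $B(x,r)=\{y:d(x,y)<r\}$, $V(x,r)=m(B(x,r))$. $(\mathcal{E},\mathcal{F})$ is a symmetric regular Dirichlet form on $L^2(\mathcal{X};m)$ with $J(dx,dy)=J(x,y)m(dx)m(dy)$, $$\mathcal{F}=\Big\{u\in L^2(\mathcal{X};m):\int_{\mathcal{X}\times\mathcal{X}}(u(x)-u(y))^2J(dx,dy)<\infty\Big\},\quad \mathcal{E}(u,v)=\tfrac12\int_{\mathcal{X}\times\mathcal{X}}(u(x)-u(y))(v(x)-v(y))J(dx,dy).$$ Functions in $\mathcal F$ are represented by $\mathcal E$-quasi-continuous versions. $\phi:[0,\infty)\to[0,\infty)$ is strictly increasing with $\phi(0)=0$, $\phi(1)=1$, and satisfies the growth bounds: there are $c_1,c_2>0$, $\beta_2\ge\beta_1>0$ with $c_1(R/r)^{\beta_1}\le\phi(R)/\phi(r)\le c_2(R/r)^{\beta_2}$ for all $0<r\le R<\infty$. (VD): there is $C_1\in(1,\infty)$ with $V(x,2r)\le C_1V(x,r)$ for all $x\in\mathcal{X}$, $r>0$. $\mathrm{Cap}(\phi)_\le$: with $\mathrm{Cap}(A,B)=\inf\{\mathcal{E}(f,f):f\in\mathcal{F},f|_A=1,f|_{\mathcal{X}\setminus B}=0\}$, there is $c>0$ such that $\mathrm{Cap}(B(x,r),B(x,2r))\le c\,m(B(x,r))/\phi(r)$ for every $x\in\mathcal{X}$ and $0<r<\operatorname{diam}(\mathcal{X})/3$.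 $\mathbf{J}_\phi$: there are $C_1,C_2>0$ with $\frac{C_1}{V(x,d(x,y))\phi(d(x,y))}\le J(x,y)\le\frac{C_2}{V(x,d(x,y))\phi(d(x,y))}$ for all $x\ne y$ in $\mathcal{X}$. Ahlfors regular: there is $c_D\in(0,1]$ with $m(B(x,r)\cap D)\ge c_D\,m(B(x,r))$ for every $x\in D$ and $0<r<\operatorname{diam}(D)/2$, where $\operatorname{diam}(D)=\sup_{x,y\in D}d(x,y)$. $m_0(A)=m(A\cap D)$ for Borel $A\subset\overline D$. Reflected form: $\bar{\mathcal F}=\{u\in L^2(\overline D;m_0):\int_{D\times D}(u(x)-u(y))^2J(dx,dy)<\infty\}$, $\bar{\mathcal E}(u,v)=\frac12\int_{D\times D}(u(x)-u(y))(v(x)-v(y))J(dx,dy)$. $\mathcal{E}_1(u,v)=\mathcal{E}(u,v)+\int_{\mathcal{X}}uv\,dm$ and $\bar{\mathcal{E}}_1(u,v)=\bar{\mathcal{E}}(u,v)+\int_{\overline D}uv\,dm_0$. Whitney cover. Fix a $\frac14$-Whitney cover of $\mathcal{X}\setminus\overline D$, i.e. balls $B_i=B(x_i,r_i)$, $i\in I$, with $x_i\in\mathcal{X}\setminus\overline D$, $r_i>0$, such that the $B_i$ are pairwise disjoint, $d(x_i,\overline D)=5r_i$, and $\bigcup_{i\in I}\frac52B_i=\mathcal{X}\setminus\overline D$, where $\lambda B_i:=B(x_i,\lambda r_i)$. Let $\Lambda=\{i\in I:0<r_i<\operatorname{diam}(D)/2\}$. Functions $f_i$. Fix a countable collection $\{f_i:i\in\Lambda\}\subset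 L^2(\mathcal{X};m)$ with: (D.1) $0\le f_i\le1$ and $\sum_{i\in\Lambda}f_i\le\mathbf{1}_D$ $m$-a.e.; (D.2) $\operatorname{diam}(\operatorname{supp}[f_i])\le2r_i$; (D.3) $d(x_i,\operatorname{supp}[f_i])\le7r_i$; (D.4) there is $C>1$ with $C^{-1}m(B_i)\le\int_Df_i\,dm\le C\,m(B_i)$ for all $i\in\Lambda$. (Such a collection exists under (VD) and Ahlfors regularity. $\operatorname{supp}[f]$ is the smallest closed set off which $f=0$ $m$-a.e.) Functions $\psi_i$. For $i\in I$ let $\eta_i\in\mathcal{F}$ satisfy $0\le\eta_i\le1$, $\eta_i=1$ on $\frac52B_i$, $\eta_i=0$ on $\mathcal{X}\setminus3B_i$, $\mathcal{E}(\eta_i,\eta_i)\le C\,m(B_i)/\phi(r_i)$ with $C>0$ depending on the constants of $\mathrm{Cap}(\phi)_\le$, (VD) and the growth bounds for $\phi$ (such $\eta_i$ exist under (VD) and $\mathrm{Cap}(\phi)_\le$). Put $\psi_i=\eta_i/\sum_{j\in I}\eta_j$ on $\mathcal{X}\setminus\overline D$ and $\psi_i=0$ on $\overline D$. Extension operator. For $u\in L^2(\overline D;m_0)$, $\mathfrak{E}u=u$ on $\overline D$ and $\mathfrak{E}u(x)=\sum_{i\in\Lambda}[u]_i\psi_i(x)$ for $x\in\mathcal{X}\setminus\overline D$, where $[u]_i=\int_Df_iu\,dm\big/\int_Df_i\,dm$.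
   Formalization: C may also depend on c_D, the (D.4) constant and the cutoff-energy constant. In the first inequality it also depends on diam(D) if 0<diam(D)<1, and on the given data if diam(D)=0; as stated it fails for u=1 on small balls in R^n. *)

theory Defs
  imports "HOL-Analysis.Analysis"
begin

section \<open>Metric measure spaces\<close>

text \<open>
  A metric space is an element \<open>X\<close> of the library type of abstract metric spaces, so that spaces
  and metrics (not only measures) can be quantified over. Diameters and distances to sets take
  values in \<open>ennreal\<close>: an unbounded set has diameter \<open>\<infinity>\<close>, the empty set has diameter \<open>0\<close> and is at
  distance \<open>\<infinity>\<close> from every point.
\<close>

definition ediam :: "'a metric \<Rightarrow> 'a set \<Rightarrow> ennreal" where
  "ediam X A = (SUP x\<in>A. SUP y\<in>A. ennreal (mdist X x y))"

definition esetdist :: "'a metric \<Rightarrow> 'a \<Rightarrow> 'a set \<Rightarrow> ennreal" where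
  "esetdist X x A = (INF y\<in>A. ennreal (mdist X x y))"

definition metric_closure :: "'a metric \<Rightarrow> 'a set \<Rightarrow> 'a set" where
  "metric_closure X A = mtopology_of X closure_of A"

definition radon_measure :: "'a metric \<Rightarrow> 'a measure \<Rightarrow> bool" where
  "radon_measure X m \<longleftrightarrow>
     space m = mspace X \<and>
     sets m = sigma_sets (mspace X) {U. openin (mtopology_of X) U} \<and>
     (\<forall>K. compactin (mtopology_of X) K \<longrightarrow> emeasure m K < \<infinity>) \<and>
     (\<forall>A\<in>sets m. emeasure m A
        = (INF U\<in>{U. openin (mtopology_of X) U \<and> A \<subseteq> U}. emeasure m U)) \<and>
     (\<forall>U. openin (mtopology_of X) U \<longrightarrow> emeasure m U
        = (SUP K\<in>{K. compactin (mtopology_of X) K \<and> K \<subseteq> U}. emeasure m K))"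

definition full_support :: "'a metric \<Rightarrow> 'a measure \<Rightarrow> bool" where
  "full_support X m \<longleftrightarrow>
     (\<forall>U. openin (mtopology_of X) U \<and> U \<noteq> {} \<longrightarrow> 0 < emeasure m U)"

definition metric_measure_space :: "'a metric \<Rightarrow> 'a measure \<Rightarrow> bool" where
  "metric_measure_space X m \<longleftrightarrow>
     locally_compact_space (mtopology_of X) \<and> separable_space (mtopology_of X) \<and>
     radon_measure X m \<and> full_support X m"

definition volume_doubling :: "real \<Rightarrow> 'a metric \<Rightarrow> 'a measure \<Rightarrow> bool" where
  "volume_doubling C X m \<longleftrightarrow> 1 < C \<and>
     (\<forall>x\<in>mspace X. \<forall>r>0.
        emeasure m (mball_of X x (2 * r)) \<le> ennreal C * emeasure m (mball_of X x r))"

definition scale_function :: "real \<Rightarrow> real \<Rightarrow> real \<Rightarrow> real \<Rightarrow> (real \<Rightarrow> real) \<Rightarrow> bool" where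
  "scale_function c1 c2 \<beta>1 \<beta>2 \<phi> \<longleftrightarrow>
     0 < c1 \<and> 0 < c2 \<and> 0 < \<beta>1 \<and> \<beta>1 \<le> \<beta>2 \<and>
     strict_mono_on {0..} \<phi> \<and> \<phi> 0 = 0 \<and> \<phi> 1 = 1 \<and>
     (\<forall>r R. 0 < r \<and> r \<le> R \<longrightarrow>
        c1 * (R / r) powr \<beta>1 \<le> \<phi> R / \<phi> r \<and> \<phi> R / \<phi> r \<le> c2 * (R / r) powr \<beta>2)"

definition ahlfors_regular :: "real \<Rightarrow> 'a metric \<Rightarrow> 'a measure \<Rightarrow> 'a set \<Rightarrow> bool" where
  "ahlfors_regular c X m D \<longleftrightarrow> 0 < c \<and> c \<le> 1 \<and>
     (\<forall>x\<in>D. \<forall>r>0. ennreal r < ediam X D / 2 \<longrightarrow>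
        ennreal c * emeasure m (mball_of X x r) \<le> emeasure m (mball_of X x r \<inter> D))"


section \<open>Symmetric regular Dirichlet forms\<close>

text \<open>
  Elements of \<open>L\<^sup>2\<close> are represented by Borel functions; a form domain is a set of such functions
  that is saturated under almost everywhere equality.
\<close>

definition L2_fun :: "'a measure \<Rightarrow> ('a \<Rightarrow> real) set" where
  "L2_fun m = {u \<in> borel_measurable m. integrable m (\<lambda>x. (u x)\<^sup>2)}"

definition form_1 ::
    "'a measure \<Rightarrow> (('a \<Rightarrow> real) \<Rightarrow> ('a \<Rightarrow> real) \<Rightarrow> real) \<Rightarrow> ('a \<Rightarrow> real) \<Rightarrow> ('a \<Rightarrow> real) \<Rightarrow> real" where
  "form_1 m E u v = E u v + (LINT x|m. u x * v x)"

definition symmetric_dirichlet_form ::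
    "'a measure \<Rightarrow> ('a \<Rightarrow> real) set \<Rightarrow> (('a \<Rightarrow> real) \<Rightarrow> ('a \<Rightarrow> real) \<Rightarrow> real) \<Rightarrow> bool" where
  "symmetric_dirichlet_form m F E \<longleftrightarrow>
     F \<subseteq> L2_fun m \<and>
     (\<forall>u\<in>F. \<forall>v\<in>borel_measurable m. (AE x in m. u x = v x) \<longrightarrow>
        v \<in> F \<and> (\<forall>w\<in>F. E u w = E v w)) \<and>
     (\<lambda>x. 0) \<in> F \<and>
     (\<forall>u\<in>F. \<forall>v\<in>F. \<forall>a b. (\<lambda>x. a * u x + b * v x) \<in> F \<and>
        (\<forall>w\<in>F. E (\<lambda>x. a * u x + b * v x) w = a * E u w + b * E v w)) \<and>
     (\<forall>u\<in>F. \<forall>v\<in>F. E u v = E v u) \<and>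
     (\<forall>u\<in>F. 0 \<le> E u u) \<and>
     \<comment> \<open>densely defined\<close>
     (\<forall>u\<in>L2_fun m. \<forall>e>0. \<exists>v\<in>F. (LINT x|m. (u x - v x)\<^sup>2) < e) \<and>
     \<comment> \<open>closed\<close>
     (\<forall>s. (\<forall>n::nat. s n \<in> F) \<and>
        (\<forall>e>0. \<exists>N. \<forall>k\<ge>N. \<forall>l\<ge>N.
           form_1 m E (\<lambda>x. s k x - s l x) (\<lambda>x. s k x - s l x) < e) \<longrightarrow>
        (\<exists>u\<in>F. (\<lambda>n. form_1 m E (\<lambda>x. s n x - u x) (\<lambda>x. s n x - u x)) \<longlonglongrightarrow> 0)) \<and>
     \<comment> \<open>Markovian\<close>
     (\<forall>u\<in>F. (\<lambda>x. min 1 (max 0 (u x))) \<in> F \<and>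
        E (\<lambda>x. min 1 (max 0 (u x))) (\<lambda>x. min 1 (max 0 (u x))) \<le> E u u)"

definition continuous_compact_support :: "'a metric \<Rightarrow> ('a \<Rightarrow> real) set" where
  "continuous_compact_support X =
     {u. continuous_map (mtopology_of X) euclideanreal u \<and>
         (\<exists>K. compactin (mtopology_of X) K \<and> (\<forall>x\<in>mspace X - K. u x = 0))}"

definition regular_form ::
    "'a metric \<Rightarrow> 'a measure \<Rightarrow> ('a \<Rightarrow> real) set \<Rightarrow> (('a \<Rightarrow> real) \<Rightarrow> ('a \<Rightarrow> real) \<Rightarrow> real) \<Rightarrow> bool" where
  "regular_form X m F E \<longleftrightarrow>
     (\<forall>u\<in>F. \<forall>e>0. \<exists>v\<in>F \<inter> continuous_compact_support X.
        form_1 m E (\<lambda>x. u x - v x) (\<lambda>x. u x - v x) < e) \<and>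
     (\<forall>u\<in>continuous_compact_support X. \<forall>e>0. \<exists>v\<in>F \<inter> continuous_compact_support X.
        \<forall>x\<in>mspace X. \<bar>u x - v x\<bar> < e)"

text \<open>The 1-capacity of an open set, used only to define quasi-continuity.\<close>

definition open_capacity_1 ::
    "'a measure \<Rightarrow> ('a \<Rightarrow> real) set \<Rightarrow> (('a \<Rightarrow> real) \<Rightarrow> ('a \<Rightarrow> real) \<Rightarrow> real) \<Rightarrow> 'a set \<Rightarrow> ennreal" where
  "open_capacity_1 m F E U =
     (INF f\<in>{f\<in>F. AE x in m. x \<in> U \<longrightarrow> 1 \<le> f x}. ennreal (form_1 m E f f))"

definition quasi_continuous ::
    "'a metric \<Rightarrow> 'a measure \<Rightarrow> ('a \<Rightarrow> real) set \<Rightarrow> (('a \<Rightarrow> real) \<Rightarrow> ('a \<Rightarrow> real) \<Rightarrow> real) \<Rightarrow>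
     ('a \<Rightarrow> real) \<Rightarrow> bool" where
  "quasi_continuous X m F E f \<longleftrightarrow>
     (\<forall>e>0. \<exists>G. openin (mtopology_of X) G \<and> open_capacity_1 m F E G < ennreal e \<and>
        continuous_map (subtopology (mtopology_of X) (mspace X - G)) euclideanreal f)"

text \<open>
  The relative capacity. The boundary conditions are pointwise conditions on quasi-continuous
  representatives; the infimum over the empty set is \<open>\<infinity>\<close>.
\<close>

definition relative_capacity ::
    "'a metric \<Rightarrow> 'a measure \<Rightarrow> ('a \<Rightarrow> real) set \<Rightarrow> (('a \<Rightarrow> real) \<Rightarrow> ('a \<Rightarrow> real) \<Rightarrow> real) \<Rightarrow>
     'a set \<Rightarrow> 'a set \<Rightarrow> ennreal" where
  "relative_capacity X m F E A B =
     (INF f\<in>{f\<in>F. quasi_continuous X m F E f \<and>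
                  (\<forall>x\<in>A. f x = 1) \<and> (\<forall>x\<in>mspace X - B. f x = 0)}. ennreal (E f f))"

definition capacity_upper_bound ::
    "real \<Rightarrow> (real \<Rightarrow> real) \<Rightarrow> 'a metric \<Rightarrow> 'a measure \<Rightarrow>
     ('a \<Rightarrow> real) set \<Rightarrow> (('a \<Rightarrow> real) \<Rightarrow> ('a \<Rightarrow> real) \<Rightarrow> real) \<Rightarrow> bool" where
  "capacity_upper_bound c \<phi> X m F E \<longleftrightarrow> 0 < c \<and>
     (\<forall>x\<in>mspace X. \<forall>r>0. ennreal r < ediam X (mspace X) / 3 \<longrightarrow>
        relative_capacity X m F E (mball_of X x r) (mball_of X x (2 * r))
          \<le> ennreal c * emeasure m (mball_of X x r) / ennreal (\<phi> r))"


section \<open>Pure jump forms and reflected forms\<close>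

definition jump_integral ::
    "'a measure \<Rightarrow> ('a \<Rightarrow> 'a \<Rightarrow> real) \<Rightarrow> ('a \<times> 'a) set \<Rightarrow> ('a \<Rightarrow> real) \<Rightarrow> ennreal" where
  "jump_integral m J S u =
     (\<integral>\<^sup>+z\<in>S. ennreal ((u (fst z) - u (snd z))\<^sup>2 * J (fst z) (snd z)) \<partial>(m \<Otimes>\<^sub>M m))"

definition jump_form ::
    "'a measure \<Rightarrow> ('a \<Rightarrow> 'a \<Rightarrow> real) \<Rightarrow> 'a set \<Rightarrow> ('a \<Rightarrow> real) \<Rightarrow> ('a \<Rightarrow> real) \<Rightarrow> real" where
  "jump_form m J D u v =
     1 / 2 * (LINT z:D \<times> D|m \<Otimes>\<^sub>M m.
        (u (fst z) - u (snd z)) * (v (fst z) - v (snd z)) * J (fst z) (snd z))"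

definition jump_kernel :: "'a measure \<Rightarrow> ('a \<Rightarrow> 'a \<Rightarrow> real) \<Rightarrow> bool" where
  "jump_kernel m J \<longleftrightarrow>
     (\<lambda>z. J (fst z) (snd z)) \<in> borel_measurable (m \<Otimes>\<^sub>M m) \<and>
     (\<forall>x\<in>space m. \<forall>y\<in>space m. 0 \<le> J x y \<and> J x y = J y x)"

definition jump_kernel_bounds ::
    "real \<Rightarrow> real \<Rightarrow> (real \<Rightarrow> real) \<Rightarrow> 'a metric \<Rightarrow> 'a measure \<Rightarrow> ('a \<Rightarrow> 'a \<Rightarrow> real) \<Rightarrow> bool" where
  "jump_kernel_bounds C1 C2 \<phi> X m J \<longleftrightarrow> 0 < C1 \<and> 0 < C2 \<and>
     (\<forall>x\<in>mspace X. \<forall>y\<in>mspace X. x \<noteq> y \<longrightarrow>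
        C1 / (measure m (mball_of X x (mdist X x y)) * \<phi> (mdist X x y)) \<le> J x y \<and>
        J x y \<le> C2 / (measure m (mball_of X x (mdist X x y)) * \<phi> (mdist X x y)))"

definition jump_domain :: "'a measure \<Rightarrow> ('a \<Rightarrow> 'a \<Rightarrow> real) \<Rightarrow> ('a \<Rightarrow> real) set" where
  "jump_domain m J = {u \<in> L2_fun m. jump_integral m J (space m \<times> space m) u < \<infinity>}"

abbreviation energy ::
    "'a measure \<Rightarrow> ('a \<Rightarrow> 'a \<Rightarrow> real) \<Rightarrow> ('a \<Rightarrow> real) \<Rightarrow> ('a \<Rightarrow> real) \<Rightarrow> real" where
  "energy m J \<equiv> jump_form m J (space m)"

text \<open>The measure \<open>m\<^sub>0(A) = m(A \<inter> D)\<close> on the Borel subsets \<open>A\<close> of the closure of \<open>D\<close>.\<close>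

definition measure_0 :: "'a metric \<Rightarrow> 'a measure \<Rightarrow> 'a set \<Rightarrow> 'a measure" where
  "measure_0 X m D = density (restrict_space m (metric_closure X D)) (indicator D)"

definition reflected_domain ::
    "'a metric \<Rightarrow> 'a measure \<Rightarrow> ('a \<Rightarrow> 'a \<Rightarrow> real) \<Rightarrow> 'a set \<Rightarrow> ('a \<Rightarrow> real) set" where
  "reflected_domain X m J D = {u \<in> L2_fun (measure_0 X m D). jump_integral m J (D \<times> D) u < \<infinity>}"


section \<open>Whitney covers and the extension operator\<close>

definition whitney_cover ::
    "'a metric \<Rightarrow> 'a set \<Rightarrow> 'i set \<Rightarrow> ('i \<Rightarrow> 'a) \<Rightarrow> ('i \<Rightarrow> real) \<Rightarrow> bool" where
  "whitney_cover X D I x r \<longleftrightarrow>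
     (\<forall>i\<in>I. x i \<in> mspace X - metric_closure X D \<and> 0 < r i \<and>
        esetdist X (x i) (metric_closure X D) = ennreal (5 * r i)) \<and>
     disjoint_family_on (\<lambda>i. mball_of X (x i) (r i)) I \<and>
     (\<Union>i\<in>I. mball_of X (x i) (5 / 2 * r i)) = mspace X - metric_closure X D"

definition small_indices :: "'a metric \<Rightarrow> 'a set \<Rightarrow> 'i set \<Rightarrow> ('i \<Rightarrow> real) \<Rightarrow> 'i set" where
  "small_indices X D I r = {i\<in>I. 0 < r i \<and> ennreal (r i) < ediam X D / 2}"

definition ae_support :: "'a metric \<Rightarrow> 'a measure \<Rightarrow> ('a \<Rightarrow> real) \<Rightarrow> 'a set" where
  "ae_support X m f =
     \<Inter>{K. closedin (mtopology_of X) K \<and> (AE x in m. x \<notin> K \<longrightarrow> f x = 0)}"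

text \<open>
  The sum of the \<open>f i\<close> is taken in \<open>ennreal\<close>, because a divergent real \<open>infsum\<close> would be \<open>0\<close>.
\<close>

definition averaging_functions ::
    "real \<Rightarrow> 'a metric \<Rightarrow> 'a measure \<Rightarrow> 'a set \<Rightarrow> 'i set \<Rightarrow> ('i \<Rightarrow> 'a) \<Rightarrow> ('i \<Rightarrow> real) \<Rightarrow>
     ('i \<Rightarrow> 'a \<Rightarrow> real) \<Rightarrow> bool" where
  "averaging_functions C X m D \<Lambda> x r f \<longleftrightarrow> 1 < C \<and>
     (\<forall>i\<in>\<Lambda>. f i \<in> L2_fun m \<and> (AE y in m. 0 \<le> f i y \<and> f i y \<le> 1)) \<and>
     (AE y in m. (\<Sum>\<^sub>\<infinity>i\<in>\<Lambda>. ennreal (f i y)) \<le> indicator D y) \<and>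
     (\<forall>i\<in>\<Lambda>. ediam X (ae_support X m (f i)) \<le> ennreal (2 * r i)) \<and>
     (\<forall>i\<in>\<Lambda>. esetdist X (x i) (ae_support X m (f i)) \<le> ennreal (7 * r i)) \<and>
     (\<forall>i\<in>\<Lambda>. measure m (mball_of X (x i) (r i)) / C \<le> (LINT y:D|m. f i y) \<and>
        (LINT y:D|m. f i y) \<le> C * measure m (mball_of X (x i) (r i)))"

definition cutoff_functions ::
    "real \<Rightarrow> (real \<Rightarrow> real) \<Rightarrow> 'a metric \<Rightarrow> 'a measure \<Rightarrow>
     ('a \<Rightarrow> real) set \<Rightarrow> (('a \<Rightarrow> real) \<Rightarrow> ('a \<Rightarrow> real) \<Rightarrow> real) \<Rightarrow>
     'i set \<Rightarrow> ('i \<Rightarrow> 'a) \<Rightarrow> ('i \<Rightarrow> real) \<Rightarrow> ('i \<Rightarrow> 'a \<Rightarrow> real) \<Rightarrow> bool" where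
  "cutoff_functions C \<phi> X m F E I x r \<eta> \<longleftrightarrow> 0 < C \<and>
     (\<forall>i\<in>I. \<eta> i \<in> F \<and> quasi_continuous X m F E (\<eta> i) \<and>
        (\<forall>y\<in>mspace X. 0 \<le> \<eta> i y \<and> \<eta> i y \<le> 1) \<and>
        (\<forall>y\<in>mball_of X (x i) (5 / 2 * r i). \<eta> i y = 1) \<and>
        (\<forall>y\<in>mspace X - mball_of X (x i) (3 * r i). \<eta> i y = 0) \<and>
        E (\<eta> i) (\<eta> i) \<le> C * measure m (mball_of X (x i) (r i)) / \<phi> (r i))"

definition partition_function ::
    "'a metric \<Rightarrow> 'a set \<Rightarrow> 'i set \<Rightarrow> ('i \<Rightarrow> 'a \<Rightarrow> real) \<Rightarrow> 'i \<Rightarrow> 'a \<Rightarrow> real" where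
  "partition_function X D I \<eta> i y =
     (if y \<in> mspace X - metric_closure X D then \<eta> i y / (\<Sum>\<^sub>\<infinity>j\<in>I. \<eta> j y) else 0)"

definition weighted_average ::
    "'a measure \<Rightarrow> 'a set \<Rightarrow> ('a \<Rightarrow> real) \<Rightarrow> ('a \<Rightarrow> real) \<Rightarrow> real" where
  "weighted_average m D f u = (LINT y:D|m. f y * u y) / (LINT y:D|m. f y)"

definition extension_operator ::
    "'a metric \<Rightarrow> 'a measure \<Rightarrow> 'a set \<Rightarrow> 'i set \<Rightarrow> ('i \<Rightarrow> real) \<Rightarrow> ('i \<Rightarrow> 'a \<Rightarrow> real) \<Rightarrow>
     ('i \<Rightarrow> 'a \<Rightarrow> real) \<Rightarrow> ('a \<Rightarrow> real) \<Rightarrow> 'a \<Rightarrow> real" where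
  "extension_operator X m D I r f \<eta> u y =
     (if y \<in> metric_closure X D then u y
      else \<Sum>\<^sub>\<infinity>i\<in>small_indices X D I r.
             weighted_average m D (f i) u * partition_function X D I \<eta> i y)"

end

theory Submission
  imports Defs
begin

text \<open>
  On a pair of points the jump integrand of the extension \<open>h\<close> is compared with that of \<open>u\<close> at nearby
  points of \<open>D\<close>. Outside the closure of \<open>D\<close> the value \<open>h y\<close> is an average of \<open>u\<close> over points of \<open>D\<close>
  whose distance to \<open>y\<close> is comparable to that from \<open>y\<close> to \<open>D\<close>, so for pairs in \<open>D \<times> U\<close>, with \<open>U\<close> the
  complement of the closure, and for pairs in \<open>U \<times> U\<close> that are far apart on the scale of the Whitney
  balls, Jensen's inequality reduces the claim to the comparability of the jump kernel at pairs of
  comparable distance, and the averaging weights integrate out by (D.1) and (D.4). For pairs in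
  \<open>U \<times> U\<close> that are close together, \<open>h\<close> is a combination of boundedly many \<open>\<psi>\<^sub>i\<close>. There the integrand is
  controlled by the energies of the cutoffs \<open>\<eta>\<^sub>i\<close> times squared differences of averages
  \<open>[u]\<^sub>i - [u]\<^sub>j\<close>, to which Jensen's inequality applies again. The frontier of \<open>D\<close> is null. In the
  global estimate, pairs at distance at least \<open>s\<close>, with \<open>s\<close> a multiple of \<open>min (diam D) 1\<close>, and Whitney
  balls of radius at least \<open>s\<close> are absorbed by the \<open>L\<^sup>2\<close> norm.
\<close>

section \<open>Doubling spaces with a jump kernel\<close>

text \<open>The obstacle is that \<open>extension_operator\<close> sums over
  \<open>small_indices\<close> only, whereas the functions \<psi>_i sum to 1 over all of
  \<open>I\<close>. A constant can be subtracted from \<open>h\<close> only at points where every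
  index that matters is small; elsewhere nothing but the size of \<open>h\<close> is available. The
  cut between Jensen's inequality and the L^2 norm is therefore made by Whitney radius as well as by
  distance: a pair closer than s meets only radii below 17/4 * s, unless it lies near a Whitney ball
  of radius at least s. Averages are summed over the indices by means of the inequality in (D.1), so
  no overlap of the supports of the f_i has to be counted. The bounded overlap of the enlarged
  Whitney balls is a packing argument based on doubling. The statement fixes its constants before
  the space, so each constant is a definition in numeric parameters alone and can be named outside
  the locale in which it arises.\<close>

locale doubling_jump_space =
  fixes X :: "'a metric" and m :: "'a measure" and J :: "'a \<Rightarrow> 'a \<Rightarrow> real" and \<phi> :: "real \<Rightarrow> real"
    and CV c1 c2 \<beta>1 \<beta>2 C1 C2 :: real
  assumes mms: "metric_measure_space X m" and jump_kernel: "jump_kernel m J"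
    and scale: "scale_function c1 c2 \<beta>1 \<beta>2 \<phi>" and doubling: "volume_doubling CV X m"
    and J_bounds: "jump_kernel_bounds C1 C2 \<phi> X m J"
begin

abbreviation M where "M \<equiv> mspace X"
abbreviation d where "d \<equiv> mdist X"
abbreviation ball where "ball \<equiv> mball_of X"
abbreviation m2 where "m2 \<equiv> m \<Otimes>\<^sub>M m"
abbreviation top where "top \<equiv> mtopology_of X"

definition V :: "'a \<Rightarrow> real \<Rightarrow> real" where "V p t = measure m (ball p t)"

sublocale MS: Metric_space M d
  by simp

lemma top_eq: "top = MS.mtopology"
  by (simp add: mtopology_of_def)

lemma ball_eq: "ball = MS.mball"
  by (simp add: mball_of_def)

lemma space_m [simp]: "space m = M"
  using mms by (simp add: metric_measure_space_def radon_measure_def)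

lemma openin_sets: "openin top U \<Longrightarrow> U \<in> sets m"
  using mms by (auto simp: metric_measure_space_def radon_measure_def)

lemma openin_ball [simp]: "openin top (ball p t)"
  by (simp add: top_eq ball_eq)

lemma ball_sets [measurable, simp]: "ball p t \<in> sets m"
  by (simp add: openin_sets)

lemma closedin_sets:
  assumes "closedin top A"
  shows "A \<in> sets m"
proof -
  have "A = space m - (M - A)" "openin top (M - A)"
    using assms by (auto simp: closedin_def)
  then show ?thesis
    by (metis openin_sets sets.compl_sets)
qed

lemma CV_gt_1: "1 < CV"
  using doubling by (simp add: volume_doubling_def)

section \<open>Volumes of balls and comparison of scales\<close>

lemma emeasure_ball_pos: "p \<in> M \<Longrightarrow> 0 < t \<Longrightarrow> 0 < emeasure m (ball p t)"
  using mms MS.mball_eq_empty[of p t] openin_ball[of p t]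
  unfolding metric_measure_space_def full_support_def ball_eq by auto

lemma emeasure_ball_double: "p \<in> M \<Longrightarrow> 0 < t \<Longrightarrow> emeasure m (ball p (2 * t)) \<le> ennreal CV * emeasure m (ball p t)"
  using doubling by (simp add: volume_doubling_def)

lemma emeasure_ball_mono: "s \<le> t \<Longrightarrow> emeasure m (ball p s) \<le> emeasure m (ball p t)"
  by (rule emeasure_mono) auto

text \<open>Local compactness gives one ball of finite measure about each point, and doubling
  carries finiteness from it to every radius.\<close>

lemma emeasure_ball_finite:
  assumes "p \<in> M"
  shows "emeasure m (ball p t) < \<infinity>"
proof -
  obtain U K where UK: "openin top U" "compactin top K" "p \<in> U" "U \<subseteq> K"
    using mms assms unfolding metric_measure_space_def locally_compact_space_def by auto
  then obtain e where e: "0 < e" "ball p e \<subseteq> U"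
    unfolding top_eq ball_eq by (metis MS.openin_mtopology)
  have "K \<in> sets m"
    using UK(2) compactin_imp_closedin[OF MS.Hausdorff_space_mtopology] by (intro closedin_sets) (simp add: top_eq)
  then have "emeasure m (ball p e) \<le> emeasure m K"
    using UK e by (intro emeasure_mono) auto
  also have "\<dots> < \<infinity>"
    using mms UK by (simp add: metric_measure_space_def radon_measure_def)
  finally have base: "emeasure m (ball p e) < \<infinity>" .
  have pow: "emeasure m (ball p (2 ^ n * e)) < \<infinity>" for n
  proof (induction n)
    case (Suc n)
    have "emeasure m (ball p (2 * (2 ^ n * e))) \<le> ennreal CV * emeasure m (ball p (2 ^ n * e))"
      using assms e by (intro emeasure_ball_double) auto
    also have "\<dots> < \<infinity>"
      using Suc by (simp add: ennreal_mult_less_top)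
    finally show ?case by (simp add: mult.assoc)
  qed (use base in simp)
  obtain n where "t / e < 2 ^ n"
    using real_arch_pow[of 2 "t / e"] by auto
  then have "t \<le> 2 ^ n * e"
    using e by (simp add: field_simps)
  then show ?thesis
    using emeasure_ball_mono pow le_less_trans by blast
qed

lemma emeasure_ball: "p \<in> M \<Longrightarrow> emeasure m (ball p t) = ennreal (V p t)"
  unfolding V_def using emeasure_ball_finite[of p t] by (simp add: emeasure_eq_ennreal_measure less_top)

lemma V_nonneg [simp]: "0 \<le> V p t"
  by (simp add: V_def)

lemma V_pos: "p \<in> M \<Longrightarrow> 0 < t \<Longrightarrow> 0 < V p t"
  using emeasure_ball_pos[of p t] by (simp add: emeasure_ball)

lemma V_mono:
  assumes "p \<in> M" "a \<in> M" "d p a + s \<le> t"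
  shows "V p s \<le> V a t"
proof -
  have "ball p s \<subseteq> ball a t"
    using assms MS.triangle[of a p] MS.commute[of a p] by (fastforce simp del: MS.triangle)
  then have "emeasure m (ball p s) \<le> emeasure m (ball a t)"
    by (intro emeasure_mono) auto
  then show ?thesis
    using assms by (simp add: emeasure_ball)
qed

lemma V_double: "p \<in> M \<Longrightarrow> 0 < t \<Longrightarrow> V p (2 * t) \<le> CV * V p t"
  using emeasure_ball_double[of p t] CV_gt_1 by (simp add: emeasure_ball flip: ennreal_mult)

lemma V_double_pow:
  assumes "p \<in> M" "0 < t"
  shows "V p (2 ^ n * t) \<le> CV ^ n * V p t"
proof (induction n)
  case (Suc n)
  have "V p (2 * (2 ^ n * t)) \<le> CV * V p (2 ^ n * t)"
    using assms by (intro V_double) auto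
  also have "\<dots> \<le> CV * (CV ^ n * V p t)"
    using Suc CV_gt_1 by simp
  finally show ?case by (simp add: mult.assoc)
qed simp

text \<open>All ratios of scales that occur below are at most \<open>128\<close>, and two balls are compared inside one
  of at most \<open>256\<close> times the radius, hence the eighth power of the doubling constant.\<close>

definition NV :: real where "NV = CV ^ 8"

lemma NV_ge_1: "1 \<le> NV"
  unfolding NV_def using CV_gt_1 by simp

lemma V_le:
  assumes "p \<in> M" "a \<in> M" "0 < t" "d p a + s \<le> 256 * t"
  shows "V p s \<le> NV * V a t"
  using V_mono[of p a s "2 ^ 8 * t"] V_double_pow[of a t 8] assms by (simp add: NV_def)

lemma \<phi>_mono: "0 \<le> s \<Longrightarrow> s \<le> t \<Longrightarrow> \<phi> s \<le> \<phi> t"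
  using scale strict_mono_on_leD[of "{0..}" \<phi> s t] by (simp add: scale_function_def)

lemma \<phi>_pos: "0 < t \<Longrightarrow> 0 < \<phi> t"
  using scale strict_mono_onD[of "{0..}" \<phi> 0 t] by (simp add: scale_function_def)

definition P\<phi> :: real where "P\<phi> = c2 * 128 powr \<beta>2"

lemma P\<phi>_pos: "0 < P\<phi>"
  using scale by (simp add: scale_function_def P\<phi>_def)

lemma \<phi>_le:
  assumes "0 < t" "0 \<le> s" "s \<le> 128 * t"
  shows "\<phi> s \<le> P\<phi> * \<phi> t"
proof -
  have "\<phi> (128 * t) / \<phi> t \<le> c2 * (128 * t / t) powr \<beta>2"
    using scale assms(1) unfolding scale_function_def by (smt (verit))
  then have "\<phi> (128 * t) \<le> P\<phi> * \<phi> t"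
    using assms(1) \<phi>_pos[of t] by (simp add: P\<phi>_def field_simps)
  then show ?thesis
    using \<phi>_mono[of s "128 * t"] assms by simp
qed

section \<open>Comparison of the jump kernel at different pairs\<close>

lemma J_measurable [measurable]: "(\<lambda>z. J (fst z) (snd z)) \<in> borel_measurable m2"
  using jump_kernel by (simp add: jump_kernel_def)

lemma J_nonneg: "p \<in> M \<Longrightarrow> q \<in> M \<Longrightarrow> 0 \<le> J p q"
  using jump_kernel by (simp add: jump_kernel_def)

lemma J_sym: "p \<in> M \<Longrightarrow> q \<in> M \<Longrightarrow> J p q = J q p"
  using jump_kernel by (simp add: jump_kernel_def)

lemma C1_pos: "0 < C1" and C2_pos: "0 < C2"
  using J_bounds by (simp_all add: jump_kernel_bounds_def)

lemma J_ge: "p \<in> M \<Longrightarrow> q \<in> M \<Longrightarrow> p \<noteq> q \<Longrightarrow> C1 / (V p (d p q) * \<phi> (d p q)) \<le> J p q"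
  and J_le: "p \<in> M \<Longrightarrow> q \<in> M \<Longrightarrow> p \<noteq> q \<Longrightarrow> J p q \<le> C2 / (V p (d p q) * \<phi> (d p q))"
  using J_bounds by (simp_all add: jump_kernel_bounds_def V_def)

text \<open>The reference scale is free: \<open>J_compare\<close> takes it from another pair of
  points, \<open>average_difference_le\<close> from a Whitney ball. Only upper bounds on distances
  enter, because \<open>V p (d p q) * \<phi> (d p q)\<close> increases with the distance.\<close>

lemma J_lower:
  assumes "p \<in> M" "q \<in> M" "a \<in> M" "p \<noteq> q" "0 < t" "d p q \<le> 128 * t" "d p a \<le> 128 * t"
  shows "C1 / (NV * P\<phi> * (V a t * \<phi> t)) \<le> J p q"
proof -
  have d: "0 < d p q"
    using assms by simp
  have "V p (d p q) \<le> NV * V a t" "\<phi> (d p q) \<le> P\<phi> * \<phi> t"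
    using assms by (auto intro!: V_le \<phi>_le)
  then have "V p (d p q) * \<phi> (d p q) \<le> (NV * V a t) * (P\<phi> * \<phi> t)"
    using d NV_ge_1 by (intro mult_mono) (simp_all add: \<phi>_pos less_imp_le)
  moreover have "0 < V p (d p q) * \<phi> (d p q)"
    using d assms by (simp add: V_pos \<phi>_pos)
  ultimately have "C1 / ((NV * V a t) * (P\<phi> * \<phi> t)) \<le> C1 / (V p (d p q) * \<phi> (d p q))"
    using C1_pos by (intro divide_left_mono) auto
  then show ?thesis
    using J_ge[OF assms(1,2,4)] by (simp add: mult_ac)
qed

definition CJ :: real where "CJ = C2 / C1 * NV * P\<phi>"

lemma CJ_pos: "0 < CJ"
  using C1_pos C2_pos P\<phi>_pos NV_ge_1 by (simp add: CJ_def)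

text \<open>One-sided: moving \<open>p\<close> and \<open>q\<close> closer together only raises the
  lower bound for the kernel. In the applications \<open>p\<close>, \<open>q\<close> are the points
  of \<open>D\<close> that replace \<open>a\<close>, \<open>b\<close> in a jump integrand.\<close>

lemma J_compare:
  assumes "p \<in> M" "q \<in> M" "a \<in> M" "b \<in> M" "p \<noteq> q" "a \<noteq> b"
    "d p q \<le> 128 * d a b" "d p a \<le> 128 * d a b"
  shows "J a b \<le> CJ * J p q"
proof -
  have pos: "0 < d a b" "0 < V a (d a b) * \<phi> (d a b)"
    using assms by (simp_all add: V_pos \<phi>_pos)
  have "J a b \<le> C2 / (V a (d a b) * \<phi> (d a b))"
    using assms by (intro J_le)
  also have "\<dots> = CJ * (C1 / (NV * P\<phi> * (V a (d a b) * \<phi> (d a b))))"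
    using C1_pos P\<phi>_pos NV_ge_1 pos by (simp add: CJ_def field_simps)
  also have "\<dots> \<le> CJ * J p q"
    using assms pos CJ_pos by (intro mult_left_mono J_lower) auto
  finally show ?thesis .
qed

section \<open>Measurability of the metric and sigma-finiteness\<close>

lemma countable_dense:
  obtains Q where "countable Q" "Q \<subseteq> M" "\<And>p e. p \<in> M \<Longrightarrow> 0 < e \<Longrightarrow> \<exists>q\<in>Q. d p q < e"
proof -
  obtain Q where Q: "countable Q" "Q \<subseteq> M" "top closure_of Q = M"
    using mms by (auto simp: metric_measure_space_def separable_space_def)
  have "\<exists>q\<in>Q. d p q < e" if "p \<in> M" "0 < e" for p e
  proof -
    have "p \<in> MS.mtopology closure_of Q"
      using Q(3) that by (simp add: top_eq)
    then show ?thesis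
      using that unfolding MS.metric_closure_of by (auto simp: MS.in_mball)
  qed
  then show ?thesis
    using that Q by blast
qed

lemma d_measurable_right [measurable]:
  assumes "p \<in> M"
  shows "(\<lambda>q. d p q) \<in> borel_measurable m"
  unfolding borel_measurable_iff_less
proof
  fix a
  have "{q \<in> space m. d p q < a} = ball p a"
    using assms by auto
  then show "{q \<in> space m. d p q < a} \<in> sets m"
    by simp
qed

text \<open>The product sigma-algebra is reached through separability: by the triangle inequality,
  two points are closer than \<open>a\<close> iff the distances from some \<open>q\<close> of a
  countable dense set to both of them add up to less than \<open>a\<close>.\<close>

lemma d_measurable [measurable]: "(\<lambda>z. d (fst z) (snd z)) \<in> borel_measurable m2"
proof -
  obtain Q where Q: "countable Q" "Q \<subseteq> M" "\<And>p e. p \<in> M \<Longrightarrow> 0 < e \<Longrightarrow> \<exists>q\<in>Q. d p q < e"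
    by (rule countable_dense) blast
  show ?thesis
    unfolding borel_measurable_iff_less
  proof
    fix a
    have "{z \<in> space m2. d (fst z) (snd z) < a}
      = (\<Union>q\<in>Q. {z \<in> space m2. d q (fst z) + d q (snd z) < a})" (is "?L = ?R")
    proof (intro equalityI subsetI)
      fix z assume z: "z \<in> ?L"
      then have zM: "fst z \<in> M" "snd z \<in> M"
        by (auto simp: space_pair_measure)
      obtain q where q: "q \<in> Q" "d (fst z) q < (a - d (fst z) (snd z)) / 2"
        using Q(3)[OF zM(1), of "(a - d (fst z) (snd z)) / 2"] z by auto
      have "d q (snd z) \<le> d q (fst z) + d (fst z) (snd z)"
        using q Q zM by (intro MS.triangle) auto
      then show "z \<in> ?R"
        using q z by (auto simp: MS.commute intro!: bexI[of _ q])
    next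
      fix z assume "z \<in> ?R"
      then obtain q where q: "q \<in> Q" "d q (fst z) + d q (snd z) < a" "z \<in> space m2"
        by auto
      then have "d (fst z) (snd z) \<le> d (fst z) q + d q (snd z)"
        using Q by (intro MS.triangle) (auto simp: space_pair_measure)
      then show "z \<in> ?L"
        using q by (simp add: MS.commute)
    qed
    moreover have "{z \<in> space m2. d q (fst z) + d q (snd z) < a} \<in> sets m2" if "q \<in> Q" for q
    proof -
      have [measurable]: "(\<lambda>y. d q y) \<in> borel_measurable m"
        using that Q by (intro d_measurable_right) auto
      show ?thesis by measurable
    qed
    ultimately show "{z \<in> space m2. d (fst z) (snd z) < a} \<in> sets m2"
      using Q(1) by (auto intro!: sets.countable_UN')
  qed
qed

lemma sigma_finite: "sigma_finite_measure m"
proof (cases "M = {}")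
  case True
  then show ?thesis
    by (metis countable_empty empty_iff sigma_finite_measure_count_space_countable space_empty space_m)
next
  case False
  then obtain p where p: "p \<in> M" by auto
  show ?thesis
  proof
    show "\<exists>A. countable A \<and> A \<subseteq> sets m \<and> \<Union> A = space m \<and> (\<forall>a\<in>A. emeasure m a \<noteq> \<infinity>)"
      using p emeasure_ball_finite[OF p] reals_Archimedean2
      by (intro exI[of _ "range (\<lambda>n. ball p (real n))"]) (auto simp: less_top)
  qed
qed

sublocale sf: sigma_finite_measure m
  by (rule sigma_finite)

sublocale pm: pair_sigma_finite m m ..

section \<open>Jump integrals as set functions\<close>

definition je :: "('a \<Rightarrow> real) \<Rightarrow> 'a \<Rightarrow> 'a \<Rightarrow> ennreal" where
  "je u p q = ennreal ((u p - u q)\<^sup>2 * J p q)"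

abbreviation JI where "JI \<equiv> jump_integral m J"

lemma je_sym: "p \<in> M \<Longrightarrow> q \<in> M \<Longrightarrow> je u p q = je u q p"
  by (simp add: je_def J_sym power2_commute)

lemma je_measurable [measurable]:
  assumes [measurable]: "u \<in> borel_measurable m"
  shows "(\<lambda>z. je u (fst z) (snd z)) \<in> borel_measurable m2"
  unfolding je_def by measurable

lemma JI_eq: "JI S u = (\<integral>\<^sup>+z. je u (fst z) (snd z) * indicator S z \<partial>m2)"
  by (simp add: jump_integral_def je_def)

lemma JI_iterated:
  assumes [measurable]: "u \<in> borel_measurable m" "S \<in> sets m2"
  shows "JI S u = (\<integral>\<^sup>+p. \<integral>\<^sup>+q. je u p q * indicator S (p, q) \<partial>m \<partial>m)"
proof -
  have "(\<lambda>z. je u (fst z) (snd z) * indicator S z) \<in> borel_measurable m2"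
    by measurable
  from sf.nn_integral_fst[OF this] show ?thesis
    by (simp add: JI_eq)
qed

lemma JI_mono: "(\<And>z. z \<in> S \<Longrightarrow> z \<in> space m2 \<Longrightarrow> z \<in> T) \<Longrightarrow> JI S u \<le> JI T u"
  unfolding JI_eq by (intro nn_integral_mono) (auto simp: indicator_def)

lemma JI_Un:
  assumes [measurable]: "u \<in> borel_measurable m" "S \<in> sets m2" "T \<in> sets m2"
  shows "JI (S \<union> T) u \<le> JI S u + JI T u"
proof -
  have "JI (S \<union> T) u \<le> (\<integral>\<^sup>+z. je u (fst z) (snd z) * indicator S z + je u (fst z) (snd z) * indicator T z \<partial>m2)"
    unfolding JI_eq by (intro nn_integral_mono) (auto simp: indicator_def)
  also have "\<dots> = JI S u + JI T u"
    unfolding JI_eq by (intro nn_integral_add) measurable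
  finally show ?thesis .
qed

text \<open>Right-nested form, so that \<open>intro\<close> can peel the pieces off a long union one
  by one; \<open>JI_core\<close> does so with nine pieces.\<close>

lemma JI_Un_le:
  assumes u: "u \<in> borel_measurable m" and S0: "S0 \<in> sets m2" and S1: "S1 \<in> sets m2"
    and le: "JI S1 u \<le> t"
  shows "JI (S0 \<union> S1) u \<le> JI S0 u + t"
  using JI_Un[OF u S0 S1] add_left_mono[OF le] by (rule order_trans)

text \<open>Countable subadditivity, with the sum written as an integral over
  \<open>count_space\<close> so that it can later be exchanged with integrals over the
  space.\<close>

lemma JI_le_nn_integral_count_space:
  assumes [measurable]: "u \<in> borel_measurable m" and A: "countable A"
    and S0: "\<And>j. j \<in> A \<Longrightarrow> S0 j \<in> sets m2" and cov: "\<And>z. z \<in> S1 \<Longrightarrow> \<exists>j\<in>A. z \<in> S0 j"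
  shows "JI S1 u \<le> (\<integral>\<^sup>+j. JI (S0 j) u \<partial>count_space A)"
proof -
  have "JI S1 u \<le> (\<integral>\<^sup>+z. (\<integral>\<^sup>+j. je u (fst z) (snd z) * indicator (S0 j) z \<partial>count_space A) \<partial>m2)"
    unfolding JI_eq
  proof (intro nn_integral_mono)
    fix z
    show "je u (fst z) (snd z) * indicator S1 z \<le> (\<integral>\<^sup>+j. je u (fst z) (snd z) * indicator (S0 j) z \<partial>count_space A)"
    proof (cases "z \<in> S1")
      case True
      then obtain j where j: "j \<in> A" "z \<in> S0 j"
        using cov by blast
      show ?thesis
        using nn_integral_ge_point[OF j(1), of "\<lambda>j. je u (fst z) (snd z) * indicator (S0 j) z"] True j by simp
    qed simp
  qed
  also have "\<dots> = (\<integral>\<^sup>+j. JI (S0 j) u \<partial>count_space A)"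
    unfolding JI_eq
  proof (rule nn_integral_count_space_nn_integral[OF A])
    fix j assume "j \<in> A"
    then have [measurable]: "S0 j \<in> sets m2"
      by (rule S0)
    show "(\<lambda>z. je u (fst z) (snd z) * indicator (S0 j) z) \<in> borel_measurable m2"
      by measurable
  qed
  finally show ?thesis .
qed

lemma JI_swap:
  assumes [measurable]: "u \<in> borel_measurable m" "S \<in> sets m2"
  shows "JI ((\<lambda>(p, q). (q, p)) -` S \<inter> space m2) u = JI S u"
proof -
  let ?S = "(\<lambda>(p, q). (q, p)) -` S \<inter> space m2"
  have [measurable]: "?S \<in> sets m2"
    by measurable
  have "JI ?S u = (\<integral>\<^sup>+p. \<integral>\<^sup>+q. je u p q * indicator ?S (p, q) \<partial>m \<partial>m)"
    by (rule JI_iterated) measurable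
  also have "\<dots> = (\<integral>\<^sup>+p. \<integral>\<^sup>+q. je u q p * indicator S (q, p) \<partial>m \<partial>m)"
    by (intro nn_integral_cong) (auto simp: indicator_def je_sym space_pair_measure)
  also have "\<dots> = (\<integral>\<^sup>+q. \<integral>\<^sup>+p. je u q p * indicator S (q, p) \<partial>m \<partial>m)"
    by (rule pm.Fubini') measurable
  also have "\<dots> = JI S u"
    by (rule JI_iterated[symmetric]) measurable
  finally show ?thesis .
qed

section \<open>Long jumps\<close>

lemma c1_pos: "0 < c1" and \<beta>1_pos: "0 < \<beta>1"
  using scale by (simp_all add: scale_function_def)

definition CT :: real where "CT = C2 * CV / c1 * (1 / (1 - 2 powr - \<beta>1))"

lemma CT_nonneg: "0 \<le> CT"
proof -
  have "2 powr - \<beta>1 < 1"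
    using \<beta>1_pos by (subst powr_less_one) auto
  then show ?thesis
    using C2_pos CV_gt_1 c1_pos by (simp add: CT_def)
qed

text \<open>On the annulus between the radii 2^n * s and 2^(n+1) * s the kernel is at most
  \<open>a n\<close>, and doubling bounds the measure of the annulus by \<open>CV\<close> times the
  volume in the denominator of \<open>a n\<close>. The lower growth bound leaves powers of 2 powr
  -\<beta>1, a geometric series whose sum gives \<open>CT\<close>.\<close>

lemma tail_bound:
  assumes p: "p \<in> M" and s: "0 < s"
  shows "(\<integral>\<^sup>+q. ennreal (J p q) * indicator {q. s \<le> d p q} q \<partial>m) \<le> ennreal (CT / \<phi> s)"
proof -
  define a where "a n = C2 / (V p (2 ^ n * s) * (c1 * 2 powr (n * \<beta>1) * \<phi> s))" for n :: nat
  have a_nonneg: "0 \<le> a n" for n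
    using C2_pos c1_pos \<phi>_pos[OF s] by (simp add: a_def)
  have pointwise: "ennreal (J p q) * indicator {q. s \<le> d p q} q
      \<le> (\<Sum>n. ennreal (a n) * indicator (ball p (2 ^ Suc n * s)) q)" if q: "q \<in> M" for q
  proof (cases "s \<le> d p q")
    case True
    \<comment> \<open>The index of the dyadic annulus that contains \<open>q\<close>.\<close>
    define n where "n = nat \<lfloor>log 2 (d p q / s)\<rfloor>"
    have ratio: "1 \<le> d p q / s"
      using True s by simp
    then have "0 \<le> log 2 (d p q / s)"
      by (subst zero_le_log_cancel_iff) auto
    then have n: "n \<le> log 2 (d p q / s)" "log 2 (d p q / s) < n + 1"
      unfolding n_def by linarith+
    have "2 powr n \<le> d p q / s" "d p q / s < 2 powr (n + 1)"
      using n ratio by (simp_all add: le_log_iff log_less_iff)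
    then have lo: "2 ^ n * s \<le> d p q" and hi: "d p q < 2 ^ Suc n * s"
      using s by (simp_all add: powr_realpow powr_add field_simps)
    have t: "0 < 2 ^ n * s"
      using s by simp
    have "c1 * (2 ^ n * s / s) powr \<beta>1 \<le> \<phi> (2 ^ n * s) / \<phi> s"
      using scale s unfolding scale_function_def by (smt (verit) mult_le_cancel_right1 one_le_power)
    then have "c1 * 2 powr (n * \<beta>1) * \<phi> s \<le> \<phi> (2 ^ n * s)"
      using s \<phi>_pos[OF s] by (simp add: field_simps powr_powr flip: powr_realpow)
    also have "\<dots> \<le> \<phi> (d p q)"
      using lo t by (intro \<phi>_mono) auto
    finally have \<phi>: "c1 * 2 powr (n * \<beta>1) * \<phi> s \<le> \<phi> (d p q)" .
    have "V p (2 ^ n * s) \<le> V p (d p q)"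
      using p lo by (intro V_mono) auto
    then have le: "V p (2 ^ n * s) * (c1 * 2 powr (n * \<beta>1) * \<phi> s) \<le> V p (d p q) * \<phi> (d p q)"
      using \<phi> c1_pos \<phi>_pos[OF s] by (intro mult_mono) auto
    have pos: "0 < V p (2 ^ n * s) * (c1 * 2 powr (n * \<beta>1) * \<phi> s)"
      using p t c1_pos \<phi>_pos[OF s] by (simp add: V_pos)
    have "J p q \<le> C2 / (V p (d p q) * \<phi> (d p q))"
      using p q s True by (intro J_le) auto
    also have "\<dots> \<le> a n"
      unfolding a_def using le pos C2_pos by (intro divide_left_mono) (auto intro: less_le_trans mult_pos_pos)
    finally have "ennreal (J p q) * indicator {q. s \<le> d p q} q \<le> ennreal (a n) * indicator (ball p (2 ^ Suc n * s)) q"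
      using True p q hi by (simp add: ennreal_leI)
    also have "\<dots> \<le> (\<Sum>n. ennreal (a n) * indicator (ball p (2 ^ Suc n * s)) q)"
      using sum_le_suminf[of "\<lambda>n. ennreal (a n) * indicator (ball p (2 ^ Suc n * s)) q" "{n}"]
      by (simp del: indicator_eq_0_iff power_Suc sum_mult_indicator)
    finally show ?thesis .
  qed simp
  define x where "x = 2 powr - \<beta>1"
  have x: "0 \<le> x" "x < 1"
    using \<beta>1_pos unfolding x_def by (auto simp: powr_less_one)
  have summand: "ennreal (a n) * emeasure m (ball p (2 ^ Suc n * s)) \<le> ennreal (C2 * CV / (c1 * \<phi> s) * x ^ n)" for n
  proof -
    have t: "0 < 2 ^ n * s"
      using s by simp
    have "V p (2 ^ Suc n * s) \<le> CV * V p (2 ^ n * s)"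
      using V_double[OF p t] by (simp add: mult.assoc)
    then have "a n * V p (2 ^ Suc n * s) \<le> a n * (CV * V p (2 ^ n * s))"
      using a_nonneg by (intro mult_left_mono)
    also have "\<dots> = C2 * CV / (c1 * \<phi> s) * (1 / 2 powr (n * \<beta>1))"
      unfolding a_def using V_pos[OF p t] c1_pos \<phi>_pos[OF s] by (simp add: field_simps)
    also have "1 / 2 powr (n * \<beta>1) = x ^ n"
      unfolding x_def by (simp add: powr_minus_divide power_divide powr_power mult.commute)
    finally show ?thesis
      using a_nonneg p by (simp add: emeasure_ball ennreal_leI flip: ennreal_mult)
  qed
  have "(\<integral>\<^sup>+q. ennreal (J p q) * indicator {q. s \<le> d p q} q \<partial>m)
      \<le> (\<integral>\<^sup>+q. (\<Sum>n. ennreal (a n) * indicator (ball p (2 ^ Suc n * s)) q) \<partial>m)"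
    using pointwise by (intro nn_integral_mono) simp
  also have "\<dots> = (\<Sum>n. ennreal (a n) * emeasure m (ball p (2 ^ Suc n * s)))"
    by (subst nn_integral_suminf) (simp_all add: nn_integral_cmult_indicator)
  also have "\<dots> \<le> (\<Sum>n. ennreal (C2 * CV / (c1 * \<phi> s) * x ^ n))"
    using summand by (intro suminf_le) auto
  also have "\<dots> = ennreal (C2 * CV / (c1 * \<phi> s) * (1 / (1 - x)))"
    using x C2_pos CV_gt_1 c1_pos \<phi>_pos[OF s]
    by (intro suminf_ennreal_eq sums_mult geometric_sums) auto
  also have "C2 * CV / (c1 * \<phi> s) * (1 / (1 - x)) = CT / \<phi> s"
    by (simp add: CT_def x_def)
  finally show ?thesis .
qed

text \<open>The squared difference is at most twice the sum of the squares. The set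
  \<open>far\<close> and the kernel are symmetric, so both squares contribute the same integral,
  whence the 4, and \<open>tail_bound\<close> integrates the kernel in its second variable.\<close>

lemma JI_far:
  assumes [measurable]: "u \<in> borel_measurable m" and s: "0 < s"
  shows "JI {z. s \<le> d (fst z) (snd z)} u \<le> ennreal (4 * CT / \<phi> s) * (\<integral>\<^sup>+p. ennreal ((u p)\<^sup>2) \<partial>m)"
proof -
  define far where "far = {z \<in> space m2. s \<le> d (fst z) (snd z)}"
  have [measurable]: "far \<in> sets m2"
    unfolding far_def by measurable
  define f where "f p q = ennreal ((u p)\<^sup>2) * (ennreal (J p q) * indicator far (p, q))" for p q
  have Jm: "case_prod (\<lambda>p q. ennreal (J p q)) \<in> borel_measurable m2"
    using J_measurable by (simp add: case_prod_beta')
  have [measurable]: "case_prod f \<in> borel_measurable m2"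
    unfolding f_def using Jm by measurable
  have "JI {z. s \<le> d (fst z) (snd z)} u \<le> JI far u"
    by (intro JI_mono) (simp add: far_def)
  also have "\<dots> = (\<integral>\<^sup>+p. \<integral>\<^sup>+q. je u p q * indicator far (p, q) \<partial>m \<partial>m)"
    by (rule JI_iterated) measurable
  also have "\<dots> \<le> (\<integral>\<^sup>+p. \<integral>\<^sup>+q. 2 * f p q + 2 * f q p \<partial>m \<partial>m)"
  proof (intro nn_integral_mono)
    fix p q assume pq: "p \<in> space m" "q \<in> space m"
    have "(u p - u q)\<^sup>2 \<le> 2 * (u p)\<^sup>2 + 2 * (u q)\<^sup>2"
      using zero_le_power2[of "u p + u q"] by (simp add: power2_eq_square algebra_simps)
    then have "(u p - u q)\<^sup>2 * J p q \<le> (2 * (u p)\<^sup>2 + 2 * (u q)\<^sup>2) * J p q"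
      using J_nonneg[of p q] pq by (intro mult_right_mono) auto
    also have "\<dots> = 2 * ((u p)\<^sup>2 * J p q) + 2 * ((u q)\<^sup>2 * J p q)"
      by (simp add: distrib_right)
    finally have "ennreal ((u p - u q)\<^sup>2 * J p q) \<le> ennreal (2 * ((u p)\<^sup>2 * J p q) + 2 * ((u q)\<^sup>2 * J p q))"
      by (rule ennreal_leI)
    then have "je u p q \<le> 2 * (ennreal ((u p)\<^sup>2) * ennreal (J p q)) + 2 * (ennreal ((u q)\<^sup>2) * ennreal (J p q))"
      unfolding je_def using J_nonneg[of p q] pq
      by (simp add: ennreal_mult)
    moreover have "indicator far (p, q) = (indicator far (q, p) :: ennreal)"
      using pq by (auto simp: far_def indicator_def space_pair_measure MS.commute)
    ultimately show "je u p q * indicator far (p, q) \<le> 2 * f p q + 2 * f q p"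
      using pq J_sym[of p q] by (auto simp: f_def indicator_def)
  qed
  also have "\<dots> = 2 * (\<integral>\<^sup>+p. \<integral>\<^sup>+q. f p q \<partial>m \<partial>m) + 2 * (\<integral>\<^sup>+p. \<integral>\<^sup>+q. f q p \<partial>m \<partial>m)"
  proof -
    have "(\<integral>\<^sup>+q. 2 * f p q + 2 * f q p \<partial>m) = 2 * (\<integral>\<^sup>+q. f p q \<partial>m) + 2 * (\<integral>\<^sup>+q. f q p \<partial>m)"
      if "p \<in> space m" for p
    proof -
      have [measurable]: "(\<lambda>q. f p q) \<in> borel_measurable m" "(\<lambda>q. f q p) \<in> borel_measurable m"
        using that by measurable
      show ?thesis
        by (simp add: nn_integral_add nn_integral_cmult)
    qed
    then have "(\<integral>\<^sup>+p. \<integral>\<^sup>+q. 2 * f p q + 2 * f q p \<partial>m \<partial>m)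
        = (\<integral>\<^sup>+p. 2 * (\<integral>\<^sup>+q. f p q \<partial>m) + 2 * (\<integral>\<^sup>+q. f q p \<partial>m) \<partial>m)"
      by (rule nn_integral_cong)
    also have "\<dots> = 2 * (\<integral>\<^sup>+p. \<integral>\<^sup>+q. f p q \<partial>m \<partial>m) + 2 * (\<integral>\<^sup>+p. \<integral>\<^sup>+q. f q p \<partial>m \<partial>m)"
      by (subst nn_integral_add) (simp_all add: nn_integral_cmult)
    finally show ?thesis .
  qed
  also have "(\<integral>\<^sup>+p. \<integral>\<^sup>+q. f q p \<partial>m \<partial>m) = (\<integral>\<^sup>+p. \<integral>\<^sup>+q. f p q \<partial>m \<partial>m)"
    by (rule pm.Fubini') measurable
  also have "2 * (\<integral>\<^sup>+p. \<integral>\<^sup>+q. f p q \<partial>m \<partial>m) + 2 * (\<integral>\<^sup>+p. \<integral>\<^sup>+q. f p q \<partial>m \<partial>m)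
      = 4 * (\<integral>\<^sup>+p. \<integral>\<^sup>+q. f p q \<partial>m \<partial>m)"
    by (simp flip: distrib_right)
  also have "(\<integral>\<^sup>+p. \<integral>\<^sup>+q. f p q \<partial>m \<partial>m) \<le> (\<integral>\<^sup>+p. ennreal ((u p)\<^sup>2) * ennreal (CT / \<phi> s) \<partial>m)"
  proof (intro nn_integral_mono)
    fix p assume p: "p \<in> space m"
    have [measurable]: "(\<lambda>q. ennreal (J p q)) \<in> borel_measurable m"
      using measurable_compose[OF measurable_Pair1'[OF p] Jm] by simp
    have "(\<integral>\<^sup>+q. f p q \<partial>m) = ennreal ((u p)\<^sup>2) * (\<integral>\<^sup>+q. ennreal (J p q) * indicator far (p, q) \<partial>m)"
      unfolding f_def by (rule nn_integral_cmult) (use p in measurable)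
    also have "(\<integral>\<^sup>+q. ennreal (J p q) * indicator far (p, q) \<partial>m)
        = (\<integral>\<^sup>+q. ennreal (J p q) * indicator {q. s \<le> d p q} q \<partial>m)"
      using p by (intro nn_integral_cong) (simp add: far_def indicator_def space_pair_measure)
    also have "\<dots> \<le> ennreal (CT / \<phi> s)"
      using p s by (intro tail_bound) auto
    finally show "(\<integral>\<^sup>+q. f p q \<partial>m) \<le> ennreal ((u p)\<^sup>2) * ennreal (CT / \<phi> s)"
      by (simp add: mult_left_mono)
  qed
  also have "\<dots> = (\<integral>\<^sup>+p. ennreal ((u p)\<^sup>2) \<partial>m) * ennreal (CT / \<phi> s)"
    by (rule nn_integral_multc) measurable
  finally have "JI {z. s \<le> d (fst z) (snd z)} u
      \<le> 4 * ((\<integral>\<^sup>+p. ennreal ((u p)\<^sup>2) \<partial>m) * ennreal (CT / \<phi> s))"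
    by (meson mult_left_mono zero_le)
  also have "\<dots> = ennreal (4 * CT / \<phi> s) * (\<integral>\<^sup>+p. ennreal ((u p)\<^sup>2) \<partial>m)"
    by (simp add: mult_ac ennreal_mult' flip: times_divide_eq_right)
  finally show ?thesis .
qed

lemma JI_null:
  assumes [measurable]: "u \<in> borel_measurable m" and N: "N \<in> null_sets m"
  shows "JI (N \<times> M \<union> M \<times> N) u = 0"
proof -
  have [measurable]: "N \<in> sets m" "M \<in> sets m"
    using N sets.top[of m] by auto
  have "emeasure m2 (N \<times> M) = 0" "emeasure m2 (M \<times> N) = 0"
    using N by (simp_all add: sf.emeasure_pair_measure_Times null_sets_def)
  then have "N \<times> M \<union> M \<times> N \<in> null_sets m2"
    by (intro null_sets.Un) (auto simp: null_sets_def)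
  then show ?thesis
    unfolding JI_eq by (rule nn_integral_null_set)
qed

text \<open>With \<open>N\<close> the part of the frontier in some ball, the density \<open>m (ball p t \<inter> D) / m (ball p t)\<close>
  is bounded below on \<open>N\<close>. By Fubini its integral over \<open>N\<close> is at most a constant times the measure
  of the points of \<open>D\<close> within \<open>t\<close> of \<open>N\<close>, which tends to \<open>0\<close> with \<open>t\<close>. No covering theorem
  is needed.\<close>

lemma frontier_null:
  assumes op: "openin top D" and reg: "ahlfors_regular cD X m D"
  shows "metric_closure X D - D \<in> null_sets m"
proof -
  define N where "N = metric_closure X D - D"
  have N_sets [measurable]: "N \<in> sets m"
    unfolding N_def metric_closure_def using op by (intro sets.Diff closedin_sets openin_sets) auto
  have D_sets [measurable]: "D \<in> sets m"
    using op by (rule openin_sets)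
  have DM: "D \<subseteq> M"
    using openin_subset[OF op] by simp
  have NM: "N \<subseteq> M"
    by (metis Diff_subset N_def closure_of_subset_topspace metric_closure_def order_trans topspace_mtopology_of)
  have near: "\<exists>y\<in>D. d p y < e" if "p \<in> N" "0 < e" for p e
    using that unfolding N_def metric_closure_def top_eq MS.metric_closure_of by (auto simp: MS.in_mball)
  have cD: "0 < cD"
    using reg by (simp add: ahlfors_regular_def)
  show ?thesis
  \<comment> \<open>Diameter 0 leaves no admissible radius in the regularity condition, so this case
    is treated separately: \<open>D\<close> has at most one point and hence no frontier.\<close>
  proof (cases "ediam X D = 0")
    case True
    have same: "y = y'" if "y \<in> D" "y' \<in> D" for y y'
    proof -
      have "ennreal (d y y') \<le> ediam X D"
        unfolding ediam_def using that by (intro SUP_upper2[of y] SUP_upper2[of y']) auto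
      then show ?thesis
        using True that DM MS.zero[of y y'] MS.nonneg[of y y']
        by (metis antisym ennreal_eq_0_iff le_zero_eq subsetD)
    qed
    have "N = {}"
    proof (rule ccontr)
      assume "N \<noteq> {}"
      then obtain p where p: "p \<in> N" by auto
      obtain y where y: "y \<in> D" using near[OF p, of 1] by auto
      have "p \<noteq> y" using p y by (auto simp: N_def)
      then have "0 < d p y"
        using p y NM DM MS.mdist_pos_less by blast
      with near[OF p this] same[OF y] show False by auto
    qed
    then show ?thesis by (metis N_def null_sets.empty_sets)
  next
    case False
    then obtain e where e: "0 < e" "e < ediam X D / 2"
      using dense[of 0 "ediam X D / 2"] by (auto simp: ennreal_divide_eq_0_iff zero_less_iff_neq_zero)
    define t0 where "t0 = enn2real e"
    have "e \<noteq> \<infinity>"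
      using e by auto
    then have t0: "0 < t0" "ennreal t0 < ediam X D / 2"
      using e by (auto simp: t0_def enn2real_positive_iff less_top)
    \<comment> \<open>Regularity speaks of centres in \<open>D\<close> only. It is applied at a
      point \<open>y\<close> of \<open>D\<close> within t/2 of \<open>p\<close> with radius t/2, and
      that ball lies inside \<open>ball p t\<close>.\<close>
    have lower: "ennreal (cD / NV) * emeasure m (ball p t) \<le> emeasure m (ball p t \<inter> D)"
      if p: "p \<in> N" and t: "0 < t" "t < t0" for p t
    proof -
      obtain y where y: "y \<in> D" "d p y < t / 2"
        using near[OF p, of "t / 2"] t by auto
      have pM: "p \<in> M" and yM: "y \<in> M"
        using p y NM DM by auto
      have "V p t \<le> NV * V y (t / 2)"
        using pM yM y t by (intro V_le) auto
      then have "V p t / NV \<le> V y (t / 2)"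
        using NV_ge_1 by (simp add: pos_divide_le_eq mult.commute)
      then have "cD / NV * V p t \<le> cD * V y (t / 2)"
        using mult_left_mono[of "V p t / NV" "V y (t / 2)" cD] cD by simp
      then have "ennreal (cD / NV) * emeasure m (ball p t) \<le> ennreal cD * emeasure m (ball y (t / 2))"
        using pM yM cD NV_ge_1 by (simp only: emeasure_ball flip: ennreal_mult) (simp add: ennreal_leI flip: ennreal_mult)
      also have "\<dots> \<le> emeasure m (ball y (t / 2) \<inter> D)"
      proof -
        have "ennreal (t / 2) < ediam X D / 2"
          using t by (intro le_less_trans[OF _ t0(2)] ennreal_leI) simp
        then show ?thesis
          using reg y t unfolding ahlfors_regular_def by auto
      qed
      also have "\<dots> \<le> emeasure m (ball p t \<inter> D)"
        by (intro emeasure_mono subsetI) (use MS.triangle[OF pM yM] pM yM y in \<open>force+\<close>)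
      finally show ?thesis .
    qed
    \<comment> \<open>Localised to a ball, because continuity from above is used below and requires
      the sets \<open>U (t n)\<close> to have finite measure.\<close>
    have null: "emeasure m (N \<inter> ball o' R) = 0" if o': "o' \<in> M" for o' R
    proof -
      define N' where "N' = N \<inter> ball o' R"
      have [measurable]: "N' \<in> sets m"
        by (simp add: N'_def)
      define U where "U t = {y \<in> D. \<exists>p\<in>N'. d p y < t}" for t
      have U_open: "openin top (U t)" for t
      proof -
        have "U t = D \<inter> (\<Union>p\<in>N'. ball p t)"
          using DM NM unfolding U_def N'_def by fastforce
        then show ?thesis
          using op by (simp add: openin_Int openin_Union ball_UN openin_clauses(3))
      qed
      have [measurable]: "U t \<in> sets m" for t
        using U_open by (rule openin_sets)
      have bound: "ennreal (cD / NV) * emeasure m N' \<le> ennreal NV * emeasure m (U t)" if t: "0 < t" "t < t0" for t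
      proof -
        define S where "S = {z \<in> space m2. d (fst z) (snd z) < t}"
        have [measurable]: "S \<in> sets m2"
          unfolding S_def by measurable
        define W where "W p = emeasure m (ball p t)" for p
        have W_eq: "W p = (\<integral>\<^sup>+y. indicator S (p, y) \<partial>m)" if "p \<in> M" for p
        proof -
          have "W p = (\<integral>\<^sup>+y. indicator (ball p t) y \<partial>m)"
            by (simp add: W_def)
          also have "\<dots> = (\<integral>\<^sup>+y. indicator S (p, y) \<partial>m)"
            using that by (intro nn_integral_cong) (auto simp: S_def indicator_def space_pair_measure)
          finally show ?thesis .
        qed
        have [measurable]: "W \<in> borel_measurable m"
          by (subst measurable_cong[OF W_eq]) simp_all
        have "ennreal (cD / NV) * emeasure m N' = (\<integral>\<^sup>+p. ennreal (cD / NV) * indicator N' p \<partial>m)"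
          by (simp add: nn_integral_cmult_indicator)
        also have "\<dots> \<le> (\<integral>\<^sup>+p. \<integral>\<^sup>+y. indicator N' p * indicator D y * indicator S (p, y) / W p \<partial>m \<partial>m)"
        proof (intro nn_integral_mono)
          fix p assume "p \<in> space m"
          then have pM: "p \<in> M" by simp
          have Wp: "0 < W p" "W p < \<infinity>"
            using pM t emeasure_ball_pos emeasure_ball_finite by (auto simp: W_def)
          show "ennreal (cD / NV) * indicator N' p
              \<le> (\<integral>\<^sup>+y. indicator N' p * indicator D y * indicator S (p, y) / W p \<partial>m)"
          proof (cases "p \<in> N'")
            case True
            have "ennreal (cD / NV) = ennreal (cD / NV) * W p / W p"
              using Wp by (simp add: mult_divide_eq_ennreal less_top)
            also have "\<dots> \<le> emeasure m (ball p t \<inter> D) / W p"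
              using lower[of p t] True t by (intro divide_right_mono_ennreal) (auto simp: W_def N'_def)
            also have "emeasure m (ball p t \<inter> D) = (\<integral>\<^sup>+y. indicator (ball p t \<inter> D) y \<partial>m)"
              by simp
            also have "\<dots> / W p = (\<integral>\<^sup>+y. indicator (ball p t \<inter> D) y / W p \<partial>m)"
              by (rule nn_integral_divide[symmetric]) simp
            also have "\<dots> = (\<integral>\<^sup>+y. indicator N' p * indicator D y * indicator S (p, y) / W p \<partial>m)"
              using True pM DM by (intro nn_integral_cong) (auto simp: S_def indicator_def space_pair_measure)
            finally show ?thesis
              using True by simp
          qed simp
        qed
        also have "\<dots> = (\<integral>\<^sup>+y. \<integral>\<^sup>+p. indicator N' p * indicator D y * indicator S (p, y) / W p \<partial>m \<partial>m)"
          by (rule pm.Fubini') measurable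
        also have "\<dots> \<le> (\<integral>\<^sup>+y. ennreal NV * indicator (U t) y \<partial>m)"
        proof (intro nn_integral_mono)
          fix y assume "y \<in> space m"
          then have yM: "y \<in> M" by simp
          have Wy: "0 < W y" "W y < \<infinity>"
            using yM t emeasure_ball_pos emeasure_ball_finite by (auto simp: W_def)
          \<comment> \<open>With \<open>y\<close> fixed, 1 / \<open>W p\<close> is replaced by
            \<open>NV\<close> / \<open>W y\<close>. The integral over \<open>p\<close> then
            contributes at most the measure \<open>W y\<close> of \<open>ball y t\<close>, which
            cancels.\<close>
          have "indicator N' p * indicator D y * indicator S (p, y) / W p
              \<le> (ennreal NV / W y * indicator (U t) y) * indicator (ball y t) p" if "p \<in> M" for p
          proof (cases "p \<in> N' \<and> y \<in> D \<and> d p y < t")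
            case True
            have "V y t \<le> NV * V p t"
              using True that yM t by (intro V_le) (auto simp: MS.commute)
            then have "1 / V p t \<le> NV / V y t"
              using that yM t V_pos by (simp add: field_simps)
            moreover have "1 / W p = ennreal (1 / V p t)" "ennreal NV / W y = ennreal (NV / V y t)"
              using that yM t V_pos NV_ge_1
              by (simp_all add: W_def emeasure_ball divide_ennreal flip: ennreal_1)
            ultimately have "1 / W p \<le> ennreal NV / W y"
              by (simp add: ennreal_leI)
            moreover have "y \<in> U t" "p \<in> ball y t"
              using True that yM by (auto simp: U_def MS.commute)
            ultimately show ?thesis
              using True that by (simp add: S_def indicator_def)
          qed (auto simp: S_def indicator_def)
          then have "(\<integral>\<^sup>+p. indicator N' p * indicator D y * indicator S (p, y) / W p \<partial>m)
              \<le> (\<integral>\<^sup>+p. (ennreal NV / W y * indicator (U t) y) * indicator (ball y t) p \<partial>m)"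
            by (intro nn_integral_mono) simp
          also have "\<dots> = ennreal NV / W y * indicator (U t) y * W y"
            by (simp add: nn_integral_cmult_indicator W_def)
          also have "\<dots> = ennreal NV * (W y / W y) * indicator (U t) y"
            by (metis ennreal_divide_times mult.assoc mult.commute)
          also have "\<dots> = ennreal NV * indicator (U t) y"
            using Wy by simp
          finally show "(\<integral>\<^sup>+p. indicator N' p * indicator D y * indicator S (p, y) / W p \<partial>m)
              \<le> ennreal NV * indicator (U t) y" .
        qed
        also have "\<dots> = ennreal NV * emeasure m (U t)"
          by (simp add: nn_integral_cmult_indicator)
        finally show ?thesis .
      qed
      define t where "t n = t0 / 2 * (1 / 2) ^ n" for n :: nat
      have t: "0 < t n" "t n < t0" for n
        using t0 power_le_one[of "1 / 2 :: real" n] by (auto simp: t_def)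
      have t_lim: "t \<longlonglongrightarrow> 0"
        unfolding t_def by (intro tendsto_mult_right_zero LIMSEQ_power_zero) simp
      have dec: "decseq (\<lambda>n. U (t n))"
      proof (rule decseq_SucI)
        fix n
        have "t (Suc n) \<le> t n"
          using t0 by (simp add: t_def)
        then show "U (t (Suc n)) \<subseteq> U (t n)"
          by (force simp: U_def)
      qed
      have "U (t n) \<subseteq> ball o' (R + t0)" for n
      proof
        fix y assume "y \<in> U (t n)"
        then obtain p where p: "p \<in> N'" "d p y < t n" "y \<in> D"
          by (auto simp: U_def)
        then show "y \<in> ball o' (R + t0)"
          using MS.triangle[of o' p y] DM o' t(2)[of n] by (auto simp: N'_def)
      qed
      then have fin: "emeasure m (U (t n)) \<noteq> \<infinity>" for n
        using emeasure_mono[of "U (t n)" "ball o' (R + t0)" m] emeasure_ball_finite[OF o', of "R + t0"]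
        by (metis ball_sets infinity_ennreal_def leD less_top)
      \<comment> \<open>A point of the open set \<open>D\<close> has a ball inside \<open>D\<close>,
        hence free of frontier points, so it leaves \<open>U (t n)\<close> once \<open>t n\<close>
        is below the radius.\<close>
      have "(\<Inter>n. U (t n)) = {}"
      proof (rule ccontr)
        assume "(\<Inter>n. U (t n)) \<noteq> {}"
        then obtain y where y: "\<And>n. y \<in> U (t n)" by auto
        then have yD: "y \<in> D" by (simp add: U_def)
        then obtain e where e: "0 < e" "ball y e \<subseteq> D"
          using op unfolding top_eq ball_eq by (metis MS.openin_mtopology)
        obtain n where "t n < e"
          using order_tendstoD(2)[OF t_lim e(1)] by (auto simp: eventually_sequentially)
        moreover obtain p where "p \<in> N'" "d p y < t n"
          using y[of n] by (auto simp: U_def)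
        ultimately have "p \<in> ball y e" "p \<notin> D"
          using yD DM NM by (auto simp: N'_def N_def MS.commute)
        then show False using e by auto
      qed
      then have "(\<lambda>n. emeasure m (U (t n))) \<longlonglongrightarrow> 0"
        using Lim_emeasure_decseq[OF _ dec fin] by (simp add: image_subset_iff)
      then have "(\<lambda>n. ennreal NV * emeasure m (U (t n))) \<longlonglongrightarrow> ennreal NV * 0"
        by (intro ennreal_tendsto_cmult) auto
      then have "ennreal (cD / NV) * emeasure m N' \<le> 0"
        using bound t by (intro LIMSEQ_le_const) auto
      then show ?thesis
        using cD NV_ge_1 by (auto simp: N'_def ennreal_eq_0_iff divide_le_0_iff)
    qed
    show ?thesis
    proof (cases "N = {}")
      case False
      then obtain p where p: "p \<in> M"
        using NM by auto
      have "N = (\<Union>n::nat. N \<inter> ball p n)"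
        using p NM reals_Archimedean2 by fastforce
      moreover have "(\<Union>n::nat. N \<inter> ball p n) \<in> null_sets m"
        using null[OF p] by (intro null_sets_UN) (auto simp: null_sets_def)
      ultimately show ?thesis
        by (simp add: N_def)
    qed (metis N_def null_sets.empty_sets)
  qed
qed

end

section \<open>Whitney covers and partitions of unity\<close>

lemma infsum_eq_sum:
  assumes "finite T" "T \<subseteq> A" "\<And>i. i \<in> A - T \<Longrightarrow> f i = (0 :: real)"
  shows "infsum f A = sum f T"
proof -
  have "infsum f A = infsum f T"
    using assms by (intro infsum_cong_neutral) auto
  then show ?thesis
    using assms by simp
qed

text \<open>Along an enumeration of \<open>A\<close> the finite partial sums are eventually constant
  at each point, so the sum is a pointwise limit of measurable functions.\<close>

lemma borel_measurable_infsum_finite_support: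
  fixes f :: "'i \<Rightarrow> 'a \<Rightarrow> real"
  assumes A: "countable A" and f: "\<And>i. i \<in> A \<Longrightarrow> f i \<in> borel_measurable N"
    and fin: "\<And>y. y \<in> space N \<Longrightarrow> finite {i \<in> A. f i y \<noteq> 0}"
  shows "(\<lambda>y. \<Sum>\<^sub>\<infinity>i\<in>A. f i y) \<in> borel_measurable N"
proof (rule borel_measurable_LIMSEQ_real)
  define A' where "A' n = {i \<in> A. to_nat_on A i < n}" for n
  have fin_A': "finite (A' n)" for n
    using A finite_vimage_IntI[OF finite_lessThan[of n], of "to_nat_on A" A]
    by (auto simp: A'_def vimage_def Int_def conj_commute inj_on_to_nat_on)
  show "(\<lambda>y. \<Sum>i\<in>A' n. f i y) \<in> borel_measurable N" for n
    using f by (intro borel_measurable_sum) (auto simp: A'_def)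
  fix y assume y: "y \<in> space N"
  define T where "T = {i \<in> A. f i y \<noteq> 0}"
  have T: "finite T" "T \<subseteq> A"
    using fin[OF y] by (auto simp: T_def)
  have "eventually (\<lambda>n. T \<subseteq> A' n) sequentially"
  proof (rule eventually_sequentiallyI)
    fix n assume n: "Suc (Max (insert 0 (to_nat_on A ` T))) \<le> n"
    have "to_nat_on A i < n" if "i \<in> T" for i
      using Max_ge[of "insert 0 (to_nat_on A ` T)" "to_nat_on A i"] T n that by (simp add: Suc_le_eq le_less_trans)
    then show "T \<subseteq> A' n"
      using T by (auto simp: A'_def)
  qed
  then have "eventually (\<lambda>n. (\<Sum>i\<in>A' n. f i y) = (\<Sum>\<^sub>\<infinity>i\<in>A. f i y)) sequentially"
  proof eventually_elim
    case (elim n)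
    show ?case
      using fin_A'[of n] elim by (intro infsum_eq_sum[symmetric]) (auto simp: A'_def T_def)
  qed
  then show "(\<lambda>n. \<Sum>i\<in>A' n. f i y) \<longlonglongrightarrow> (\<Sum>\<^sub>\<infinity>i\<in>A. f i y)"
    by (rule tendsto_eventually)
qed

text \<open>The passage between the \<open>ennreal\<close> and the real description of the energy;
  the 2 undoes the factor 1/2 of the form. Finiteness matters because the Bochner integral of a
  non-integrable function defaults to 0.\<close>

lemma jump_integral_eq_jump_form:
  assumes "(\<lambda>z. indicator (D \<times> D) z * ((u (fst z) - u (snd z))\<^sup>2 * J (fst z) (snd z))) \<in> borel_measurable (m \<Otimes>\<^sub>M m)"
    and nonneg: "\<And>p q. p \<in> D \<Longrightarrow> q \<in> D \<Longrightarrow> 0 \<le> J p q"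
    and fin: "jump_integral m J (D \<times> D) u < \<infinity>"
  shows "jump_integral m J (D \<times> D) u = ennreal (2 * jump_form m J D u u)"
    and "0 \<le> jump_form m J D u u"
proof -
  define f where "f z = indicator (D \<times> D) z * ((u (fst z) - u (snd z))\<^sup>2 * J (fst z) (snd z))" for z
  have f_nonneg: "0 \<le> f z" for z
    using nonneg by (auto simp: f_def indicator_def)
  have JI: "jump_integral m J (D \<times> D) u = (\<integral>\<^sup>+z. ennreal (f z) \<partial>(m \<Otimes>\<^sub>M m))"
    unfolding jump_integral_def by (intro nn_integral_cong) (auto simp: f_def indicator_def)
  have "integrable (m \<Otimes>\<^sub>M m) f"
    using assms(1) fin f_nonneg unfolding JI by (intro integrableI_nonneg) (auto simp: f_def[abs_def])
  then have "(\<integral>\<^sup>+z. ennreal (f z) \<partial>(m \<Otimes>\<^sub>M m)) = ennreal (LINT z|(m \<Otimes>\<^sub>M m). f z)"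
    using f_nonneg by (intro nn_integral_eq_integral) auto
  moreover have form: "2 * jump_form m J D u u = (LINT z|(m \<Otimes>\<^sub>M m). f z)"
    unfolding jump_form_def set_lebesgue_integral_def f_def by (simp add: power2_eq_square)
  ultimately show "jump_integral m J (D \<times> D) u = ennreal (2 * jump_form m J D u u)"
    by (simp only: JI)
  show "0 \<le> jump_form m J D u u"
  proof -
    have "0 \<le> (LINT z|(m \<Otimes>\<^sub>M m). f z)"
      using f_nonneg by (intro Bochner_Integration.integral_nonneg)
    then show ?thesis
      using form by linarith
  qed
qed

locale whitney_partition = doubling_jump_space X m J \<phi> CV c1 c2 \<beta>1 \<beta>2 C1 C2
  for X :: "'a metric" and m :: "'a measure" and J :: "'a \<Rightarrow> 'a \<Rightarrow> real" and \<phi> :: "real \<Rightarrow> real"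
    and CV c1 c2 \<beta>1 \<beta>2 C1 C2 :: real +
  fixes D :: "'a set" and I :: "'i set" and x :: "'i \<Rightarrow> 'a" and r :: "'i \<Rightarrow> real"
    and \<eta> :: "'i \<Rightarrow> 'a \<Rightarrow> real" and C\<eta> :: real
  assumes D_open: "openin top D" and D_proper: "metric_closure X D \<subset> M"
    and whitney: "whitney_cover X D I x r"
    and cutoff: "cutoff_functions C\<eta> \<phi> X m (jump_domain m J) (energy m J) I x r \<eta>"
begin

abbreviation cl where "cl \<equiv> metric_closure X D"

definition U where "U = M - cl"

lemma D_sub: "D \<subseteq> cl" and cl_sub: "cl \<subseteq> M" and DM: "D \<subseteq> M"
proof -
  show DM: "D \<subseteq> M"
    using openin_subset[OF D_open] by simp
  show "cl \<subseteq> M"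
    using D_proper by auto
  show "D \<subseteq> cl"
    unfolding metric_closure_def using DM by (intro closure_of_subset) simp
qed

lemma D_sets [measurable]: "D \<in> sets m"
  using D_open by (rule openin_sets)

lemma cl_sets [measurable]: "cl \<in> sets m"
  unfolding metric_closure_def by (intro closedin_sets) simp

lemma U_sets [measurable]: "U \<in> sets m"
  using sets.compl_sets[OF cl_sets] by (simp add: U_def)

lemma M_sets [measurable]: "M \<in> sets m"
  using sets.top[of m] by simp

section \<open>Geometry of the Whitney cover\<close>

lemma x_M: "i \<in> I \<Longrightarrow> x i \<in> M" and r_pos: "i \<in> I \<Longrightarrow> 0 < r i"
  using whitney by (auto simp: whitney_cover_def)

lemma dist_cl: "i \<in> I \<Longrightarrow> esetdist X (x i) cl = ennreal (5 * r i)"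
  using whitney by (auto simp: whitney_cover_def)

lemma dist_ge:
  assumes "i \<in> I" "c \<in> cl"
  shows "5 * r i \<le> d (x i) c"
proof -
  have "ennreal (5 * r i) \<le> ennreal (d (x i) c)"
    using dist_cl[OF assms(1)] assms(2) unfolding esetdist_def by (metis INF_lower)
  then show ?thesis
    using r_pos[OF assms(1)] by (simp add: ennreal_le_iff)
qed

lemma dist_near:
  assumes "i \<in> I" "0 < e"
  obtains c where "c \<in> cl" "d (x i) c < 5 * r i + e"
proof -
  have "(INF y\<in>cl. ennreal (d (x i) y)) < ennreal (5 * r i + e)"
    using dist_cl[OF assms(1)] assms r_pos[OF assms(1)]
    unfolding esetdist_def by (simp add: ennreal_less_iff del: ennreal_plus)
  then obtain c where "c \<in> cl" "ennreal (d (x i) c) < ennreal (5 * r i + e)"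
    by (auto simp: INF_less_iff)
  then show ?thesis
    using that by (simp add: ennreal_less_iff del: ennreal_plus)
qed

text \<open>The distance to the closure is 1-Lipschitz, and at \<open>x i\<close> it equals
  \<open>5 * r i\<close>. The infimum need not be attained, hence the approximation.\<close>

lemma r_diff:
  assumes "i \<in> I" "j \<in> I"
  shows "5 * r i \<le> d (x i) (x j) + 5 * r j"
proof (rule field_le_epsilon)
  fix e :: real assume "0 < e"
  then obtain c where c: "c \<in> cl" "d (x j) c < 5 * r j + e"
    using dist_near[OF assms(2)] by blast
  have "d (x i) c \<le> d (x i) (x j) + d (x j) c"
    using c assms cl_sub x_M by (intro MS.triangle) auto
  then show "5 * r i \<le> d (x i) (x j) + 5 * r j + e"
    using dist_ge[OF assms(1) c(1)] c(2) by simp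
qed

lemma ball_U: "i \<in> I \<Longrightarrow> y \<in> M \<Longrightarrow> d (x i) y < 5 * r i \<Longrightarrow> y \<in> U"
  using dist_ge[of i y] by (force simp: U_def)

lemma cover:
  assumes "y \<in> U"
  obtains j where "j \<in> I" "d (x j) y < 5 / 2 * r j"
proof -
  have "y \<in> (\<Union>i\<in>I. ball (x i) (5 / 2 * r i))"
    using assms whitney by (simp add: whitney_cover_def U_def)
  then show ?thesis
    using that by auto
qed

lemma disjoint_balls: "disjoint_family_on (\<lambda>i. ball (x i) (r i)) I"
  using whitney by (simp add: whitney_cover_def)

text \<open>Pairwise disjoint balls contain distinct points of a countable dense set.\<close>

lemma countable_I: "countable I"
proof -
  obtain Q where Q: "countable Q" "\<And>p e. p \<in> M \<Longrightarrow> 0 < e \<Longrightarrow> \<exists>q\<in>Q. d p q < e" "Q \<subseteq> M"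
    by (rule countable_dense) blast
  have "\<exists>q\<in>Q. q \<in> ball (x i) (r i)" if "i \<in> I" for i
    using Q(2)[OF x_M[OF that] r_pos[OF that]] Q(3) x_M[OF that] by auto
  then obtain q where q: "\<And>i. i \<in> I \<Longrightarrow> q i \<in> Q \<and> q i \<in> ball (x i) (r i)"
    by metis
  have "inj_on q I"
    using q disjoint_balls unfolding inj_on_def disjoint_family_on_def by (metis disjoint_iff)
  moreover have "countable (q ` I)"
    using q Q(1) by (auto intro: countable_subset)
  ultimately show ?thesis
    by (metis countable_image_inj_on)
qed

definition touched where "touched y = {i \<in> I. y \<in> M \<and> d (x i) y < 3 * r i}"

text \<open>Symmetric by design, so that double sums over neighbours can be exchanged. The factors 6
  and 4 are round bounds for what \<open>touched_nbr\<close> produces: radius ratios below 17/4 and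
  16/3 and distances below 3 * \<open>r i\<close> + 7/2 * \<open>r j\<close>.\<close>

definition nbr where
  "nbr j = {i \<in> I. r i \<le> 6 * r j \<and> r j \<le> 6 * r i \<and> d (x i) (x j) \<le> 4 * (r i + r j)}"

lemma touched_I: "touched y \<subseteq> I" and nbr_I: "nbr j \<subseteq> I"
  by (auto simp: touched_def nbr_def)

lemma nbr_sym: "j \<in> I \<Longrightarrow> i \<in> nbr j \<Longrightarrow> j \<in> nbr i"
  by (auto simp: nbr_def MS.commute)

text \<open>Both radius bounds follow from \<open>r_diff\<close> once the centres are known to be
  close. The 7/2 is 5/2 + 1: the point \<open>y\<close> may be a second point at distance less than
  \<open>r j\<close> from a point of the ball of radius 5/2 * \<open>r j\<close>.\<close>

lemma touched_nbr:
  assumes "j \<in> I" "d (x j) y < 7 / 2 * r j" "i \<in> touched y"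
  shows "i \<in> nbr j" "d (x i) (x j) < 3 * r i + 7 / 2 * r j" "r i < 17 / 4 * r j"
proof -
  have i: "i \<in> I" "y \<in> M" "d (x i) y < 3 * r i"
    using assms by (auto simp: touched_def)
  have "d (x i) (x j) \<le> d (x i) y + d y (x j)"
    using i assms x_M by (intro MS.triangle) auto
  then show d: "d (x i) (x j) < 3 * r i + 7 / 2 * r j"
    using i assms by (simp add: MS.commute)
  show "r i < 17 / 4 * r j"
    using r_diff[OF i(1) assms(1)] d by simp
  then show "i \<in> nbr j"
    using d r_diff[OF assms(1) i(1)] r_pos[OF i(1)] r_pos[OF assms(1)] i(1) by (auto simp: nbr_def MS.commute)
qed

lemma nbr_vol:
  assumes "j \<in> I" "i \<in> nbr j"
  shows "V (x j) (r j) \<le> NV * V (x i) (r i)" "\<phi> (r j) \<le> P\<phi> * \<phi> (r i)"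
proof -
  have i: "i \<in> I" "r j \<le> 6 * r i" "d (x i) (x j) \<le> 4 * (r i + r j)"
    using assms by (auto simp: nbr_def)
  show "V (x j) (r j) \<le> NV * V (x i) (r i)"
    using i r_pos[of i] r_pos[of j] assms(1) x_M by (intro V_le) (auto simp: MS.commute)
  show "\<phi> (r j) \<le> P\<phi> * \<phi> (r i)"
    using i r_pos[of i] r_pos[of j] assms(1) by (intro \<phi>_le) auto
qed

text \<open>A packing argument: the balls of the neighbours are disjoint, lie in one ball about
  \<open>x j\<close>, and each carries a fixed fraction of its volume. The bound is proved for
  finite subsets, which then yields finiteness.\<close>

lemma nbr_finite_card:
  assumes j: "j \<in> I"
  shows "finite (nbr j)" "real (card (nbr j)) \<le> NV"
proof -
  have *: "real (card A) \<le> NV" if A: "finite A" "A \<subseteq> nbr j" for A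
  proof -
    have AI: "A \<subseteq> I"
      using A nbr_I by auto
    \<comment> \<open>34 = 28 + 6: the centres are within 4 * (6 + 1) * \<open>r j\<close> of
      \<open>x j\<close>, and the radii are at most 6 * \<open>r j\<close>.\<close>
    define W where "W = V (x j) (34 * r j)"
    have W: "0 < W"
      using j r_pos x_M by (simp add: W_def V_pos)
    have small: "W \<le> NV * V (x i) (r i)" if "i \<in> A" for i
    proof -
      have i: "i \<in> I" "r j \<le> 6 * r i" "d (x i) (x j) \<le> 4 * (r i + r j)"
        using that A by (auto simp: nbr_def)
      show ?thesis
        unfolding W_def using i r_pos[of i] r_pos[of j] j x_M by (intro V_le) (auto simp: MS.commute)
    qed
    have sub: "ball (x i) (r i) \<subseteq> ball (x j) (34 * r j)" if "i \<in> A" for i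
    proof
      fix y assume y: "y \<in> ball (x i) (r i)"
      have i: "i \<in> I" "r i \<le> 6 * r j" "d (x i) (x j) \<le> 4 * (r i + r j)"
        using that A by (auto simp: nbr_def)
      have "d (x j) y \<le> d (x j) (x i) + d (x i) y"
        using y i j x_M by (intro MS.triangle) auto
      then show "y \<in> ball (x j) (34 * r j)"
        using y i j x_M r_pos[of j] by (auto simp: MS.commute)
    qed
    have "(\<Sum>i\<in>A. emeasure m (ball (x i) (r i))) = emeasure m (\<Union>i\<in>A. ball (x i) (r i))"
      using A AI disjoint_balls by (intro sum_emeasure) (auto intro: disjoint_family_on_mono)
    also have "\<dots> \<le> emeasure m (ball (x j) (34 * r j))"
      using sub by (intro emeasure_mono UN_least) auto
    also have "(\<Sum>i\<in>A. emeasure m (ball (x i) (r i))) = ennreal (\<Sum>i\<in>A. V (x i) (r i))"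
      using AI x_M emeasure_ball by (subst sum_ennreal[symmetric]) (auto intro!: sum.cong simp: subset_iff)
    finally have le: "(\<Sum>i\<in>A. V (x i) (r i)) \<le> W"
      using W by (simp add: emeasure_ball[OF x_M[OF j]] W_def)
    have "real (card A) * W = (\<Sum>i\<in>A. W)"
      by simp
    also have "\<dots> \<le> (\<Sum>i\<in>A. NV * V (x i) (r i))"
      using small by (rule sum_mono)
    also have "\<dots> \<le> NV * W"
      using le NV_ge_1 by (simp flip: sum_distrib_left)
    finally show ?thesis
      using W by simp
  qed
  have "finite (nbr j) \<and> card (nbr j) \<le> nat \<lfloor>NV\<rfloor>"
    using * by (intro finite_if_finite_subsets_card_bdd) (auto simp: le_nat_floor)
  then show "finite (nbr j)" by simp
  then show "real (card (nbr j)) \<le> NV"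
    using * by simp
qed

lemma touched_outside: "y \<notin> U \<Longrightarrow> touched y = {}"
  using ball_U r_pos by (force simp: touched_def)

lemma touched_finite: "finite (touched y)"
proof (cases "y \<in> U")
  case True
  then obtain j where j: "j \<in> I" "d (x j) y < 5 / 2 * r j"
    by (rule cover)
  then have "touched y \<subseteq> nbr j"
    using touched_nbr(1)[of j y] r_pos[of j] by fastforce
  then show ?thesis
    using nbr_finite_card(1)[OF j(1)] by (rule finite_subset)
qed (simp add: touched_outside)

section \<open>Cutoffs and the partition of unity\<close>

lemma \<eta>_01: "i \<in> I \<Longrightarrow> y \<in> M \<Longrightarrow> 0 \<le> \<eta> i y \<and> \<eta> i y \<le> 1"
  using cutoff by (simp add: cutoff_functions_def)

lemma \<eta>_1: "i \<in> I \<Longrightarrow> y \<in> M \<Longrightarrow> d (x i) y < 5 / 2 * r i \<Longrightarrow> \<eta> i y = 1"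
  using cutoff x_M[of i] by (auto simp: cutoff_functions_def)

lemma \<eta>_0: "i \<in> I \<Longrightarrow> y \<in> M \<Longrightarrow> i \<notin> touched y \<Longrightarrow> \<eta> i y = 0"
  using cutoff x_M[of i] by (auto simp: cutoff_functions_def touched_def)

lemma \<eta>_dom: "i \<in> I \<Longrightarrow> \<eta> i \<in> jump_domain m J"
  using cutoff by (simp add: cutoff_functions_def)

lemma \<eta>_measurable [measurable]: "i \<in> I \<Longrightarrow> \<eta> i \<in> borel_measurable m"
  using \<eta>_dom by (simp add: jump_domain_def L2_fun_def)

lemma C\<eta>_pos: "0 < C\<eta>"
  using cutoff by (simp add: cutoff_functions_def)

lemma \<eta>_energy:
  assumes i: "i \<in> I"
  shows "JI (M \<times> M) (\<eta> i) \<le> ennreal (2 * C\<eta> * V (x i) (r i) / \<phi> (r i))"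
proof -
  have [measurable]: "\<eta> i \<in> borel_measurable m"
    using i by measurable
  have "JI (M \<times> M) (\<eta> i) < \<infinity>"
    using \<eta>_dom[OF i] by (simp add: jump_domain_def)
  then have "JI (M \<times> M) (\<eta> i) = ennreal (2 * energy m J (\<eta> i) (\<eta> i))"
    using J_nonneg by (simp, intro jump_integral_eq_jump_form) auto
  also have "\<dots> \<le> ennreal (2 * (C\<eta> * V (x i) (r i) / \<phi> (r i)))"
    using cutoff i by (intro ennreal_leI mult_left_mono) (auto simp: cutoff_functions_def V_def)
  finally show ?thesis
    by (simp add: mult.assoc)
qed

definition S where "S y = (\<Sum>i\<in>touched y. \<eta> i y)"

lemma S_eq: "y \<in> M \<Longrightarrow> (\<Sum>\<^sub>\<infinity>j\<in>I. \<eta> j y) = S y"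
  unfolding S_def using touched_finite touched_I \<eta>_0 by (intro infsum_eq_sum) auto

lemma S_superset:
  assumes "finite A" "touched y \<subseteq> A" "A \<subseteq> I" "y \<in> M"
  shows "S y = (\<Sum>i\<in>A. \<eta> i y)"
  unfolding S_def using assms \<eta>_0 by (intro sum.mono_neutral_left) auto

lemma S_ge_1:
  assumes "y \<in> U"
  shows "1 \<le> S y"
proof -
  obtain j where j: "j \<in> I" "d (x j) y < 5 / 2 * r j"
    using assms by (rule cover)
  have yM: "y \<in> M"
    using assms by (simp add: U_def)
  have "j \<in> touched y"
    using j yM r_pos[OF j(1)] by (auto simp: touched_def)
  then have "\<eta> j y \<le> S y"
    unfolding S_def using touched_finite touched_I yM \<eta>_01 by (intro member_le_sum) (auto simp: subset_iff)
  then show ?thesis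
    using \<eta>_1[OF j(1) yM j(2)] by simp
qed

lemma S_measurable [measurable]: "S \<in> borel_measurable m"
proof -
  have "(\<lambda>y. \<Sum>\<^sub>\<infinity>j\<in>I. \<eta> j y) \<in> borel_measurable m"
  proof (rule borel_measurable_infsum_finite_support[OF countable_I \<eta>_measurable])
    fix y assume "y \<in> space m"
    then have "{i \<in> I. \<eta> i y \<noteq> 0} \<subseteq> touched y"
      using \<eta>_0 by auto
    then show "finite {i \<in> I. \<eta> i y \<noteq> 0}"
      using touched_finite by (rule finite_subset)
  qed
  then show ?thesis
    by (subst (asm) measurable_cong[OF S_eq]) auto
qed

definition \<psi> where "\<psi> i y = \<eta> i y / S y"

lemma \<psi>_measurable [measurable]: "i \<in> I \<Longrightarrow> \<psi> i \<in> borel_measurable m"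
  unfolding \<psi>_def by measurable

text \<open>On the closure no index is touched, so \<open>\<eta> i\<close> and \<open>S\<close>
  vanish there and the convention 0 / 0 = 0 gives the prescribed value.\<close>

lemma \<psi>_eq: "i \<in> I \<Longrightarrow> y \<in> M \<Longrightarrow> partition_function X D I \<eta> i y = \<psi> i y"
  using \<eta>_0[of i y] touched_outside[of y]
  by (auto simp: partition_function_def \<psi>_def S_eq U_def)

lemma \<psi>_0: "i \<in> I \<Longrightarrow> y \<in> M \<Longrightarrow> i \<notin> touched y \<Longrightarrow> \<psi> i y = 0"
  by (simp add: \<psi>_def \<eta>_0)

lemma \<psi>_nonneg: "i \<in> I \<Longrightarrow> y \<in> M \<Longrightarrow> 0 \<le> \<psi> i y"
  unfolding \<psi>_def S_def using \<eta>_01 touched_I by (intro divide_nonneg_nonneg sum_nonneg) auto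

lemma \<psi>_sum:
  assumes "finite A" "touched y \<subseteq> A" "A \<subseteq> I" "y \<in> U"
  shows "(\<Sum>i\<in>A. \<psi> i y) = 1"
proof -
  have "y \<in> M"
    using assms by (simp add: U_def)
  then show ?thesis
    using S_superset[OF assms(1-3)] S_ge_1[OF assms(4)] by (simp add: \<psi>_def flip: sum_divide_distrib)
qed

lemma \<psi>_le_1:
  assumes "i \<in> I" "y \<in> M"
  shows "\<psi> i y \<le> 1"
proof (cases "i \<in> touched y")
  case True
  then have "y \<in> U"
    using touched_outside by auto
  have "\<psi> i y \<le> (\<Sum>i\<in>touched y. \<psi> i y)"
    using True touched_finite touched_I assms by (intro member_le_sum \<psi>_nonneg) auto
  then show ?thesis
    using \<psi>_sum[OF touched_finite order_refl touched_I \<open>y \<in> U\<close>] by simp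
qed (use assms \<psi>_0 in simp)

lemma \<psi>_integral:
  assumes i: "i \<in> I"
  shows "(\<integral>\<^sup>+y. ennreal (\<psi> i y) \<partial>m) \<le> ennreal (NV * V (x i) (r i))"
proof -
  have "(\<integral>\<^sup>+y. ennreal (\<psi> i y) \<partial>m) \<le> (\<integral>\<^sup>+y. indicator (ball (x i) (3 * r i)) y \<partial>m)"
  proof (intro nn_integral_mono)
    fix y assume y: "y \<in> space m"
    show "ennreal (\<psi> i y) \<le> indicator (ball (x i) (3 * r i)) y"
      using y \<psi>_le_1[OF i, of y] \<psi>_0[OF i, of y] x_M[OF i] i
      by (cases "i \<in> touched y") (auto simp: touched_def indicator_def)
  qed
  also have "\<dots> = ennreal (V (x i) (3 * r i))"
    using i x_M by (simp add: emeasure_ball)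
  also have "\<dots> \<le> ennreal (NV * V (x i) (r i))"
    using i x_M r_pos[OF i] by (intro ennreal_leI V_le) auto
  finally show ?thesis .
qed

text \<open>Ordered pairs: only the first point is required to lie in the ball. The reversed pairs
  are recovered later with \<open>JI_swap\<close>.\<close>

definition near_at where
  "near_at j = {z \<in> space m2. d (x j) (fst z) < 5 / 2 * r j \<and> d (fst z) (snd z) < r j}"

lemma near_at_sets [measurable]:
  assumes "j \<in> I"
  shows "near_at j \<in> sets m2"
proof -
  have [measurable]: "d (x j) \<in> borel_measurable m"
    using assms x_M by measurable
  show ?thesis
    unfolding near_at_def by measurable
qed

lemma near_at_touched:
  assumes j: "j \<in> I" and z: "(p, y) \<in> near_at j"
  shows "touched p \<subseteq> nbr j" "touched y \<subseteq> nbr j" "j \<in> touched p"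
    "\<And>i. i \<in> touched p \<union> touched y \<Longrightarrow> r i < 17 / 4 * r j"
proof -
  have pyM: "p \<in> M" "y \<in> M" and d: "d (x j) p < 5 / 2 * r j" "d p y < r j"
    using z by (auto simp: near_at_def space_pair_measure)
  have "d (x j) y \<le> d (x j) p + d p y"
    using pyM j x_M by (intro MS.triangle) auto
  then have dy: "d (x j) y < 7 / 2 * r j" and dp: "d (x j) p < 7 / 2 * r j"
    using d r_pos[OF j] by auto
  show "touched p \<subseteq> nbr j" "touched y \<subseteq> nbr j"
    using touched_nbr(1)[OF j dp] touched_nbr(1)[OF j dy] by auto
  show "j \<in> touched p"
    using pyM j d r_pos[OF j] by (simp add: touched_def)
  show "\<And>i. i \<in> touched p \<union> touched y \<Longrightarrow> r i < 17 / 4 * r j"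
    using touched_nbr(3)[OF j dp] touched_nbr(3)[OF j dy] by auto
qed

text \<open>A constant \<open>b\<close> can be subtracted from the coefficients because the \<open>\<psi>\<close>'s sum to \<open>1\<close>.\<close>

lemma partition_oscillation:
  assumes A: "finite A" "A \<subseteq> I" "touched p \<subseteq> A" "touched q \<subseteq> A" and pq: "p \<in> U" "q \<in> U"
  shows "((\<Sum>i\<in>A. a i * \<psi> i p) - (\<Sum>i\<in>A. a i * \<psi> i q))\<^sup>2
    \<le> 4 * (real (card A))\<^sup>2 * (\<Sum>i\<in>A. (a i - b)\<^sup>2) * (\<Sum>k\<in>A. (\<eta> k p - \<eta> k q)\<^sup>2)"
proof -
  have pqM: "p \<in> M" "q \<in> M"
    using pq by (auto simp: U_def)
  define E where "E = (\<Sum>k\<in>A. \<bar>\<eta> k p - \<eta> k q\<bar>)"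
  have osc: "\<bar>\<psi> i p - \<psi> i q\<bar> \<le> 2 * E" if i: "i \<in> A" for i
  proof -
    have Sp: "1 \<le> S p" and Sq: "1 \<le> S q"
      using pq S_ge_1 by auto
    have "\<bar>S q - S p\<bar> \<le> E"
      unfolding E_def S_superset[OF A(1,3,2) pqM(1)] S_superset[OF A(1,4,2) pqM(2)]
      by (subst sum_subtractf[symmetric]) (subst abs_minus_commute, rule sum_abs)
    moreover have "\<bar>\<eta> i p - \<eta> i q\<bar> \<le> E"
      unfolding E_def using i A by (intro member_le_sum) auto
    \<comment> \<open>The quotient rule for differences. With 0 \<le> \<psi> \<le> 1 and S \<ge> 1,
      both the numerator \<eta>_i and the denominator \<open>S\<close> contribute at most
      \<open>E\<close>.\<close>
    moreover have "\<psi> i p - \<psi> i q = ((\<eta> i p - \<eta> i q) + \<psi> i q * (S q - S p)) / S p"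
      using Sp Sq by (simp add: \<psi>_def field_simps)
    moreover have "\<bar>\<psi> i q * (S q - S p)\<bar> \<le> 1 * \<bar>S q - S p\<bar>"
      unfolding abs_mult using i A pqM \<psi>_nonneg[of i q] \<psi>_le_1[of i q] by (intro mult_right_mono) auto
    ultimately have "\<bar>\<psi> i p - \<psi> i q\<bar> \<le> 2 * E / S p"
      using Sp by (simp add: divide_right_mono)
    also have "\<dots> \<le> 2 * E"
      using Sp divide_left_mono[of 1 "S p" "2 * E"] by (simp add: E_def sum_nonneg)
    finally show ?thesis .
  qed
  have "(\<Sum>i\<in>A. \<psi> i p) = 1" "(\<Sum>i\<in>A. \<psi> i q) = 1"
    using A pq by (auto intro: \<psi>_sum)
  then have "(\<Sum>i\<in>A. a i * \<psi> i p) - (\<Sum>i\<in>A. a i * \<psi> i q) = (\<Sum>i\<in>A. (a i - b) * (\<psi> i p - \<psi> i q))"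
    by (simp add: algebra_simps sum.distrib sum_subtractf flip: sum_distrib_left)
  also have "\<bar>\<dots>\<bar> \<le> (\<Sum>i\<in>A. \<bar>a i - b\<bar> * (2 * E))"
    using osc by (intro order_trans[OF sum_abs] sum_mono) (simp add: abs_mult mult_left_mono)
  also have "\<dots> = 2 * E * (\<Sum>i\<in>A. \<bar>a i - b\<bar>)"
    by (simp add: mult_ac flip: sum_distrib_left sum_distrib_right)
  finally have "((\<Sum>i\<in>A. a i * \<psi> i p) - (\<Sum>i\<in>A. a i * \<psi> i q))\<^sup>2 \<le> (2 * E * (\<Sum>i\<in>A. \<bar>a i - b\<bar>))\<^sup>2"
    by (rule power2_le_iff_abs_le[THEN iffD2, rotated]) (simp add: E_def sum_nonneg)
  also have "\<dots> = 4 * (E\<^sup>2 * (\<Sum>i\<in>A. \<bar>a i - b\<bar>)\<^sup>2)"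
    by (simp add: power_mult_distrib)
  \<comment> \<open>Cauchy-Schwarz in each of the two sums costs one factor
    \<open>card A\<close>.\<close>
  also have "\<dots> \<le> 4 * ((real (card A) * (\<Sum>k\<in>A. (\<eta> k p - \<eta> k q)\<^sup>2)) * (real (card A) * (\<Sum>i\<in>A. (a i - b)\<^sup>2)))"
  proof -
    have "E\<^sup>2 \<le> real (card A) * (\<Sum>k\<in>A. (\<eta> k p - \<eta> k q)\<^sup>2)"
      unfolding E_def using sum_squared_le_sum_of_squares[of "\<lambda>k. \<bar>\<eta> k p - \<eta> k q\<bar>" A] A(1)
      by (cases "A = {}") (auto simp: mult.commute)
    moreover have "(\<Sum>i\<in>A. \<bar>a i - b\<bar>)\<^sup>2 \<le> real (card A) * (\<Sum>i\<in>A. (a i - b)\<^sup>2)"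
      using sum_squared_le_sum_of_squares[of "\<lambda>i. \<bar>a i - b\<bar>" A] A(1)
      by (cases "A = {}") (auto simp: mult.commute)
    ultimately show ?thesis
      by (intro mult_left_mono mult_mono) (auto intro!: mult_nonneg_nonneg sum_nonneg)
  qed
  finally show ?thesis
    by (simp add: power2_eq_square mult_ac)
qed

end

section \<open>Averages and the extension\<close>

lemma sum_le_nn_integral_count_space:
  fixes f :: "'i \<Rightarrow> ennreal"
  assumes "finite T" "T \<subseteq> A"
  shows "sum f T \<le> (\<integral>\<^sup>+i. f i \<partial>count_space A)"
proof -
  have "sum f T = (\<integral>\<^sup>+i. f i * indicator T i \<partial>count_space A)"
    using assms by (subst nn_integral_count_space'[of T]) (auto simp: indicator_def)
  also have "\<dots> \<le> (\<integral>\<^sup>+i. f i \<partial>count_space A)"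
    by (intro nn_integral_mono) (simp add: indicator_def)
  finally show ?thesis .
qed

text \<open>Expand the nonnegative weighted sum of (c_i - s)^2 about the mean \<open>s\<close>.
  Total mass below 1 must be allowed, because the indices outside \<open>L\<close> are dropped from
  the extension.\<close>

lemma weighted_mean_square_le:
  fixes w c :: "'i \<Rightarrow> real"
  assumes nonneg: "\<And>i. i \<in> A \<Longrightarrow> 0 \<le> w i" and le: "sum w A \<le> 1"
  shows "(\<Sum>i\<in>A. w i * c i)\<^sup>2 \<le> (\<Sum>i\<in>A. w i * (c i)\<^sup>2)"
proof -
  define s where "s = (\<Sum>i\<in>A. w i * c i)"
  have "0 \<le> (\<Sum>i\<in>A. w i * (c i - s)\<^sup>2)"
    using nonneg by (intro sum_nonneg) simp
  also have "\<dots> = (\<Sum>i\<in>A. w i * (c i)\<^sup>2 - 2 * s * (w i * c i) + s\<^sup>2 * w i)"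
    by (intro sum.cong) (simp_all add: power2_diff algebra_simps)
  also have "\<dots> = (\<Sum>i\<in>A. w i * (c i)\<^sup>2) - 2 * s * s + s\<^sup>2 * sum w A"
    by (simp add: s_def sum.distrib sum_subtractf flip: sum_distrib_left)
  also have "\<dots> \<le> (\<Sum>i\<in>A. w i * (c i)\<^sup>2) - 2 * s * s + s\<^sup>2"
    using le by (simp add: mult_left_le)
  finally show ?thesis
    by (simp add: s_def power2_eq_square)
qed

text \<open>Here \<open>g i\<close> is a version of \<open>f\<^sub>i\<close> for which the almost everywhere conditions hold at every point,
  and \<open>h\<close> is the extension of \<open>u\<close>. As \<open>h = u\<close> on \<open>D\<close>, the function \<open>u\<close> need not be mentioned.\<close>

locale whitney_extension = whitney_partition X m J \<phi> CV c1 c2 \<beta>1 \<beta>2 C1 C2 D I x r \<eta> C\<eta>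
  for X :: "'a metric" and m :: "'a measure" and J :: "'a \<Rightarrow> 'a \<Rightarrow> real" and \<phi> :: "real \<Rightarrow> real"
    and CV c1 c2 \<beta>1 \<beta>2 C1 C2 :: real
    and D :: "'a set" and I :: "'i set" and x :: "'i \<Rightarrow> 'a" and r :: "'i \<Rightarrow> real"
    and \<eta> :: "'i \<Rightarrow> 'a \<Rightarrow> real" and C\<eta> :: real +
  fixes L :: "'i set" and g :: "'i \<Rightarrow> 'a \<Rightarrow> real" and Cf :: real and h :: "'a \<Rightarrow> real"
  assumes L_I: "L \<subseteq> I" and Cf_pos: "0 < Cf"
    and g_measurable [measurable]: "\<And>i. i \<in> L \<Longrightarrow> g i \<in> borel_measurable m"
    and g_nonneg: "\<And>i z. i \<in> L \<Longrightarrow> z \<in> mspace X \<Longrightarrow> 0 \<le> g i z"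
    and g_sum: "\<And>z. z \<in> mspace X \<Longrightarrow> (\<integral>\<^sup>+i. ennreal (g i z) \<partial>count_space L) \<le> indicator D z"
    and g_near: "\<And>i z. i \<in> L \<Longrightarrow> z \<in> mspace X \<Longrightarrow> g i z \<noteq> 0 \<Longrightarrow> mdist X z (x i) \<le> 9 * r i"
    and g_mass: "\<And>i. i \<in> L \<Longrightarrow> measure m (mball_of X (x i) (r i)) / Cf \<le> (LINT z|m. g i z)"
    and h_measurable [measurable]: "h \<in> borel_measurable m"
    and h_L2: "(\<integral>\<^sup>+z. ennreal ((h z)\<^sup>2) * indicator D z \<partial>m) < \<infinity>"
    and h_extension: "\<And>y. y \<in> U \<Longrightarrow>
      h y = (\<Sum>i\<in>touched y \<inter> L. (LINT z|m. g i z * h z) / (LINT z|m. g i z) * \<psi> i y)"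
begin

text \<open>The normalising mass of f_i; the quotient \<open>b i\<close> below is the average
  [u]_i.\<close>

definition F where "F i = (LINT z|m. g i z)"
definition b where "b i = (LINT z|m. g i z * h z) / F i"

lemma h_ext: "y \<in> U \<Longrightarrow> h y = (\<Sum>i\<in>touched y \<inter> L. b i * \<psi> i y)"
  unfolding b_def F_def by (rule h_extension)

lemma countable_L: "A \<subseteq> L \<Longrightarrow> countable A"
  using L_I countable_I by (auto intro: countable_subset)

section \<open>Integrability of the weights and Jensen's inequality for averages\<close>

lemma g_sum_subset:
  assumes L': "L' \<subseteq> L" and z: "z \<in> M"
  shows "(\<integral>\<^sup>+i. ennreal (g i z) \<partial>count_space L') \<le> indicator D z"
proof -
  have "(\<integral>\<^sup>+i. ennreal (g i z) \<partial>count_space L') = (\<integral>\<^sup>+i. ennreal (g i z) * indicator L' i \<partial>count_space L)"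
    using L' by (subst nn_integral_count_space_indicator[of L'])
      (auto simp: nn_integral_count_space_indicator[of L] mult.assoc Int_absorb2 intro!: nn_integral_cong split: split_indicator)
  also have "\<dots> \<le> (\<integral>\<^sup>+i. ennreal (g i z) \<partial>count_space L)"
    by (intro nn_integral_mono) (simp add: indicator_def)
  also have "\<dots> \<le> indicator D z"
    by (rule g_sum[OF z])
  finally show ?thesis .
qed

lemma g_le_indicator:
  assumes i: "i \<in> L" and z: "z \<in> M"
  shows "ennreal (g i z) \<le> indicator D z"
  using nn_integral_ge_point[OF i, of "\<lambda>i. ennreal (g i z)"] g_sum[OF z] by (rule order_trans)

lemma g_le_1:
  assumes "i \<in> L" "z \<in> M"
  shows "g i z \<le> 1"
proof -
  have "ennreal (g i z) \<le> ennreal 1"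
    using g_le_indicator[OF assms] by (rule order_trans) (simp add: indicator_def)
  then show ?thesis
    by (subst (asm) ennreal_le_iff) auto
qed

lemma g_outside: "i \<in> L \<Longrightarrow> z \<in> M \<Longrightarrow> z \<notin> D \<Longrightarrow> g i z = 0"
  using g_le_indicator[of i z] g_nonneg[of i z] by (simp add: ennreal_eq_0_iff)

lemma g_integrable:
  assumes i: "i \<in> L"
  shows "integrable m (g i)"
proof (rule integrableI_nonneg)
  have xi: "x i \<in> M" "0 < r i"
    using i L_I x_M r_pos by auto
  show "AE z in m. 0 \<le> g i z"
    using g_nonneg[OF i] by auto
  have "(\<integral>\<^sup>+z. ennreal (g i z) \<partial>m) \<le> (\<integral>\<^sup>+z. indicator (ball (x i) (10 * r i)) z \<partial>m)"
  proof (intro nn_integral_mono)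
    fix z assume "z \<in> space m"
    then show "ennreal (g i z) \<le> indicator (ball (x i) (10 * r i)) z"
      using g_near[OF i, of z] g_le_1[OF i, of z] xi
      by (cases "g i z = 0") (auto simp: indicator_def MS.commute)
  qed
  also have "\<dots> < \<infinity>"
    using emeasure_ball_finite[OF xi(1)] by simp
  finally show "(\<integral>\<^sup>+z. ennreal (g i z) \<partial>m) < \<infinity>" .
qed (use i in measurable)

lemma F_ge: "i \<in> L \<Longrightarrow> V (x i) (r i) \<le> Cf * F i"
  using g_mass[of i] Cf_pos by (simp add: V_def F_def field_simps)

lemma F_pos:
  assumes "i \<in> L"
  shows "0 < F i"
proof -
  have "0 < V (x i) (r i)"
    using assms L_I x_M r_pos by (intro V_pos) auto
  then have "0 < Cf * F i"
    using F_ge[OF assms] by linarith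
  then show ?thesis
    using Cf_pos by (simp add: zero_less_mult_iff)
qed

lemma g_h2_integrable:
  assumes i: "i \<in> L"
  shows "integrable m (\<lambda>z. g i z * (h z)\<^sup>2)"
proof (rule integrableI_nonneg)
  have [measurable]: "g i \<in> borel_measurable m"
    using i by measurable
  show "(\<lambda>z. g i z * (h z)\<^sup>2) \<in> borel_measurable m"
    by measurable
  show "AE z in m. 0 \<le> g i z * (h z)\<^sup>2"
    using g_nonneg[OF i] by auto
  have "(\<integral>\<^sup>+z. ennreal (g i z * (h z)\<^sup>2) \<partial>m) \<le> (\<integral>\<^sup>+z. ennreal ((h z)\<^sup>2) * indicator D z \<partial>m)"
  proof (intro nn_integral_mono)
    fix z assume "z \<in> space m"
    then show "ennreal (g i z * (h z)\<^sup>2) \<le> ennreal ((h z)\<^sup>2) * indicator D z"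
      using g_outside[OF i, of z] g_le_1[OF i, of z] g_nonneg[OF i, of z]
      by (cases "z \<in> D") (auto intro!: ennreal_leI mult_left_le_one_le mult_right_mono[of _ 1, simplified])
  qed
  also note h_L2
  finally show "(\<integral>\<^sup>+z. ennreal (g i z * (h z)\<^sup>2) \<partial>m) < \<infinity>" .
qed

lemma g_h_integrable:
  assumes i: "i \<in> L"
  shows "integrable m (\<lambda>z. g i z * h z)"
proof (rule Bochner_Integration.integrable_bound)
  show "integrable m (\<lambda>z. g i z + g i z * (h z)\<^sup>2)"
    using g_integrable[OF i] g_h2_integrable[OF i] by simp
  show "(\<lambda>z. g i z * h z) \<in> borel_measurable m"
    using i by measurable
  show "AE z in m. norm (g i z * h z) \<le> norm (g i z + g i z * (h z)\<^sup>2)"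
  proof (intro AE_I2)
    fix z assume z: "z \<in> space m"
    have "0 \<le> (\<bar>h z\<bar> - 1)\<^sup>2" by simp
    then have "\<bar>h z\<bar> \<le> 1 + (h z)\<^sup>2"
      by (simp add: power2_eq_square algebra_simps)
    then have "g i z * \<bar>h z\<bar> \<le> g i z * (1 + (h z)\<^sup>2)"
      using g_nonneg[OF i, of z] z by (intro mult_left_mono) auto
    then show "norm (g i z * h z) \<le> norm (g i z + g i z * (h z)\<^sup>2)"
      using g_nonneg[OF i, of z] z by (simp add: abs_mult distrib_left)
  qed
qed

text \<open>Expanding the square, the integral of \<open>g i z * (a - h z)\<close>^2 equals
  \<open>F i * (a - b i)\<close>^2 plus the same integral with \<open>b i\<close> in place of
  \<open>a\<close>, which is nonnegative.\<close>

lemma average_Jensen: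
  assumes i: "i \<in> L"
  shows "ennreal ((a - b i)\<^sup>2) \<le> (\<integral>\<^sup>+z. ennreal (g i z / F i * (a - h z)\<^sup>2) \<partial>m)"
proof -
  note int = g_integrable[OF i] g_h_integrable[OF i] g_h2_integrable[OF i]
  have quad: "(\<lambda>z. g i z * (c - h z)\<^sup>2) = (\<lambda>z. c\<^sup>2 * g i z - 2 * c * (g i z * h z) + g i z * (h z)\<^sup>2)" for c
    by (simp add: fun_eq_iff power2_diff algebra_simps)
  have quad_int: "integrable m (\<lambda>z. g i z * (c - h z)\<^sup>2)" for c
    unfolding quad using int by simp
  have quad_eq: "(LINT z|m. g i z * (c - h z)\<^sup>2) = c\<^sup>2 * F i - 2 * c * (b i * F i) + (LINT z|m. g i z * (h z)\<^sup>2)" for c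
    unfolding quad using int F_pos[OF i] by (simp add: F_def b_def)
  have "0 \<le> (LINT z|m. g i z * (b i - h z)\<^sup>2)"
    using g_nonneg[OF i] by (intro integral_nonneg_AE) auto
  then have "(a - b i)\<^sup>2 * F i \<le> (LINT z|m. g i z * (a - h z)\<^sup>2)"
    unfolding quad_eq by (simp add: power2_diff algebra_simps power2_eq_square)
  then have "(a - b i)\<^sup>2 \<le> (LINT z|m. g i z * (a - h z)\<^sup>2) / F i"
    using F_pos[OF i] by (simp add: pos_le_divide_eq)
  also have "\<dots> = (LINT z|m. g i z / F i * (a - h z)\<^sup>2)"
    by simp
  finally have "ennreal ((a - b i)\<^sup>2) \<le> ennreal (LINT z|m. g i z / F i * (a - h z)\<^sup>2)"
    by (rule ennreal_leI)
  also have "\<dots> = (\<integral>\<^sup>+z. ennreal (g i z / F i * (a - h z)\<^sup>2) \<partial>m)"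
    using quad_int[of a] g_nonneg[OF i] F_pos[OF i]
    by (intro nn_integral_eq_integral[symmetric]) (auto intro!: AE_I2)
  finally show ?thesis .
qed

text \<open>For \<open>y\<close> outside the closure, \<open>h y\<close> is the mean of \<open>h\<close> with respect to the probability density
  \<open>K L' y\<close> on \<open>D\<close>, provided that \<open>L'\<close> contains all indices that matter at \<open>y\<close>.\<close>

definition K where "K L' y z = (\<integral>\<^sup>+i. ennreal (\<psi> i y * (g i z / F i)) \<partial>count_space L')"

text \<open>Joint measurability in both points, required for the exchange of integrals. It is first
  shown jointly with the index, which is possible because the index set is countable.\<close>

lemma K_measurable [measurable]:
  assumes L': "L' \<subseteq> L"
  shows "case_prod (K L') \<in> borel_measurable m2"
proof -
  interpret cs: sigma_finite_measure "count_space L'"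
    using countable_L[OF L'] by (rule sigma_finite_measure_count_space_countable)
  have "(\<lambda>w. ennreal (\<psi> (snd w) (fst (fst w)) * (g (snd w) (snd (fst w)) / F (snd w))))
      \<in> borel_measurable (m2 \<Otimes>\<^sub>M count_space L')"
  proof (rule measurable_compose_countable'[where g = snd and I = L'
        and f = "\<lambda>i w. ennreal (\<psi> i (fst (fst w)) * (g i (snd (fst w)) / F i))"])
    fix i assume "i \<in> L'"
    then have [measurable]: "\<psi> i \<in> borel_measurable m" "g i \<in> borel_measurable m"
      using L' L_I by auto
    show "(\<lambda>w. ennreal (\<psi> i (fst (fst w)) * (g i (snd (fst w)) / F i)))
        \<in> borel_measurable (m2 \<Otimes>\<^sub>M count_space L')"
      by measurable
  qed (use countable_L[OF L'] in auto)
  then have "(\<lambda>w. \<integral>\<^sup>+i. ennreal (\<psi> i (fst w) * (g i (snd w) / F i)) \<partial>count_space L') \<in> borel_measurable m2"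
    by (intro cs.borel_measurable_nn_integral) (simp add: case_prod_beta')
  then show ?thesis
    by (simp add: K_def case_prod_beta')
qed

lemma K_support:
  assumes "L' \<subseteq> L" "y \<in> M" "z \<in> M" "K L' y z \<noteq> 0"
  obtains i where "i \<in> L'" "i \<in> touched y" "g i z \<noteq> 0" "d y z < 12 * r i"
proof -
  have "\<exists>i\<in>L'. \<psi> i y * (g i z / F i) \<noteq> 0"
  proof (rule ccontr)
    assume "\<not> ?thesis"
    then have "K L' y z = (\<integral>\<^sup>+i. 0 \<partial>count_space L')"
      unfolding K_def by (intro nn_integral_cong) auto
    then show False using assms by simp
  qed
  then obtain i where i: "i \<in> L'" "\<psi> i y \<noteq> 0" "g i z \<noteq> 0" by auto
  have iI: "i \<in> I" "i \<in> L"
    using i assms L_I by auto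
  have t: "i \<in> touched y"
    using \<psi>_0[OF iI(1) assms(2)] i by auto
  have "d y z \<le> d y (x i) + d (x i) z"
    using assms iI x_M by (intro MS.triangle) auto
  then have "d y z < 12 * r i"
    using g_near[OF iI(2) assms(3) i(3)] t by (auto simp: touched_def MS.commute)
  then show ?thesis
    using that i t by auto
qed

text \<open>The kernel is normalised in \<open>z\<close>, yet its mass in \<open>y\<close> is
  bounded too: the integral of \<psi>_i is at most a multiple of the volume of the Whitney ball,
  hence by (D.4) of \<open>F i\<close>. This cancels the normalisation, and (D.1) bounds the
  remaining sum.\<close>

lemma K_integral:
  assumes L': "L' \<subseteq> L" and z: "z \<in> M"
  shows "(\<integral>\<^sup>+y. K L' y z \<partial>m) \<le> ennreal (NV * Cf) * indicator {w. \<exists>i\<in>L'. g i w \<noteq> 0} z"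
proof -
  have "(\<integral>\<^sup>+y. K L' y z \<partial>m) = (\<integral>\<^sup>+i. \<integral>\<^sup>+y. ennreal (\<psi> i y * (g i z / F i)) \<partial>m \<partial>count_space L')"
    unfolding K_def using L' L_I countable_L by (intro nn_integral_count_space_nn_integral) auto
  also have "\<dots> \<le> (\<integral>\<^sup>+i. ennreal (NV * Cf) * ennreal (g i z) \<partial>count_space L')"
  proof (intro nn_integral_mono)
    fix i assume "i \<in> space (count_space L')"
    then have i: "i \<in> L" "i \<in> I"
      using L' L_I by auto
    have [measurable]: "\<psi> i \<in> borel_measurable m"
      using i by measurable
    have "(\<integral>\<^sup>+y. ennreal (\<psi> i y * (g i z / F i)) \<partial>m) = (\<integral>\<^sup>+y. ennreal (\<psi> i y) * ennreal (g i z / F i) \<partial>m)"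
      using i g_nonneg[OF i(1) z] F_pos[OF i(1)] \<psi>_nonneg[OF i(2)] by (intro nn_integral_cong ennreal_mult) auto
    also have "\<dots> = (\<integral>\<^sup>+y. ennreal (\<psi> i y) \<partial>m) * ennreal (g i z / F i)"
      by (rule nn_integral_multc) measurable
    also have "\<dots> \<le> ennreal (NV * V (x i) (r i)) * ennreal (g i z / F i)"
      using \<psi>_integral[OF i(2)] by (rule mult_right_mono) simp
    also have "\<dots> = ennreal (NV * V (x i) (r i) * (g i z / F i))"
      using g_nonneg[OF i(1) z] F_pos[OF i(1)] NV_ge_1 by (intro ennreal_mult[symmetric]) auto
    also have "\<dots> \<le> ennreal (NV * (Cf * F i) * (g i z / F i))"
      using g_nonneg[OF i(1) z] F_pos[OF i(1)] NV_ge_1 F_ge[OF i(1)]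
      by (intro ennreal_leI mult_right_mono mult_left_mono) auto
    also have "NV * (Cf * F i) * (g i z / F i) = NV * Cf * g i z"
      using F_pos[OF i(1)] by simp
    also have "ennreal (NV * Cf * g i z) = ennreal (NV * Cf) * ennreal (g i z)"
      using g_nonneg[OF i(1) z] NV_ge_1 Cf_pos by (intro ennreal_mult) auto
    finally show "(\<integral>\<^sup>+y. ennreal (\<psi> i y * (g i z / F i)) \<partial>m) \<le> ennreal (NV * Cf) * ennreal (g i z)" .
  qed
  also have "\<dots> = ennreal (NV * Cf) * (\<integral>\<^sup>+i. ennreal (g i z) \<partial>count_space L')"
    by (rule nn_integral_cmult) simp
  also have "(\<integral>\<^sup>+i. ennreal (g i z) \<partial>count_space L') \<le> indicator {w. \<exists>i\<in>L'. g i w \<noteq> 0} z"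
  proof (cases "\<exists>i\<in>L'. g i z \<noteq> 0")
    case True
    have "(\<integral>\<^sup>+i. ennreal (g i z) \<partial>count_space L') \<le> 1"
      using g_sum_subset[OF L' z] by (rule order_trans) (simp add: indicator_def)
    then show ?thesis
      using True by simp
  next
    case False
    then have "(\<integral>\<^sup>+i. ennreal (g i z) \<partial>count_space L') = (\<integral>\<^sup>+i. 0 \<partial>count_space L')"
      by (intro nn_integral_cong) auto
    then show ?thesis by simp
  qed
  finally show ?thesis
    by (simp add: mult_left_mono)
qed

text \<open>This integrates out the weights that Jensen's inequality introduces, at the cost of one
  factor \<open>NV * Cf\<close> per replaced point.\<close>

lemma K_smear:
  assumes L': "L' \<subseteq> L" and [measurable]: "f \<in> borel_measurable m"
  shows "(\<integral>\<^sup>+y. \<integral>\<^sup>+z. K L' y z * f z \<partial>m \<partial>m) \<le> ennreal (NV * Cf) * (\<integral>\<^sup>+z. f z \<partial>m)"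
proof -
  note [measurable] = K_measurable[OF L']
  have "(\<integral>\<^sup>+y. \<integral>\<^sup>+z. K L' y z * f z \<partial>m \<partial>m) = (\<integral>\<^sup>+z. \<integral>\<^sup>+y. K L' y z * f z \<partial>m \<partial>m)"
    by (rule pm.Fubini') measurable
  also have "\<dots> \<le> (\<integral>\<^sup>+z. ennreal (NV * Cf) * f z \<partial>m)"
  proof (intro nn_integral_mono)
    fix z assume z: "z \<in> space m"
    have [measurable]: "(\<lambda>y. K L' y z) \<in> borel_measurable m"
      using z by measurable
    have "(\<integral>\<^sup>+y. K L' y z * f z \<partial>m) = (\<integral>\<^sup>+y. K L' y z \<partial>m) * f z"
      by (rule nn_integral_multc) measurable
    also have "\<dots> \<le> (ennreal (NV * Cf) * 1) * f z"
      using K_integral[OF L', of z] z by (intro mult_right_mono) (auto intro: order_trans mult_left_mono simp: indicator_def split: if_splits)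
    finally show "(\<integral>\<^sup>+y. K L' y z * f z \<partial>m) \<le> ennreal (NV * Cf) * f z"
      by simp
  qed
  also have "\<dots> = ennreal (NV * Cf) * (\<integral>\<^sup>+z. f z \<partial>m)"
    by (rule nn_integral_cmult) measurable
  finally show ?thesis .
qed

lemma convex_combination_Jensen:
  assumes L': "L' \<subseteq> L" and y: "y \<in> M" and A: "finite A" "A \<subseteq> L'"
  shows "ennreal (\<Sum>i\<in>A. \<psi> i y * (a - b i)\<^sup>2) \<le> (\<integral>\<^sup>+z. K L' y z * ennreal ((a - h z)\<^sup>2) \<partial>m)"
proof -
  have AL: "i \<in> L" "i \<in> I" if "i \<in> A" for i
    using that A L' L_I by auto
  have "ennreal (\<Sum>i\<in>A. \<psi> i y * (a - b i)\<^sup>2) = (\<Sum>i\<in>A. ennreal (\<psi> i y) * ennreal ((a - b i)\<^sup>2))"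
    using AL \<psi>_nonneg y by (subst sum_ennreal[symmetric]) (auto intro!: sum.cong ennreal_mult simp del: sum_ennreal)
  also have "\<dots> \<le> (\<Sum>i\<in>A. ennreal (\<psi> i y) * (\<integral>\<^sup>+z. ennreal (g i z / F i * (a - h z)\<^sup>2) \<partial>m))"
    using AL by (intro sum_mono mult_left_mono average_Jensen) auto
  also have "\<dots> = (\<Sum>i\<in>A. (\<integral>\<^sup>+z. ennreal (\<psi> i y) * ennreal (g i z / F i * (a - h z)\<^sup>2) \<partial>m))"
    using AL by (intro sum.cong nn_integral_cmult[symmetric]) auto
  also have "\<dots> = (\<integral>\<^sup>+z. (\<Sum>i\<in>A. ennreal (\<psi> i y) * ennreal (g i z / F i * (a - h z)\<^sup>2)) \<partial>m)"
    using AL by (intro nn_integral_sum[symmetric]) auto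
  also have "\<dots> \<le> (\<integral>\<^sup>+z. K L' y z * ennreal ((a - h z)\<^sup>2) \<partial>m)"
  proof (intro nn_integral_mono)
    fix z assume z: "z \<in> space m"
    have "(\<Sum>i\<in>A. ennreal (\<psi> i y) * ennreal (g i z / F i * (a - h z)\<^sup>2))
        = (\<Sum>i\<in>A. ennreal (\<psi> i y * (g i z / F i)) * ennreal ((a - h z)\<^sup>2))"
    proof (rule sum.cong)
      fix i assume i: "i \<in> A"
      have "0 \<le> g i z / F i" "0 \<le> \<psi> i y"
        using AL[OF i] g_nonneg[of i z] F_pos[of i] \<psi>_nonneg[of i y] y z by auto
      then show "ennreal (\<psi> i y) * ennreal (g i z / F i * (a - h z)\<^sup>2) = ennreal (\<psi> i y * (g i z / F i)) * ennreal ((a - h z)\<^sup>2)"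
        by (simp only: ennreal_mult zero_le_power2 mult.assoc)
    qed simp
    also have "\<dots> \<le> K L' y z * ennreal ((a - h z)\<^sup>2)"
      unfolding K_def sum_distrib_right[symmetric] using A
      by (intro mult_right_mono sum_le_nn_integral_count_space) auto
    finally show "(\<Sum>i\<in>A. ennreal (\<psi> i y) * ennreal (g i z / F i * (a - h z)\<^sup>2)) \<le> K L' y z * ennreal ((a - h z)\<^sup>2)" .
  qed
  finally show ?thesis .
qed

text \<open>Subtracting the constant \<open>a\<close> requires total weight 1, which is why every
  touched index must belong to \<open>L'\<close>.\<close>

lemma extension_Jensen:
  assumes L': "L' \<subseteq> L" and y: "y \<in> U" "touched y \<subseteq> L'"
  shows "ennreal ((a - h y)\<^sup>2) \<le> (\<integral>\<^sup>+z. K L' y z * ennreal ((a - h z)\<^sup>2) \<partial>m)"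
proof -
  have yM: "y \<in> M"
    using y by (simp add: U_def)
  have sum1: "(\<Sum>i\<in>touched y. \<psi> i y) = 1"
    using touched_finite touched_I y by (intro \<psi>_sum) auto
  have "touched y \<inter> L = touched y"
    using y L' by auto
  then have "h y = (\<Sum>i\<in>touched y. b i * \<psi> i y)"
    using h_ext[OF y(1)] by simp
  then have eq: "a - h y = (\<Sum>i\<in>touched y. \<psi> i y * (a - b i))"
    using sum1 sum_distrib_left[of a "\<lambda>i. \<psi> i y" "touched y"] by (simp add: algebra_simps sum_subtractf)
  have "(a - h y)\<^sup>2 \<le> (\<Sum>i\<in>touched y. \<psi> i y * (a - b i)\<^sup>2)"
    unfolding eq using sum1 \<psi>_nonneg yM touched_I by (intro weighted_mean_square_le) auto
  then have "ennreal ((a - h y)\<^sup>2) \<le> ennreal (\<Sum>i\<in>touched y. \<psi> i y * (a - b i)\<^sup>2)"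
    by (rule ennreal_leI)
  also have "\<dots> \<le> (\<integral>\<^sup>+z. K L' y z * ennreal ((a - h z)\<^sup>2) \<partial>m)"
    using L' yM touched_finite y by (intro convex_combination_Jensen) auto
  finally show ?thesis .
qed

text \<open>With \<open>a\<close> = 0 total weight at most 1 suffices, so this bound holds at every
  point of \<open>U\<close> and yields the L^2 estimate there.\<close>

lemma extension_Jensen_0:
  assumes y: "y \<in> U"
  shows "ennreal ((h y)\<^sup>2) \<le> (\<integral>\<^sup>+z. K L y z * ennreal ((h z)\<^sup>2) \<partial>m)"
proof -
  have yM: "y \<in> M"
    using y by (simp add: U_def)
  have sub: "i \<in> I" if "i \<in> touched y" for i
    using that touched_I by auto
  have "(\<Sum>i\<in>touched y \<inter> L. \<psi> i y) \<le> (\<Sum>i\<in>touched y. \<psi> i y)"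
    using touched_finite sub \<psi>_nonneg yM by (intro sum_mono2) auto
  also have "\<dots> = 1"
    using touched_finite touched_I y by (intro \<psi>_sum) auto
  finally have sum1: "(\<Sum>i\<in>touched y \<inter> L. \<psi> i y) \<le> 1" .
  have "(h y)\<^sup>2 = (\<Sum>i\<in>touched y \<inter> L. \<psi> i y * b i)\<^sup>2"
    using h_ext[OF y] by (simp add: mult.commute)
  also have "\<dots> \<le> (\<Sum>i\<in>touched y \<inter> L. \<psi> i y * (b i)\<^sup>2)"
    using sum1 \<psi>_nonneg yM sub by (intro weighted_mean_square_le) auto
  finally have "ennreal ((h y)\<^sup>2) \<le> ennreal (\<Sum>i\<in>touched y \<inter> L. \<psi> i y * (0 - b i)\<^sup>2)"
    by (intro ennreal_leI) simp
  also have "\<dots> \<le> (\<integral>\<^sup>+z. K L y z * ennreal ((0 - h z)\<^sup>2) \<partial>m)"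
    using yM touched_finite by (intro convex_combination_Jensen) auto
  finally show ?thesis by simp
qed

lemma extension_L2:
  "(\<integral>\<^sup>+y. ennreal ((h y)\<^sup>2) * indicator U y \<partial>m)
    \<le> ennreal (NV * Cf) * (\<integral>\<^sup>+z. ennreal ((h z)\<^sup>2) * indicator D z \<partial>m)"
proof -
  have "(\<integral>\<^sup>+y. ennreal ((h y)\<^sup>2) * indicator U y \<partial>m)
      \<le> (\<integral>\<^sup>+y. \<integral>\<^sup>+z. K L y z * (ennreal ((h z)\<^sup>2) * indicator D z) \<partial>m \<partial>m)"
  proof (intro nn_integral_mono)
    fix y assume y: "y \<in> space m"
    have "(\<integral>\<^sup>+z. K L y z * ennreal ((h z)\<^sup>2) \<partial>m) = (\<integral>\<^sup>+z. K L y z * (ennreal ((h z)\<^sup>2) * indicator D z) \<partial>m)"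
    proof (intro nn_integral_cong)
      fix z assume z: "z \<in> space m"
      have "K L y z = 0" if "z \<notin> D"
        using K_support[OF order_refl, of y z] y z g_outside[of _ z] that by force
      then show "K L y z * ennreal ((h z)\<^sup>2) = K L y z * (ennreal ((h z)\<^sup>2) * indicator D z)"
        by (auto simp: indicator_def)
    qed
    then show "ennreal ((h y)\<^sup>2) * indicator U y \<le> (\<integral>\<^sup>+z. K L y z * (ennreal ((h z)\<^sup>2) * indicator D z) \<partial>m)"
      using extension_Jensen_0[of y] by (auto simp: indicator_def)
  qed
  also have "\<dots> \<le> ennreal (NV * Cf) * (\<integral>\<^sup>+z. ennreal ((h z)\<^sup>2) * indicator D z \<partial>m)"
    by (rule K_smear) auto
  finally show ?thesis .
qed

section \<open>Jump integrals of the extension\<close>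

text \<open>Curried, with the two indicators separated, so that one variable can be integrated
  against a kernel while the other is held fixed.\<close>

definition q where "q T z w = je h z w * (indicator T z * indicator T w)"

lemma q_measurable [measurable]:
  assumes [measurable]: "T \<in> sets m"
  shows "case_prod (q T) \<in> borel_measurable m2"
proof -
  have "case_prod (q T) = (\<lambda>z. je h (fst z) (snd z) * (indicator T (fst z) * indicator T (snd z)))"
    by (auto simp: q_def)
  then show ?thesis
    by simp
qed

lemma q_integral:
  assumes [measurable]: "T \<in> sets m"
  shows "(\<integral>\<^sup>+z. \<integral>\<^sup>+w. q T z w \<partial>m \<partial>m) = JI (T \<times> T) h"
proof -
  have "JI (T \<times> T) h = (\<integral>\<^sup>+z. \<integral>\<^sup>+w. je h z w * indicator (T \<times> T) (z, w) \<partial>m \<partial>m)"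
    by (rule JI_iterated) measurable
  then show ?thesis
    by (simp add: q_def indicator_times)
qed

lemma q_sym: "z \<in> M \<Longrightarrow> w \<in> M \<Longrightarrow> q T z w = q T w z"
  by (simp add: q_def je_sym mult.commute)

lemma square_J_le_q:
  assumes "z \<in> T" "w \<in> T" "z \<in> M" "w \<in> M" "p \<in> M" "y \<in> M" "p \<noteq> y"
    and "d z w \<le> 128 * d p y" "d z p \<le> 128 * d p y"
  shows "ennreal ((h z - h w)\<^sup>2) * ennreal (J p y) \<le> ennreal CJ * q T z w"
\<comment> \<open>The kernel bounds exclude the diagonal, which may have positive measure when there
  are atoms; the increment vanishes there.\<close>
proof (cases "z = w")
  case False
  have "(h z - h w)\<^sup>2 * J p y \<le> CJ * ((h z - h w)\<^sup>2 * J z w)"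
    using mult_left_mono[OF J_compare[of z w p y], of "(h z - h w)\<^sup>2"] assms False by (simp add: mult.left_commute)
  then have "ennreal ((h z - h w)\<^sup>2 * J p y) \<le> ennreal CJ * ennreal ((h z - h w)\<^sup>2 * J z w)"
    using CJ_pos by (subst ennreal_mult'[symmetric]) (auto intro: ennreal_leI)
  then show ?thesis
    using assms by (simp add: q_def je_def ennreal_mult')
qed simp

text \<open>Only \<open>y\<close> is replaced, by points \<open>z\<close> of \<open>D\<close>. As
  \<open>p\<close> lies in the closure, 5 * \<open>r i\<close> \<le> \<open>d (x i) p\<close> for
  each touched \<open>i\<close>, so \<open>d p y\<close> exceeds 2 * \<open>r i\<close>, while
  \<open>z\<close> is within 12 * \<open>r i\<close> of \<open>y\<close>. Hence \<open>d p z\<close>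
  < 7 * \<open>d p y\<close>, and the kernels are comparable.\<close>

lemma JI_mixed:
  assumes L': "L' \<subseteq> L" and [measurable]: "S0 \<in> sets m2" "T \<in> sets m"
    and T: "\<And>i z. i \<in> L' \<Longrightarrow> z \<in> M \<Longrightarrow> g i z \<noteq> 0 \<Longrightarrow> z \<in> T"
    and S0: "\<And>p y. (p, y) \<in> S0 \<Longrightarrow> p \<in> T \<inter> D \<and> y \<in> U \<and> touched y \<subseteq> L'"
  shows "JI S0 h \<le> ennreal (CJ * (NV * Cf)) * JI (T \<times> T) h"
proof -
  note [measurable] = K_measurable[OF L'] q_measurable[of T]
  have "JI S0 h = (\<integral>\<^sup>+p. \<integral>\<^sup>+y. je h p y * indicator S0 (p, y) \<partial>m \<partial>m)"
    by (rule JI_iterated) measurable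
  also have "\<dots> \<le> (\<integral>\<^sup>+p. \<integral>\<^sup>+y. \<integral>\<^sup>+z. K L' y z * (ennreal CJ * q T p z) \<partial>m \<partial>m \<partial>m)"
  proof (intro nn_integral_mono)
    fix p y assume pyM: "p \<in> space m" "y \<in> space m"
    show "je h p y * indicator S0 (p, y) \<le> (\<integral>\<^sup>+z. K L' y z * (ennreal CJ * q T p z) \<partial>m)"
    proof (cases "(p, y) \<in> S0")
      case True
      then have py: "p \<in> T" "p \<in> D" "y \<in> U" "touched y \<subseteq> L'"
        using S0 by auto
      have "je h p y = ennreal ((h p - h y)\<^sup>2) * ennreal (J p y)"
        by (simp add: je_def ennreal_mult')
      also have "\<dots> \<le> (\<integral>\<^sup>+z. K L' y z * ennreal ((h p - h z)\<^sup>2) \<partial>m) * ennreal (J p y)"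
        using extension_Jensen[OF L' py(3,4)] by (rule mult_right_mono) simp
      also have "\<dots> = (\<integral>\<^sup>+z. K L' y z * ennreal ((h p - h z)\<^sup>2) * ennreal (J p y) \<partial>m)"
        using pyM by (intro nn_integral_multc[symmetric]) measurable
      also have "\<dots> \<le> (\<integral>\<^sup>+z. K L' y z * (ennreal CJ * q T p z) \<partial>m)"
      proof (intro nn_integral_mono)
        fix z assume z: "z \<in> space m"
        show "K L' y z * ennreal ((h p - h z)\<^sup>2) * ennreal (J p y) \<le> K L' y z * (ennreal CJ * q T p z)"
        proof (cases "K L' y z = 0")
          case False
          then obtain i where i: "i \<in> L'" "i \<in> touched y" "g i z \<noteq> 0" "d y z < 12 * r i"
            using K_support[OF L', of y z] pyM z by auto
          have iI: "i \<in> I" "d (x i) y < 3 * r i" "x i \<in> M"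
            using i x_M by (auto simp: touched_def)
          have "5 * r i \<le> d (x i) p"
            using iI py D_sub by (intro dist_ge) auto
          also have "\<dots> \<le> d (x i) y + d y p"
            using iI pyM by (intro MS.triangle) auto
          finally have ri: "2 * r i < d p y"
            using iI by (simp add: MS.commute)
          have "d p z \<le> d p y + d y z"
            using pyM z by (intro MS.triangle) auto
          then have "d p z \<le> 128 * d p y"
            using i ri MS.nonneg[of p y] by linarith
          moreover have "p \<noteq> y"
            using ri r_pos[OF iI(1)] pyM by auto
          moreover have "z \<in> T"
            using T i z by simp
          ultimately have "ennreal ((h p - h z)\<^sup>2) * ennreal (J p y) \<le> ennreal CJ * q T p z"
            using py pyM z by (intro square_J_le_q) auto
          then show ?thesis
            by (simp add: mult.assoc mult_left_mono)
        qed simp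
      qed
      finally show ?thesis
        using True by simp
    qed simp
  qed
  also have "\<dots> \<le> (\<integral>\<^sup>+p. ennreal (NV * Cf) * (\<integral>\<^sup>+z. ennreal CJ * q T p z \<partial>m) \<partial>m)"
    by (intro nn_integral_mono K_smear[OF L']) measurable
  also have "\<dots> = (\<integral>\<^sup>+p. ennreal (NV * Cf) * (ennreal CJ * (\<integral>\<^sup>+z. q T p z \<partial>m)) \<partial>m)"
    by (intro nn_integral_cong arg_cong[where f = "\<lambda>a. ennreal (NV * Cf) * a"] nn_integral_cmult) measurable
  also have "\<dots> = ennreal (NV * Cf) * (ennreal CJ * JI (T \<times> T) h)"
    unfolding q_integral[OF \<open>T \<in> sets m\<close>, symmetric] by (subst nn_integral_cmult; measurable)+
  also have "\<dots> = ennreal (CJ * (NV * Cf)) * JI (T \<times> T) h"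
    using CJ_pos NV_ge_1 Cf_pos by (simp add: ennreal_mult mult_ac)
  finally show ?thesis .
qed

text \<open>Jensen's inequality is applied to \<open>y\<close> and then to \<open>p\<close>. The two
  kernels are integrated out one after the other with an exchange of integrals in between, which
  gives the square of \<open>NV * Cf\<close>.\<close>

lemma JI_separated:
  assumes L': "L' \<subseteq> L" and [measurable]: "S0 \<in> sets m2" "T \<in> sets m"
    and T: "\<And>i z. i \<in> L' \<Longrightarrow> z \<in> M \<Longrightarrow> g i z \<noteq> 0 \<Longrightarrow> z \<in> T"
    and S0: "\<And>p y. (p, y) \<in> S0 \<Longrightarrow> p \<in> U \<and> y \<in> U \<and> touched p \<subseteq> L' \<and> touched y \<subseteq> L'"
    and sep: "\<And>p y j. (p, y) \<in> S0 \<Longrightarrow> j \<in> I \<Longrightarrow> d (x j) p < 5 / 2 * r j \<or> d (x j) y < 5 / 2 * r j \<Longrightarrow> r j \<le> d p y"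
  shows "JI S0 h \<le> ennreal (CJ * (NV * Cf)\<^sup>2) * JI (T \<times> T) h"
proof -
  note [measurable] = K_measurable[OF L'] q_measurable[of T]
  define G where "G p w = (\<integral>\<^sup>+z. K L' p z * (ennreal CJ * q T w z) \<partial>m)" for p w
  have [measurable]: "case_prod G \<in> borel_measurable m2"
    unfolding G_def by measurable
  \<comment> \<open>51 = 12 * 17/4: \<open>z\<close> is within 12 * \<open>r i\<close> of
    \<open>y\<close>, the radius \<open>r i\<close> is below 17/4 * \<open>r j\<close> for a ball
    \<open>j\<close> covering \<open>y\<close>, and \<open>sep\<close> bounds \<open>r j\<close> by
    the distance of the pair.\<close>
  have scale: "d y z \<le> 51 * d p' y'" if "(p', y') \<in> S0" "y = p' \<or> y = y'" "y \<in> M" "z \<in> M" "K L' y z \<noteq> 0" for p' y' y z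
  proof -
    note K_supp = K_support[OF L' that(3-5)]
    obtain i where i: "i \<in> L'" "i \<in> touched y" "g i z \<noteq> 0" "d y z < 12 * r i"
      by (rule K_supp)
    have "y \<in> U"
      using S0[OF that(1)] that(2) by auto
    then obtain j where j: "j \<in> I" "d (x j) y < 5 / 2 * r j"
      by (rule cover)
    have "r i < 17 / 4 * r j"
      using touched_nbr(3)[of j y i] i j r_pos[OF j(1)] by simp
    moreover have "r j \<le> d p' y'"
      using sep[OF that(1) j(1)] j(2) that(2) by auto
    ultimately show ?thesis
      using i by simp
  qed
  have "JI S0 h = (\<integral>\<^sup>+p. \<integral>\<^sup>+y. je h p y * indicator S0 (p, y) \<partial>m \<partial>m)"
    by (rule JI_iterated) measurable
  also have "\<dots> \<le> (\<integral>\<^sup>+p. \<integral>\<^sup>+y. \<integral>\<^sup>+w. K L' y w * G p w \<partial>m \<partial>m \<partial>m)"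
  proof (intro nn_integral_mono)
    fix p y assume pyM: "p \<in> space m" "y \<in> space m"
    show "je h p y * indicator S0 (p, y) \<le> (\<integral>\<^sup>+w. K L' y w * G p w \<partial>m)"
    proof (cases "(p, y) \<in> S0")
      case True
      then have py: "p \<in> U" "y \<in> U" "touched p \<subseteq> L'" "touched y \<subseteq> L'"
        using S0 by auto
      have "p \<noteq> y"
      proof -
        obtain j where j: "j \<in> I" "d (x j) p < 5 / 2 * r j"
          using py(1) by (rule cover)
        then have "0 < d p y"
          using sep[OF True j(1)] r_pos[OF j(1)] by simp
        then show ?thesis
          using pyM by auto
      qed
      have "je h p y = ennreal ((h p - h y)\<^sup>2) * ennreal (J p y)"
        by (simp add: je_def ennreal_mult')
      also have "\<dots> \<le> (\<integral>\<^sup>+w. K L' y w * ennreal ((h p - h w)\<^sup>2) \<partial>m) * ennreal (J p y)"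
        using extension_Jensen[OF L' py(2,4)] by (rule mult_right_mono) simp
      also have "\<dots> = (\<integral>\<^sup>+w. K L' y w * ennreal ((h p - h w)\<^sup>2) * ennreal (J p y) \<partial>m)"
        using pyM by (intro nn_integral_multc[symmetric]) measurable
      also have "\<dots> \<le> (\<integral>\<^sup>+w. K L' y w * G p w \<partial>m)"
      proof (intro nn_integral_mono)
        fix w assume w: "w \<in> space m"
        show "K L' y w * ennreal ((h p - h w)\<^sup>2) * ennreal (J p y) \<le> K L' y w * G p w"
        proof (cases "K L' y w = 0")
          case False
          have wT: "w \<in> T"
            using K_support[OF L', of y w] pyM w False T by (metis space_m)
          have "ennreal ((h p - h w)\<^sup>2) * ennreal (J p y) = ennreal ((h w - h p)\<^sup>2) * ennreal (J p y)"
            by (simp add: power2_commute)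
          also have "\<dots> \<le> (\<integral>\<^sup>+z. K L' p z * ennreal ((h w - h z)\<^sup>2) \<partial>m) * ennreal (J p y)"
            using extension_Jensen[OF L' py(1,3)] by (rule mult_right_mono) simp
          also have "\<dots> = (\<integral>\<^sup>+z. K L' p z * ennreal ((h w - h z)\<^sup>2) * ennreal (J p y) \<partial>m)"
            using pyM by (intro nn_integral_multc[symmetric]) measurable
          also have "\<dots> \<le> G p w"
            unfolding G_def
          proof (intro nn_integral_mono)
            fix z assume z: "z \<in> space m"
            show "K L' p z * ennreal ((h w - h z)\<^sup>2) * ennreal (J p y) \<le> K L' p z * (ennreal CJ * q T w z)"
            proof (cases "K L' p z = 0")
              case nz: False
              have zT: "z \<in> T"
                using K_support[OF L', of p z] pyM z nz T by (metis space_m)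
              have dz: "d p z \<le> 51 * d p y"
                using scale[OF True, of p z] nz pyM z by simp
              have dw: "d y w \<le> 51 * d p y"
                using scale[OF True, of y w] False pyM w by simp
              have "d w p \<le> d w y + d y p" "d w z \<le> d w p + d p z"
                using pyM z w by (auto intro!: MS.triangle)
              \<comment> \<open>The actual factors are 52 and 103 = 52 + 51.\<close>
              then have "d w p \<le> 128 * d p y" "d w z \<le> 128 * d p y"
                using dz dw MS.commute[of w y] MS.commute[of y p] MS.nonneg[of p y] by linarith+
              then have "ennreal ((h w - h z)\<^sup>2) * ennreal (J p y) \<le> ennreal CJ * q T w z"
                using wT zT pyM z w \<open>p \<noteq> y\<close> by (intro square_J_le_q) auto
              then show ?thesis
                by (simp add: mult.assoc mult_left_mono)
            qed simp
          qed
          finally show ?thesis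
            by (simp add: mult.assoc mult_left_mono)
        qed simp
      qed
      finally show ?thesis
        using True by simp
    qed simp
  qed
  also have "\<dots> \<le> (\<integral>\<^sup>+p. ennreal (NV * Cf) * (\<integral>\<^sup>+w. G p w \<partial>m) \<partial>m)"
    by (intro nn_integral_mono K_smear[OF L']) measurable
  also have "\<dots> = ennreal (NV * Cf) * (\<integral>\<^sup>+p. \<integral>\<^sup>+w. G p w \<partial>m \<partial>m)"
    by (rule nn_integral_cmult) measurable
  also have "(\<integral>\<^sup>+p. \<integral>\<^sup>+w. G p w \<partial>m \<partial>m) = (\<integral>\<^sup>+w. \<integral>\<^sup>+p. G p w \<partial>m \<partial>m)"
    by (rule pm.Fubini') measurable
  also have "\<dots> \<le> (\<integral>\<^sup>+w. ennreal (NV * Cf) * (\<integral>\<^sup>+z. ennreal CJ * q T w z \<partial>m) \<partial>m)"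
    unfolding G_def by (intro nn_integral_mono K_smear[OF L']) measurable
  also have "\<dots> = (\<integral>\<^sup>+w. ennreal (NV * Cf) * (ennreal CJ * (\<integral>\<^sup>+z. q T w z \<partial>m)) \<partial>m)"
    by (intro nn_integral_cong arg_cong[where f = "\<lambda>a. ennreal (NV * Cf) * a"] nn_integral_cmult) measurable
  also have "\<dots> = ennreal (NV * Cf) * (ennreal CJ * JI (T \<times> T) h)"
    unfolding q_integral[OF \<open>T \<in> sets m\<close>, symmetric] by (subst nn_integral_cmult; measurable)+
  finally have "JI S0 h \<le> ennreal (NV * Cf) * (ennreal (NV * Cf) * (ennreal CJ * JI (T \<times> T) h))"
    by (simp add: mult_left_mono)
  also have "\<dots> = ennreal (CJ * (NV * Cf)\<^sup>2) * JI (T \<times> T) h"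
    using CJ_pos NV_ge_1 Cf_pos by (simp add: ennreal_mult power2_eq_square mult_ac)
  finally show ?thesis .
qed

section \<open>Pairs that are close on the Whitney scale\<close>

definition CN :: real where "CN = 8 * NV ^ 4 * P\<phi> * C\<eta>"

lemma CN_pos: "0 < CN"
  using NV_ge_1 P\<phi>_pos C\<eta>_pos by (simp add: CN_def)

text \<open>Extending the coefficients by 0 turns \<open>h\<close> into a combination over all
  touched indices. Their \<psi>'s sum to 1, so \<open>partition_oscillation\<close> applies even
  where some touched index lies outside \<open>L\<close>.\<close>

definition bb where "bb i = (if i \<in> L then b i else 0)"

text \<open>The oscillation of \<open>h\<close> is bounded by that of the cutoffs, so the kernel
  enters only through the energies of the \<eta>_k; no integrability of the kernel near the diagonal
  is invoked. The reference value \<open>c\<close> is free: \<open>b j\<close> for small balls, 0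
  for large ones.\<close>

lemma JI_near_ball:
  assumes j: "j \<in> I" and [measurable]: "S0 \<in> sets m2" and A: "A \<subseteq> nbr j"
    and S0: "\<And>p y. (p, y) \<in> S0 \<Longrightarrow> d (x j) p < 5 / 2 * r j \<and> d p y < r j \<and> touched p \<subseteq> A \<and> touched y \<subseteq> A"
  shows "JI S0 h \<le> ennreal (CN * V (x j) (r j) / \<phi> (r j) * (\<Sum>i\<in>A. (bb i - c)\<^sup>2))"
proof -
  have finA: "finite A"
    using A nbr_finite_card(1)[OF j] by (rule finite_subset)
  have AI: "A \<subseteq> I"
    using A nbr_I by auto
  have cardA: "real (card A) \<le> NV"
    using card_mono[OF nbr_finite_card(1)[OF j] A] nbr_finite_card(2)[OF j] by simp
  define B where "B = 4 * (real (card A))\<^sup>2 * (\<Sum>i\<in>A. (bb i - c)\<^sup>2)"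
  have B_nonneg: "0 \<le> B"
    by (simp add: B_def sum_nonneg)
  have xj: "x j \<in> M" "0 < r j"
    using j x_M r_pos by auto
  have "JI S0 h = (\<integral>\<^sup>+z. je h (fst z) (snd z) * indicator S0 z \<partial>m2)"
    by (rule JI_eq)
  also have "\<dots> \<le> (\<integral>\<^sup>+z. ennreal B * (\<Sum>k\<in>A. je (\<eta> k) (fst z) (snd z) * indicator (M \<times> M) z) \<partial>m2)"
  proof (intro nn_integral_mono)
    fix z assume "z \<in> space m2"
    then obtain p y where z: "z = (p, y)" and pyM: "p \<in> M" "y \<in> M"
      by (auto simp: space_pair_measure)
    show "je h (fst z) (snd z) * indicator S0 z
        \<le> ennreal B * (\<Sum>k\<in>A. je (\<eta> k) (fst z) (snd z) * indicator (M \<times> M) z)"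
    proof (cases "(p, y) \<in> S0")
      case True
      have d: "d (x j) p < 5 / 2 * r j" "d p y < r j" and t: "touched p \<subseteq> A" "touched y \<subseteq> A"
        using S0[OF True] by auto
      have "d (x j) y \<le> d (x j) p + d p y"
        using xj pyM by (intro MS.triangle) auto
      then have "p \<in> U" "y \<in> U"
        using d xj pyM j by (auto intro!: ball_U[of j])
      moreover have ext: "h v = (\<Sum>i\<in>A. bb i * \<psi> i v)" if "v \<in> U" "touched v \<subseteq> A" for v
      proof -
        have "v \<in> M"
          using that by (simp add: U_def)
        then have "\<psi> i v = 0" if "i \<in> A" "i \<notin> touched v" for i
          using that AI by (intro \<psi>_0) auto
        then show ?thesis
          unfolding h_ext[OF that(1)] using that finA
          by (intro sum.mono_neutral_cong_left) (auto simp: bb_def)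
      qed
      ultimately have "(h p - h y)\<^sup>2 \<le> B * (\<Sum>k\<in>A. (\<eta> k p - \<eta> k y)\<^sup>2)"
        using partition_oscillation[OF finA AI t, of bb c] t by (simp add: B_def)
      then have "(h p - h y)\<^sup>2 * J p y \<le> (B * (\<Sum>k\<in>A. (\<eta> k p - \<eta> k y)\<^sup>2)) * J p y"
        using J_nonneg pyM by (intro mult_right_mono) auto
      also have "\<dots> = B * (\<Sum>k\<in>A. (\<eta> k p - \<eta> k y)\<^sup>2 * J p y)"
        by (simp add: sum_distrib_right mult.assoc)
      finally have "je h p y \<le> ennreal (B * (\<Sum>k\<in>A. (\<eta> k p - \<eta> k y)\<^sup>2 * J p y))"
        unfolding je_def by (rule ennreal_leI)
      also have "\<dots> = ennreal B * (\<Sum>k\<in>A. je (\<eta> k) p y)"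
        unfolding je_def using B_nonneg J_nonneg pyM by (subst sum_ennreal) (auto simp: ennreal_mult')
      finally show ?thesis
        using True z pyM by simp
    qed (simp add: z)
  qed
  also have "\<dots> = ennreal B * (\<Sum>k\<in>A. JI (M \<times> M) (\<eta> k))"
  proof -
    have [measurable]: "(\<lambda>z. je (\<eta> k) (fst z) (snd z) * indicator (M \<times> M) z) \<in> borel_measurable m2" if "k \<in> A" for k
    proof -
      have [measurable]: "\<eta> k \<in> borel_measurable m"
        using that AI by auto
      show ?thesis by measurable
    qed
    then show ?thesis
      by (subst nn_integral_cmult, measurable) (simp add: nn_integral_sum JI_eq)
  qed
  also have "\<dots> \<le> ennreal B * (\<Sum>k\<in>A. ennreal (2 * C\<eta> * NV * P\<phi> * V (x j) (r j) / \<phi> (r j)))"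
  proof (intro mult_left_mono sum_mono)
    fix k assume k: "k \<in> A"
    then have kI: "k \<in> I" and kn: "k \<in> nbr j" and jn: "j \<in> nbr k"
      using AI A nbr_sym[OF j] by auto
    have "JI (M \<times> M) (\<eta> k) \<le> ennreal (2 * C\<eta> * V (x k) (r k) / \<phi> (r k))"
      by (rule \<eta>_energy[OF kI])
    also have "\<dots> \<le> ennreal (2 * C\<eta> * NV * P\<phi> * V (x j) (r j) / \<phi> (r j))"
    proof (rule ennreal_leI)
      have pos: "0 < \<phi> (r j)" "0 < \<phi> (r k)"
        using xj r_pos[OF kI] \<phi>_pos by auto
      have "V (x k) (r k) * \<phi> (r j) \<le> (NV * V (x j) (r j)) * (P\<phi> * \<phi> (r k))"
        using nbr_vol(1)[OF kI jn] nbr_vol(2)[OF j kn] pos NV_ge_1 by (intro mult_mono) auto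
      then have "2 * C\<eta> * (V (x k) (r k) * \<phi> (r j)) \<le> 2 * C\<eta> * ((NV * V (x j) (r j)) * (P\<phi> * \<phi> (r k)))"
        using C\<eta>_pos by (intro mult_left_mono) auto
      then show "2 * C\<eta> * V (x k) (r k) / \<phi> (r k) \<le> 2 * C\<eta> * NV * P\<phi> * V (x j) (r j) / \<phi> (r j)"
        using pos by (simp add: divide_le_eq le_divide_eq mult_ac)
    qed
    finally show "JI (M \<times> M) (\<eta> k) \<le> ennreal (2 * C\<eta> * NV * P\<phi> * V (x j) (r j) / \<phi> (r j))" .
  qed auto
  also have "\<dots> = ennreal (B * (real (card A) * (2 * C\<eta> * NV * P\<phi> * V (x j) (r j) / \<phi> (r j))))"
  proof -
    have "0 \<le> 2 * C\<eta> * NV * P\<phi> * V (x j) (r j) / \<phi> (r j)"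
      using C\<eta>_pos NV_ge_1 P\<phi>_pos \<phi>_pos[OF xj(2)] by (intro divide_nonneg_nonneg mult_nonneg_nonneg) auto
    moreover have "ennreal B * (\<Sum>k\<in>A. ennreal R) = ennreal (B * (real (card A) * R))" if "0 \<le> R" for R
      using B_nonneg that by (simp add: ennreal_mult ennreal_of_nat_eq_real_of_nat)
    ultimately show ?thesis
      by blast
  qed
  also have "\<dots> \<le> ennreal (CN * V (x j) (r j) / \<phi> (r j) * (\<Sum>i\<in>A. (bb i - c)\<^sup>2))"
  proof (rule ennreal_leI)
    \<comment> \<open>The constant \<open>CN\<close> is assembled here: 8 = 4 * 2 from the
      oscillation bound and the normalisation of the energy, three factors \<open>NV\<close> for
      \<open>card A\<close> and a fourth for the comparison of volumes.\<close>
    define R where "R = (\<Sum>i\<in>A. (bb i - c)\<^sup>2) * (V (x j) (r j) / \<phi> (r j)) * C\<eta> * P\<phi>"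
    have R: "0 \<le> R"
      unfolding R_def using C\<eta>_pos P\<phi>_pos \<phi>_pos[OF xj(2)] by (intro mult_nonneg_nonneg divide_nonneg_nonneg sum_nonneg) auto
    have "(real (card A))^3 \<le> NV ^ 3"
      using cardA by (intro power_mono) auto
    then have "8 * NV * R * (real (card A))^3 \<le> 8 * NV * R * NV ^ 3"
      using R NV_ge_1 by (intro mult_left_mono) auto
    then show "B * (real (card A) * (2 * C\<eta> * NV * P\<phi> * V (x j) (r j) / \<phi> (r j)))
        \<le> CN * V (x j) (r j) / \<phi> (r j) * (\<Sum>i\<in>A. (bb i - c)\<^sup>2)"
      by (simp add: B_def CN_def R_def power2_eq_square power3_eq_cube power4_eq_xxxx mult_ac)
  qed
  finally show ?thesis .
qed

text \<open>By (D.1), integrals against all the weights \<open>g i\<close> together cost no more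
  than one integral over \<open>D\<close>. This replaces any count of overlapping supports.\<close>

lemma sum_g_integral_le:
  assumes L': "L' \<subseteq> L" and [measurable]: "f \<in> borel_measurable m"
  shows "(\<integral>\<^sup>+i. (\<integral>\<^sup>+z. ennreal (g i z) * f z \<partial>m) \<partial>count_space L') \<le> (\<integral>\<^sup>+z. f z * indicator D z \<partial>m)"
proof -
  have "(\<integral>\<^sup>+i. (\<integral>\<^sup>+z. ennreal (g i z) * f z \<partial>m) \<partial>count_space L')
      = (\<integral>\<^sup>+z. (\<integral>\<^sup>+i. ennreal (g i z) * f z \<partial>count_space L') \<partial>m)"
  proof (rule nn_integral_count_space_nn_integral[OF countable_L[OF L'], symmetric])
    fix i assume "i \<in> L'"
    then have [measurable]: "g i \<in> borel_measurable m"
      using L' by auto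
    show "(\<lambda>z. ennreal (g i z) * f z) \<in> borel_measurable m"
      by measurable
  qed
  also have "\<dots> \<le> (\<integral>\<^sup>+z. f z * indicator D z \<partial>m)"
  proof (intro nn_integral_mono)
    fix z assume z: "z \<in> space m"
    have "(\<integral>\<^sup>+i. ennreal (g i z) \<partial>count_space L') * f z \<le> indicator D z * f z"
      using g_sum_subset[OF L', of z] z by (intro mult_right_mono) auto
    then show "(\<integral>\<^sup>+i. ennreal (g i z) * f z \<partial>count_space L') \<le> f z * indicator D z"
      by (subst nn_integral_multc) (simp_all add: mult.commute)
  qed
  finally show ?thesis .
qed

definition CS :: real where "CS = CN * NV\<^sup>2 * Cf\<^sup>2 * P\<phi> / C1"

lemma CS_pos: "0 < CS"
  using CN_pos NV_ge_1 Cf_pos P\<phi>_pos C1_pos by (simp add: CS_def)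

text \<open>Jensen's inequality in both averages. The weights \<open>g i z\<close> and
  \<open>g j w\<close> are kept on the right without normalisation, so that a sum over
  \<open>i\<close> and \<open>j\<close> can be carried out by
  \<open>sum_g_integral_le\<close>.\<close>

lemma average_difference_le:
  assumes j: "j \<in> L" and i: "i \<in> L" "i \<in> nbr j" and T [measurable]: "T \<in> sets m"
    and Ti: "\<And>z. z \<in> M \<Longrightarrow> g i z \<noteq> 0 \<Longrightarrow> z \<in> T" and Tj: "\<And>z. z \<in> M \<Longrightarrow> g j z \<noteq> 0 \<Longrightarrow> z \<in> T"
  shows "ennreal (CN * V (x j) (r j) / \<phi> (r j) * (b i - b j)\<^sup>2)
    \<le> (\<integral>\<^sup>+z. ennreal (g i z) * (\<integral>\<^sup>+w. ennreal (g j w) * (ennreal CS * q T z w) \<partial>m) \<partial>m)"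
proof -
  have jI: "j \<in> I" "x j \<in> M" "0 < r j" and iI: "i \<in> I" "x i \<in> M" "0 < r i"
    using j i L_I x_M r_pos by auto
  note [measurable] = g_measurable[OF i(1)] g_measurable[OF j]
  define W where "W = CN * V (x j) (r j) / \<phi> (r j)"
  have pos: "0 < V (x j) (r j)" "0 < \<phi> (r j)" "0 < F i" "0 < F j"
    using jI i j V_pos \<phi>_pos F_pos by auto
  have W: "0 \<le> W"
    unfolding W_def using CN_pos pos by simp
  have nb: "r i \<le> 6 * r j" "d (x i) (x j) \<le> 4 * (r i + r j)"
    using i by (auto simp: nbr_def)
  have "V (x j) (r j) \<le> NV * V (x i) (r i)"
    by (rule nbr_vol(1)[OF jI(1) i(2)])
  also have "\<dots> \<le> NV * (Cf * F i)"
    using F_ge[OF i(1)] NV_ge_1 by (intro mult_left_mono) auto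
  finally have "V (x j) (r j) * V (x j) (r j) \<le> (NV * (Cf * F i)) * (Cf * F j)"
    using F_ge[OF j] pos NV_ge_1 Cf_pos by (intro mult_mono) auto
  \<comment> \<open>\<open>W\<close> has the size of volume over \<phi>, and each of
    \<open>F i\<close>, \<open>F j\<close> is at least a multiple of the volume. What remains is 1 /
    (volume * \<phi>), the size of the kernel between the two supports.\<close>
  then have WF: "W / (F i * F j) \<le> CS * (C1 / (NV * P\<phi> * (V (x j) (r j) * \<phi> (r j))))"
  proof -
    assume le: "V (x j) (r j) * V (x j) (r j) \<le> (NV * (Cf * F i)) * (Cf * F j)"
    have "W / (F i * F j) = CN / (V (x j) (r j) * \<phi> (r j)) * ((V (x j) (r j) * V (x j) (r j)) / (F i * F j))"
      using pos by (simp add: W_def field_simps)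
    also have "\<dots> \<le> CN / (V (x j) (r j) * \<phi> (r j)) * (NV * Cf\<^sup>2)"
      using pos le CN_pos by (intro mult_left_mono) (auto simp: divide_le_eq power2_eq_square mult_ac)
    also have "\<dots> = CS * (C1 / (NV * P\<phi> * (V (x j) (r j) * \<phi> (r j))))"
      using pos C1_pos NV_ge_1 P\<phi>_pos by (simp add: CS_def power2_eq_square field_simps)
    finally show ?thesis .
  qed
  have pw: "ennreal W * ennreal (g i z / F i) * ennreal (g j w / F j * (h z - h w)\<^sup>2)
      \<le> ennreal (g i z) * (ennreal (g j w) * (ennreal CS * q T z w))" if z: "z \<in> M" and w: "w \<in> M" for z w
  proof (cases "g i z = 0 \<or> g j w = 0 \<or> z = w")
    case False
    then have dz: "d z (x i) \<le> 9 * r i" and dw: "d w (x j) \<le> 9 * r j" and T: "z \<in> T" "w \<in> T"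
      using g_near i(1) j Ti Tj z w by auto
    have tri: "d z (x j) \<le> d z (x i) + d (x i) (x j)" "d z w \<le> d z (x j) + d (x j) w"
      using z w jI iI by (auto intro!: MS.triangle)
    \<comment> \<open>In units of \<open>r j\<close>, the distance from \<open>z\<close> to
      \<open>x j\<close> is at most 54 + 28 = 82, and that from \<open>z\<close> to \<open>w\<close>
      at most 91.\<close>
    have "C1 / (NV * P\<phi> * (V (x j) (r j) * \<phi> (r j))) \<le> J z w"
      using z w jI False tri dz dw nb MS.commute[of w "x j"] by (intro J_lower) auto
    then have "W / (F i * F j) \<le> CS * J z w"
      using WF CS_pos by (meson mult_left_mono order_trans less_imp_le)
    then have "(g i z * g j w * (h z - h w)\<^sup>2) * (W / (F i * F j)) \<le> (g i z * g j w * (h z - h w)\<^sup>2) * (CS * J z w)"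
      using g_nonneg i(1) j z w by (intro mult_left_mono) auto
    then have "ennreal (W * (g i z / F i) * (g j w / F j * (h z - h w)\<^sup>2))
        \<le> ennreal (g i z * (g j w * (CS * ((h z - h w)\<^sup>2 * J z w))))"
      by (intro ennreal_leI) (simp add: mult_ac)
    moreover have "ennreal W * ennreal (g i z / F i) * ennreal (g j w / F j * (h z - h w)\<^sup>2)
        = ennreal (W * (g i z / F i) * (g j w / F j * (h z - h w)\<^sup>2))"
      using W pos g_nonneg[OF i(1) z] g_nonneg[OF j w]
      by (simp add: ennreal_mult del: times_divide_eq_left times_divide_eq_right)
    moreover have "ennreal (g i z) * (ennreal (g j w) * (ennreal CS * q T z w))
        = ennreal (g i z * (g j w * (CS * ((h z - h w)\<^sup>2 * J z w))))"
      using T CS_pos g_nonneg[OF i(1) z] g_nonneg[OF j w] J_nonneg[OF z w]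
      by (simp add: q_def je_def ennreal_mult)
    ultimately show ?thesis
      by simp
  qed auto
  have "ennreal (W * (b i - b j)\<^sup>2) = ennreal W * ennreal ((b j - b i)\<^sup>2)"
    using W by (simp add: ennreal_mult power2_commute)
  also have "\<dots> \<le> ennreal W * (\<integral>\<^sup>+z. ennreal (g i z / F i * (b j - h z)\<^sup>2) \<partial>m)"
    using average_Jensen[OF i(1)] by (rule mult_left_mono) simp
  also have "\<dots> = (\<integral>\<^sup>+z. ennreal W * ennreal (g i z / F i * (b j - h z)\<^sup>2) \<partial>m)"
    by (intro nn_integral_cmult[symmetric]) measurable
  also have "\<dots> \<le> (\<integral>\<^sup>+z. (\<integral>\<^sup>+w. ennreal W * ennreal (g i z / F i) * ennreal (g j w / F j * (h z - h w)\<^sup>2) \<partial>m) \<partial>m)"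
  proof (intro nn_integral_mono)
    fix z assume z: "z \<in> space m"
    have "ennreal W * ennreal (g i z / F i * (b j - h z)\<^sup>2) = ennreal W * ennreal (g i z / F i) * ennreal ((h z - b j)\<^sup>2)"
      using g_nonneg[OF i(1)] z pos by (subst ennreal_mult) (auto simp: power2_commute mult.assoc)
    also have "\<dots> \<le> ennreal W * ennreal (g i z / F i) * (\<integral>\<^sup>+w. ennreal (g j w / F j * (h z - h w)\<^sup>2) \<partial>m)"
      using average_Jensen[OF j] by (rule mult_left_mono) simp
    also have "\<dots> = (\<integral>\<^sup>+w. ennreal W * ennreal (g i z / F i) * ennreal (g j w / F j * (h z - h w)\<^sup>2) \<partial>m)"
      by (intro nn_integral_cmult[symmetric]) measurable
    finally show "ennreal W * ennreal (g i z / F i * (b j - h z)\<^sup>2)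
      \<le> (\<integral>\<^sup>+w. ennreal W * ennreal (g i z / F i) * ennreal (g j w / F j * (h z - h w)\<^sup>2) \<partial>m)" .
  qed
  also have "\<dots> \<le> (\<integral>\<^sup>+z. (\<integral>\<^sup>+w. ennreal (g i z) * (ennreal (g j w) * (ennreal CS * q T z w)) \<partial>m) \<partial>m)"
    using pw by (intro nn_integral_mono) simp
  also have "\<dots> = (\<integral>\<^sup>+z. ennreal (g i z) * (\<integral>\<^sup>+w. ennreal (g j w) * (ennreal CS * q T z w) \<partial>m) \<partial>m)"
    by (intro nn_integral_cong nn_integral_cmult) measurable
  finally show ?thesis
    by (simp add: W_def)
qed

text \<open>The reference value is \<open>b j\<close>, and the index \<open>j\<close> of a near pair
  lies in \<open>L'\<close> because it is touched at the first point. Enlarging the sum over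
  neighbours to all of \<open>L'\<close> is harmless: \<open>sum_g_integral_le\<close>, applied once
  for \<open>i\<close> and once for \<open>j\<close>, collapses the double sum to the integral over
  \<open>T \<times> T\<close>.\<close>

lemma JI_near_small:
  assumes L': "L' \<subseteq> L" and [measurable]: "S0 \<in> sets m2" "T \<in> sets m"
    and T: "\<And>i z. i \<in> L' \<Longrightarrow> z \<in> M \<Longrightarrow> g i z \<noteq> 0 \<Longrightarrow> z \<in> T"
    and S0: "\<And>p y. (p, y) \<in> S0 \<Longrightarrow> touched p \<subseteq> L' \<and> touched y \<subseteq> L' \<and> (\<exists>j\<in>I. (p, y) \<in> near_at j)"
  shows "JI S0 h \<le> ennreal CS * JI (T \<times> T) h"
proof -
  note [measurable] = q_measurable[OF \<open>T \<in> sets m\<close>]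
  have L'I: "j \<in> I" "j \<in> L" if "j \<in> L'" for j
    using that L' L_I by auto
  define H where "H j z = (\<integral>\<^sup>+w. ennreal (g j w) * (ennreal CS * q T z w) \<partial>m)" for j z
  have H_meas: "H j \<in> borel_measurable m" if "j \<in> L'" for j
  proof -
    have [measurable]: "g j \<in> borel_measurable m"
      using L'I[OF that] by measurable
    show ?thesis
      unfolding H_def by measurable
  qed
  have "JI S0 h \<le> (\<integral>\<^sup>+j. JI (S0 \<inter> near_at j) h \<partial>count_space L')"
  proof (rule JI_le_nn_integral_count_space[OF h_measurable countable_L[OF L']])
    show "S0 \<inter> near_at j \<in> sets m2" if "j \<in> L'" for j
      using L'I[OF that] by measurable
    fix z assume z: "z \<in> S0"
    then obtain p y where "z = (p, y)" by (cases z)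
    then show "\<exists>j\<in>L'. z \<in> S0 \<inter> near_at j"
      using S0[of p y] z near_at_touched(3)[of _ p y] by blast
  qed
  also have "\<dots> \<le> (\<integral>\<^sup>+j. (\<integral>\<^sup>+z. H j z \<partial>m) \<partial>count_space L')"
  proof (intro nn_integral_mono)
    fix j assume "j \<in> space (count_space L')"
    then have j: "j \<in> L'" by simp
    note jI = L'I[OF j]
    have nbr: "finite (nbr j)"
      by (rule nbr_finite_card(1)[OF jI(1)])
    have [measurable]: "near_at j \<in> sets m2"
      using jI by measurable
    have "JI (S0 \<inter> near_at j) h
        \<le> ennreal (CN * V (x j) (r j) / \<phi> (r j) * (\<Sum>i\<in>nbr j \<inter> L'. (bb i - b j)\<^sup>2))"
    proof (rule JI_near_ball[OF jI(1)])
      fix p y assume py: "(p, y) \<in> S0 \<inter> near_at j"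
      then show "d (x j) p < 5 / 2 * r j \<and> d p y < r j \<and> touched p \<subseteq> nbr j \<inter> L' \<and> touched y \<subseteq> nbr j \<inter> L'"
        using near_at_touched(1,2)[OF jI(1), of p y] S0[of p y] by (auto simp: near_at_def)
    qed auto
    also have "\<dots> = (\<Sum>i\<in>nbr j \<inter> L'. ennreal (CN * V (x j) (r j) / \<phi> (r j) * (b i - b j)\<^sup>2))"
      unfolding sum_distrib_left using CN_pos \<phi>_pos[OF r_pos[OF jI(1)]] L'I
      by (subst sum_ennreal) (auto simp: bb_def intro!: sum.cong arg_cong[where f = ennreal])
    also have "\<dots> \<le> (\<Sum>i\<in>nbr j \<inter> L'. (\<integral>\<^sup>+z. ennreal (g i z) * H j z \<partial>m))"
      unfolding H_def using L'I jI j T by (intro sum_mono average_difference_le) auto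
    also have "\<dots> \<le> (\<integral>\<^sup>+i. (\<integral>\<^sup>+z. ennreal (g i z) * H j z \<partial>m) \<partial>count_space L')"
      using nbr by (intro sum_le_nn_integral_count_space) auto
    also have "\<dots> \<le> (\<integral>\<^sup>+z. H j z * indicator D z \<partial>m)"
      by (rule sum_g_integral_le[OF L' H_meas[OF j]])
    also have "\<dots> \<le> (\<integral>\<^sup>+z. H j z \<partial>m)"
      by (intro nn_integral_mono) (simp add: indicator_def)
    finally show "JI (S0 \<inter> near_at j) h \<le> (\<integral>\<^sup>+z. H j z \<partial>m)" .
  qed
  also have "\<dots> = (\<integral>\<^sup>+j. (\<integral>\<^sup>+w. ennreal (g j w) * (\<integral>\<^sup>+z. ennreal CS * q T z w \<partial>m) \<partial>m) \<partial>count_space L')"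
  proof (rule nn_integral_cong)
    fix j assume "j \<in> space (count_space L')"
    then have [measurable]: "g j \<in> borel_measurable m"
      using L'I by auto
    have "(\<integral>\<^sup>+z. H j z \<partial>m) = (\<integral>\<^sup>+w. \<integral>\<^sup>+z. ennreal (g j w) * (ennreal CS * q T z w) \<partial>m \<partial>m)"
      unfolding H_def by (rule pm.Fubini') measurable
    also have "\<dots> = (\<integral>\<^sup>+w. ennreal (g j w) * (\<integral>\<^sup>+z. ennreal CS * q T z w \<partial>m) \<partial>m)"
      by (intro nn_integral_cong nn_integral_cmult) measurable
    finally show "(\<integral>\<^sup>+z. H j z \<partial>m) = (\<integral>\<^sup>+w. ennreal (g j w) * (\<integral>\<^sup>+z. ennreal CS * q T z w \<partial>m) \<partial>m)" .
  qed
  also have "\<dots> \<le> (\<integral>\<^sup>+w. (\<integral>\<^sup>+z. ennreal CS * q T z w \<partial>m) * indicator D w \<partial>m)"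
    by (rule sum_g_integral_le[OF L']) measurable
  also have "\<dots> \<le> (\<integral>\<^sup>+w. (\<integral>\<^sup>+z. ennreal CS * q T w z \<partial>m) \<partial>m)"
    using q_sym[of _ _ T] by (intro nn_integral_mono) (auto simp: indicator_def intro!: nn_integral_mono)
  also have "\<dots> = (\<integral>\<^sup>+w. ennreal CS * (\<integral>\<^sup>+z. q T w z \<partial>m) \<partial>m)"
    by (intro nn_integral_cong nn_integral_cmult) measurable
  also have "\<dots> = ennreal CS * JI (T \<times> T) h"
    unfolding q_integral[OF \<open>T \<in> sets m\<close>, symmetric] by (rule nn_integral_cmult) measurable
  finally show ?thesis .
qed

text \<open>Here touched indices may be missing from \<open>L\<close>, so the reference value is 0,
  and \<open>r j\<close> \<ge> \<theta> keeps 1 / \<open>\<phi> (r j)\<close> bounded. One factor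
  \<open>NV\<close> compares the volumes of neighbours; the other counts, after the sums are
  exchanged, the indices \<open>j\<close> that a given \<open>i\<close> serves.\<close>

lemma JI_near_large:
  assumes [measurable]: "S0 \<in> sets m2" and \<theta>: "0 < \<theta>"
    and S0: "\<And>p y. (p, y) \<in> S0 \<Longrightarrow> \<exists>j\<in>I. \<theta> \<le> r j \<and> (p, y) \<in> near_at j"
  shows "JI S0 h \<le> ennreal (CN * NV\<^sup>2 * Cf / \<phi> \<theta>) * (\<integral>\<^sup>+z. ennreal ((h z)\<^sup>2) * indicator D z \<partial>m)"
proof -
  define I' where "I' = {j \<in> I. \<theta> \<le> r j}"
  have I'I: "j \<in> I" "\<theta> \<le> r j" if "j \<in> I'" for j
    using that by (auto simp: I'_def)
  have I'_count: "countable I'"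
    using countable_I by (auto simp: I'_def)
  have \<phi>\<theta>: "0 < \<phi> \<theta>"
    using \<theta> by (rule \<phi>_pos)
  define e where "e i = CN * NV / \<phi> \<theta> * V (x i) (r i) * (b i)\<^sup>2" for i
  have e_nonneg: "0 \<le> e i" for i
    unfolding e_def using CN_pos NV_ge_1 \<phi>\<theta> by simp
  have "JI S0 h \<le> (\<integral>\<^sup>+j. JI (S0 \<inter> near_at j) h \<partial>count_space I')"
  proof (rule JI_le_nn_integral_count_space[OF h_measurable I'_count])
    show "S0 \<inter> near_at j \<in> sets m2" if "j \<in> I'" for j
      using I'I[OF that] by measurable
    fix z assume z: "z \<in> S0"
    then obtain p y where "z = (p, y)" by (cases z)
    then show "\<exists>j\<in>I'. z \<in> S0 \<inter> near_at j"
      using S0[of p y] z by (auto simp: I'_def)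
  qed
  also have "\<dots> \<le> (\<integral>\<^sup>+j. (\<integral>\<^sup>+i. ennreal (e i) * indicator (nbr j) i \<partial>count_space L) \<partial>count_space I')"
  proof (intro nn_integral_mono)
    fix j assume "j \<in> space (count_space I')"
    then have j: "j \<in> I'" by simp
    note jI = I'I[OF j]
    have nbr: "finite (nbr j)"
      by (rule nbr_finite_card(1)[OF jI(1)])
    have \<phi>j: "0 < \<phi> (r j)"
      using r_pos[OF jI(1)] by (rule \<phi>_pos)
    have [measurable]: "near_at j \<in> sets m2"
      using jI by measurable
    have "JI (S0 \<inter> near_at j) h
        \<le> ennreal (CN * V (x j) (r j) / \<phi> (r j) * (\<Sum>i\<in>nbr j. (bb i - 0)\<^sup>2))"
    proof (rule JI_near_ball[OF jI(1)])
      fix p y assume py: "(p, y) \<in> S0 \<inter> near_at j"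
      then show "d (x j) p < 5 / 2 * r j \<and> d p y < r j \<and> touched p \<subseteq> nbr j \<and> touched y \<subseteq> nbr j"
        using near_at_touched(1,2)[OF jI(1), of p y] by (auto simp: near_at_def)
    qed auto
    also have "(\<Sum>i\<in>nbr j. (bb i - 0)\<^sup>2) = (\<Sum>i\<in>nbr j \<inter> L. (b i)\<^sup>2)"
      using nbr by (intro sum.mono_neutral_cong_right) (auto simp: bb_def)
    also have "ennreal (CN * V (x j) (r j) / \<phi> (r j) * \<dots>) \<le> ennreal (\<Sum>i\<in>nbr j \<inter> L. e i)"
    proof (rule ennreal_leI, unfold sum_distrib_left, rule sum_mono)
      fix i assume i: "i \<in> nbr j \<inter> L"
      have "CN * V (x j) (r j) / \<phi> (r j) \<le> CN * (NV * V (x i) (r i)) / \<phi> \<theta>"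
        using nbr_vol(1)[OF jI(1), of i] i \<phi>_mono[of \<theta> "r j"] jI \<theta> \<phi>\<theta> CN_pos NV_ge_1
        by (intro frac_le mult_left_mono) auto
      then have "CN * V (x j) (r j) / \<phi> (r j) * (b i)\<^sup>2 \<le> CN * (NV * V (x i) (r i)) / \<phi> \<theta> * (b i)\<^sup>2"
        by (rule mult_right_mono) simp
      then show "CN * V (x j) (r j) / \<phi> (r j) * (b i)\<^sup>2 \<le> e i"
        by (simp add: e_def mult_ac)
    qed
    also have "ennreal (\<Sum>i\<in>nbr j \<inter> L. e i) = (\<Sum>i\<in>nbr j \<inter> L. ennreal (e i) * indicator (nbr j) i)"
      using e_nonneg by (subst sum_ennreal[symmetric]) (auto intro!: sum.cong simp del: sum_ennreal)
    also have "\<dots> \<le> (\<integral>\<^sup>+i. ennreal (e i) * indicator (nbr j) i \<partial>count_space L)"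
      using nbr by (intro sum_le_nn_integral_count_space) auto
    finally show "JI (S0 \<inter> near_at j) h \<le> (\<integral>\<^sup>+i. ennreal (e i) * indicator (nbr j) i \<partial>count_space L)" .
  qed
  also have "\<dots> = (\<integral>\<^sup>+i. (\<integral>\<^sup>+j. ennreal (e i) * indicator (nbr j) i \<partial>count_space I') \<partial>count_space L)"
    using I'_count by (intro nn_integral_count_space_nn_integral[symmetric]) auto
  also have "\<dots> \<le> (\<integral>\<^sup>+i. ennreal NV * ennreal (CN * NV * Cf / \<phi> \<theta>) *
      (\<integral>\<^sup>+z. ennreal (g i z) * ennreal ((h z)\<^sup>2) \<partial>m) \<partial>count_space L)"
  proof (intro nn_integral_mono)
    fix i assume "i \<in> space (count_space L)"
    then have i: "i \<in> L" and iI: "i \<in> I"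
      using L_I by auto
    note [measurable] = g_measurable[OF i]
    have Fi: "0 < F i"
      by (rule F_pos[OF i])
    have fin: "finite (nbr i \<inter> I')"
      using nbr_finite_card(1)[OF iI] by auto
    have "(\<integral>\<^sup>+j. ennreal (e i) * indicator (nbr j) i \<partial>count_space I')
        \<le> (\<integral>\<^sup>+j. ennreal (e i) * indicator (nbr i \<inter> I') j \<partial>count_space I')"
      using nbr_sym I'I by (intro nn_integral_mono) (auto simp: indicator_def)
    also have "\<dots> = ennreal (e i) * ennreal (real (card (nbr i \<inter> I')))"
      using fin by (subst nn_integral_cmult_indicator) (auto simp: emeasure_count_space ennreal_of_nat_eq_real_of_nat)
    also have "\<dots> \<le> ennreal (e i) * ennreal NV"
      using card_mono[OF nbr_finite_card(1)[OF iI], of "nbr i \<inter> I'"] nbr_finite_card(2)[OF iI]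
      by (intro mult_left_mono ennreal_leI) auto
    also have "ennreal (e i) \<le> ennreal (CN * NV * Cf / \<phi> \<theta>) * (\<integral>\<^sup>+z. ennreal (g i z) * ennreal ((h z)\<^sup>2) \<partial>m)"
    proof -
      have "CN * NV / \<phi> \<theta> * V (x i) (r i) \<le> CN * NV / \<phi> \<theta> * (Cf * F i)"
        using F_ge[OF i] CN_pos NV_ge_1 \<phi>\<theta> by (intro mult_left_mono) auto
      then have "e i \<le> CN * NV / \<phi> \<theta> * (Cf * F i) * (b i)\<^sup>2"
        unfolding e_def by (rule mult_right_mono) simp
      then have "ennreal (e i) \<le> ennreal (CN * NV * Cf / \<phi> \<theta> * (F i * (b i)\<^sup>2))"
        by (intro ennreal_leI) (simp add: mult_ac)
      also have "\<dots> = ennreal (CN * NV * Cf / \<phi> \<theta>) * (ennreal (F i) * ennreal ((0 - b i)\<^sup>2))"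
        using CN_pos NV_ge_1 Cf_pos \<phi>\<theta> Fi by (simp add: ennreal_mult del: times_divide_eq_left times_divide_eq_right)
      also have "\<dots> \<le> ennreal (CN * NV * Cf / \<phi> \<theta>) * (ennreal (F i) * (\<integral>\<^sup>+z. ennreal (g i z / F i * (0 - h z)\<^sup>2) \<partial>m))"
        by (intro mult_left_mono average_Jensen[OF i]) auto
      also have "ennreal (F i) * (\<integral>\<^sup>+z. ennreal (g i z / F i * (0 - h z)\<^sup>2) \<partial>m)
          = (\<integral>\<^sup>+z. ennreal (F i) * ennreal (g i z / F i * (0 - h z)\<^sup>2) \<partial>m)"
        by (intro nn_integral_cmult[symmetric]) measurable
      also have "\<dots> = (\<integral>\<^sup>+z. ennreal (g i z) * ennreal ((h z)\<^sup>2) \<partial>m)"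
        using Fi g_nonneg[OF i] by (intro nn_integral_cong) (auto simp flip: ennreal_mult)
      finally show ?thesis .
    qed
    finally show "(\<integral>\<^sup>+j. ennreal (e i) * indicator (nbr j) i \<partial>count_space I')
      \<le> ennreal NV * ennreal (CN * NV * Cf / \<phi> \<theta>) * (\<integral>\<^sup>+z. ennreal (g i z) * ennreal ((h z)\<^sup>2) \<partial>m)"
      by (simp add: mult_ac mult_right_mono)
  qed
  also have "\<dots> = ennreal NV * ennreal (CN * NV * Cf / \<phi> \<theta>) *
      (\<integral>\<^sup>+i. (\<integral>\<^sup>+z. ennreal (g i z) * ennreal ((h z)\<^sup>2) \<partial>m) \<partial>count_space L)"
    by (rule nn_integral_cmult) simp
  also have "\<dots> \<le> ennreal NV * ennreal (CN * NV * Cf / \<phi> \<theta>) * (\<integral>\<^sup>+z. ennreal ((h z)\<^sup>2) * indicator D z \<partial>m)"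
    by (intro mult_left_mono sum_g_integral_le[OF order_refl]) auto
  also have "ennreal NV * ennreal (CN * NV * Cf / \<phi> \<theta>) = ennreal (CN * NV\<^sup>2 * Cf / \<phi> \<theta>)"
    using NV_ge_1 CN_pos Cf_pos \<phi>\<theta> by (simp add: power2_eq_square mult_ac flip: ennreal_mult)
  finally show ?thesis .
qed

section \<open>Assembly of the local and the global estimate\<close>

definition A1 :: real where "A1 = 1 + 2 * CJ * (NV * Cf) + CJ * (NV * Cf)\<^sup>2 + 2 * CS"

text \<open>Shared by both estimates. The hypothesis \<open>touch\<close> guarantees that
  \<open>h\<close> reproduces constants at the points concerned; pairs near a ball of radius at
  least \<theta> are handed back to the caller. Mixed and near pairs are ordered, so they occur
  together with their reversals, which explains the factors 2 in \<open>A1\<close>.\<close>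

lemma JI_core:
  assumes null: "cl - D \<in> null_sets m"
    and L': "L' \<subseteq> L" and [measurable]: "P \<in> sets m2" "T \<in> sets m"
    and T: "\<And>i z. i \<in> L' \<Longrightarrow> z \<in> M \<Longrightarrow> g i z \<noteq> 0 \<Longrightarrow> z \<in> T"
    and sym: "\<And>p y. (p, y) \<in> P \<Longrightarrow> (y, p) \<in> P"
    and close: "\<And>p y. (p, y) \<in> P \<Longrightarrow> d p y < \<theta>"
    and PT: "\<And>p y. (p, y) \<in> P \<Longrightarrow> p \<in> D \<Longrightarrow> p \<in> T"
    and touch: "\<And>p y j. (p, y) \<in> P \<Longrightarrow> j \<in> I \<Longrightarrow> r j < \<theta> \<Longrightarrow> d (x j) p < 7 / 2 * r j \<Longrightarrow> touched p \<subseteq> L'"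
  shows "JI P h \<le> ennreal A1 * JI (T \<times> T) h + 2 * JI (P \<inter> (\<Union>j\<in>{j \<in> I. \<theta> \<le> r j}. near_at j)) h"
proof -
  define N where "N = cl - D"
  have N [measurable]: "N \<in> sets m"
    by (simp add: N_def)
  define near where "near = (\<Union>j\<in>I. near_at j)"
  define large where "large = (\<Union>j\<in>{j \<in> I. \<theta> \<le> r j}. near_at j)"
  define small where "small = (\<Union>j\<in>{j \<in> I. r j < \<theta>}. near_at j)"
  have near_UN: "(\<Union>j\<in>A. near_at j) \<in> sets m2" if "A \<subseteq> I" for A
    using that countable_I by (intro sets.countable_UN' near_at_sets) (auto intro: countable_subset)
  have [measurable]: "near \<in> sets m2" "large \<in> sets m2" "small \<in> sets m2"
    unfolding near_def large_def small_def by (rule near_UN, blast)+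
  define sw where "sw Q = (\<lambda>(p, q). (q, p)) -` Q \<inter> space m2" for Q :: "('a \<times> 'a) set"
  have sw_sets [measurable]: "sw Q \<in> sets m2" if [measurable]: "Q \<in> sets m2" for Q
    unfolding sw_def by measurable
  have sw_JI: "JI (sw Q) h = JI Q h" if [measurable]: "Q \<in> sets m2" for Q
    unfolding sw_def by (rule JI_swap) measurable
  have PM: "p \<in> M" "y \<in> M" if "(p, y) \<in> P" for p y
    using that sets.sets_into_space[of P "m \<Otimes>\<^sub>M m"] by (auto simp: space_pair_measure)
  define mixed where "mixed = P \<inter> D \<times> U"
  \<comment> \<open>\<open>near\<close> is removed in both orders, because
    \<open>JI_separated\<close> considers the Whitney balls that cover either point.\<close>
  define sep where "sep = P \<inter> U \<times> U - near - sw near"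
  have [measurable]: "mixed \<in> sets m2" "sep \<in> sets m2"
    unfolding mixed_def sep_def by measurable
  define Z where "Z = N \<times> M \<union> M \<times> N"
  have [measurable]: "Z \<in> sets m2"
    unfolding Z_def by measurable
  have Z_null: "JI Z h = 0"
    unfolding Z_def using null by (intro JI_null) (auto simp: N_def)
  have pieces: "P \<in> sets m2" "T \<times> T \<in> sets m2" "mixed \<in> sets m2" "sep \<in> sets m2"
    "small \<in> sets m2" "large \<in> sets m2" "Z \<in> sets m2"
    by measurable
  have cover_P: "z \<in> T \<times> T \<union> (mixed \<union> (sw mixed \<union> (sep \<union> (P \<inter> small \<union> (sw (P \<inter> small)
      \<union> (P \<inter> large \<union> (sw (P \<inter> large) \<union> Z)))))))" if z: "z \<in> P" for z
  proof -
    obtain p y where zpy: "z = (p, y)" by (cases z)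
    have py: "(p, y) \<in> P" "(y, p) \<in> P" "p \<in> M" "y \<in> M"
      using z zpy sym PM by auto
    consider "p \<in> N \<or> y \<in> N" | "p \<in> D" "y \<in> D" | "p \<in> D" "y \<in> U" | "p \<in> U" "y \<in> D" | "p \<in> U" "y \<in> U"
      using py by (auto simp: N_def U_def)
    then show ?thesis
    proof cases
      case 1
      then show ?thesis
        using py zpy by (auto simp: Z_def)
    next
      case 2
      then show ?thesis
        using PT py zpy by auto
    next
      case 5
      have "near = small \<union> large"
        by (auto simp: near_def small_def large_def) (meson not_le)
      then show ?thesis
        using 5 py zpy by (auto simp: sep_def sw_def space_pair_measure)
    qed (use py zpy in \<open>auto simp: mixed_def sw_def space_pair_measure\<close>)
  qed
  have "JI P h \<le> JI (T \<times> T \<union> (mixed \<union> (sw mixed \<union> (sep \<union> (P \<inter> small \<union> (sw (P \<inter> small)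
      \<union> (P \<inter> large \<union> (sw (P \<inter> large) \<union> Z))))))) ) h"
    using cover_P by (intro JI_mono) blast
  also have "\<dots> \<le> JI (T \<times> T) h + (JI mixed h + (JI (sw mixed) h + (JI sep h + (JI (P \<inter> small) h
      + (JI (sw (P \<inter> small)) h + (JI (P \<inter> large) h + (JI (sw (P \<inter> large)) h + JI Z h)))))))"
    by (intro JI_Un_le h_measurable sets.Un sw_sets sets.Int order_refl pieces)
  also have "\<dots> = JI (T \<times> T) h + 2 * JI mixed h + JI sep h + 2 * JI (P \<inter> small) h + 2 * JI (P \<inter> large) h"
    by (simp add: sw_JI Z_null mult_2 add_ac)
  also have "\<dots> \<le> JI (T \<times> T) h + 2 * (ennreal (CJ * (NV * Cf)) * JI (T \<times> T) h)
      + ennreal (CJ * (NV * Cf)\<^sup>2) * JI (T \<times> T) h + 2 * (ennreal CS * JI (T \<times> T) h) + 2 * JI (P \<inter> large) h"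
  proof (intro add_mono mult_left_mono order_refl)
    show "JI mixed h \<le> ennreal (CJ * (NV * Cf)) * JI (T \<times> T) h"
    proof (rule JI_mixed[OF L'])
      fix p y assume "(p, y) \<in> mixed"
      then have py: "(p, y) \<in> P" "p \<in> D" "y \<in> U"
        by (auto simp: mixed_def)
      \<comment> \<open>A touched index \<open>i\<close> is itself the witness for
        \<open>touch\<close>: \<open>p\<close> in \<open>D\<close> is at distance at least 5 *
        \<open>r i\<close> from \<open>x i\<close>, so 2 * \<open>r i\<close> < \<open>d p y\<close>
        < \<theta>. If nothing is touched, the inclusion is trivial.\<close>
      have "touched y \<subseteq> L'" if i: "i \<in> touched y" for i
      proof -
        have iI: "i \<in> I" "d (x i) y < 3 * r i" "x i \<in> M" "0 < r i"
          using i x_M r_pos by (auto simp: touched_def)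
        have "5 * r i \<le> d (x i) p"
          using iI py D_sub by (intro dist_ge) auto
        also have "\<dots> \<le> d (x i) y + d y p"
          using iI PM[OF py(1)] by (intro MS.triangle) auto
        finally have "2 * r i < d p y"
          using iI by (simp add: MS.commute)
        then have "r i < \<theta>"
          using close[OF py(1)] iI by simp
        then show ?thesis
          using touch[OF sym[OF py(1)] iI(1)] iI by simp
      qed
      then show "p \<in> T \<inter> D \<and> y \<in> U \<and> touched y \<subseteq> L'"
        using py PT by blast
    qed (use T in auto)
    show "JI sep h \<le> ennreal (CJ * (NV * Cf)\<^sup>2) * JI (T \<times> T) h"
    proof (rule JI_separated[OF L'])
      have sepD: "r j \<le> d p y" if "(p, y) \<in> sep" "j \<in> I" "d (x j) p < 5 / 2 * r j \<or> d (x j) y < 5 / 2 * r j" for p y j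
      proof (rule ccontr)
        assume "\<not> r j \<le> d p y"
        moreover have "p \<in> M" "y \<in> M"
          using that(1) PM by (auto simp: sep_def)
        ultimately have "(p, y) \<in> near_at j \<or> (y, p) \<in> near_at j"
          using that(3) by (auto simp: near_at_def space_pair_measure MS.commute)
        then show False
          using that(1,2) \<open>p \<in> M\<close> \<open>y \<in> M\<close> by (auto simp: sep_def near_def sw_def space_pair_measure)
      qed
      then show "\<And>p y j. (p, y) \<in> sep \<Longrightarrow> j \<in> I \<Longrightarrow> d (x j) p < 5 / 2 * r j \<or> d (x j) y < 5 / 2 * r j \<Longrightarrow> r j \<le> d p y" .
      fix p y assume py: "(p, y) \<in> sep"
      then have P: "(p, y) \<in> P" "(y, p) \<in> P" and pU: "p \<in> U" and yU: "y \<in> U"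
        using sym by (auto simp: sep_def)
      obtain j where j: "j \<in> I" "d (x j) p < 5 / 2 * r j"
        using pU by (rule cover)
      obtain k where k: "k \<in> I" "d (x k) y < 5 / 2 * r k"
        using yU by (rule cover)
      have "r j < \<theta>" "r k < \<theta>"
        using sepD[OF py j(1)] sepD[OF py k(1)] j k close[OF P(1)] by auto
      moreover have "d (x j) p < 7 / 2 * r j" "d (x k) y < 7 / 2 * r k"
        using j k r_pos[OF j(1)] r_pos[OF k(1)] by auto
      ultimately show "p \<in> U \<and> y \<in> U \<and> touched p \<subseteq> L' \<and> touched y \<subseteq> L'"
        using pU yU touch[OF P(1) j(1)] touch[OF P(2) k(1)] by blast
    qed (use T in auto)
    show "JI (P \<inter> small) h \<le> ennreal CS * JI (T \<times> T) h"
    proof (rule JI_near_small[OF L'])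
      fix p y assume py: "(p, y) \<in> P \<inter> small"
      then obtain j where j: "j \<in> I" "r j < \<theta>" "(p, y) \<in> near_at j"
        by (auto simp: small_def)
      have P: "(p, y) \<in> P" "(y, p) \<in> P" and pyM: "p \<in> M" "y \<in> M"
        using py sym PM by auto
      have d: "d (x j) p < 5 / 2 * r j" "d p y < r j"
        using j by (auto simp: near_at_def)
      have "d (x j) y \<le> d (x j) p + d p y"
        using pyM x_M[OF j(1)] by (intro MS.triangle) auto
      then show "touched p \<subseteq> L' \<and> touched y \<subseteq> L' \<and> (\<exists>j\<in>I. (p, y) \<in> near_at j)"
        using touch[OF P(1) j(1,2)] touch[OF P(2) j(1,2)] d j r_pos[OF j(1)] by auto
    qed (use T in auto)
  qed auto
  also have "\<dots> = ennreal A1 * JI (T \<times> T) h + 2 * JI (P \<inter> large) h"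
  proof -
    have "ennreal A1 = 1 + 2 * ennreal (CJ * (NV * Cf)) + ennreal (CJ * (NV * Cf)\<^sup>2) + 2 * ennreal CS"
      using CJ_pos NV_ge_1 Cf_pos CS_pos unfolding A1_def
      by (simp add: ennreal_plus ennreal_mult mult.assoc)
    then show ?thesis
      by (simp add: distrib_right mult.assoc)
  qed
  finally show ?thesis
    by (simp add: large_def)
qed

text \<open>For \<open>y\<close> in the ball and a touched \<open>i\<close>, the position of
  \<open>x0\<close> in the closure gives 5 * \<open>r i\<close> \<le> \<open>d (x i) x0\<close> < 3
  * \<open>r i\<close> + \<open>R\<close>, hence 2 * \<open>r i\<close> < \<open>R\<close>. So
  \<open>i\<close> belongs to \<open>L\<close>, and points where \<open>g i\<close> is nonzero lie
  within \<open>R\<close> + 12 * \<open>r i\<close> < 7 * \<open>R\<close> of \<open>x0\<close>,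
  which is the origin of the 7.\<close>

lemma JI_local:
  assumes null: "cl - D \<in> null_sets m" and x0: "x0 \<in> cl"
    and L_R: "\<And>i. i \<in> I \<Longrightarrow> 2 * r i < R \<Longrightarrow> i \<in> L"
  shows "JI (ball x0 R \<times> ball x0 R) h
    \<le> ennreal A1 * JI ((ball x0 (7 * R) \<inter> D) \<times> (ball x0 (14 * R) \<inter> D)) h"
proof -
  define T where "T = ball x0 (7 * R) \<inter> D"
  define L' where "L' = {i \<in> L. \<forall>z\<in>M. g i z \<noteq> 0 \<longrightarrow> z \<in> T}"
  have x0M: "x0 \<in> M"
    using x0 cl_sub by auto
  have near_x0: "2 * r i < R" "i \<in> L'" if y: "y \<in> ball x0 R" and i: "i \<in> touched y" for y i
  proof -
    have iI: "i \<in> I" "d (x i) y < 3 * r i" "x i \<in> M" "0 < r i" and yM: "y \<in> M" and dy: "d x0 y < R"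
      using i y x_M r_pos by (auto simp: touched_def)
    have "5 * r i \<le> d (x i) x0"
      using iI x0 by (intro dist_ge) auto
    also have "\<dots> \<le> d (x i) y + d y x0"
      using iI yM x0M by (intro MS.triangle) auto
    finally show ri: "2 * r i < R"
      using iI dy by (simp add: MS.commute)
    then have iL: "i \<in> L"
      using L_R iI by auto
    have "z \<in> T" if z: "z \<in> M" "g i z \<noteq> 0" for z
    proof -
      have "d x0 z \<le> d x0 y + d y z" "d y z \<le> d y (x i) + d (x i) z"
        using z yM x0M iI by (auto intro!: MS.triangle)
      then have "d x0 z < 7 * R"
        using g_near[OF iL z] ri iI dy by (simp add: MS.commute)
      moreover have "z \<in> D"
        using g_outside[OF iL z(1)] z by auto
      ultimately show ?thesis
        using z x0M by (simp add: T_def)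
    qed
    then show "i \<in> L'"
      using iL by (simp add: L'_def)
  qed
  have "JI (ball x0 R \<times> ball x0 R) h
      \<le> ennreal A1 * JI (T \<times> T) h + 2 * JI (ball x0 R \<times> ball x0 R \<inter> (\<Union>j\<in>{j \<in> I. 2 * R \<le> r j}. near_at j)) h"
  proof (rule JI_core[OF null, where L' = L'])
    fix p y assume py: "(p, y) \<in> ball x0 R \<times> ball x0 R"
    then have "d p y \<le> d p x0 + d x0 y"
      by (intro MS.triangle) auto
    then show "d p y < 2 * R"
      using py by (auto simp: MS.commute)
    show "p \<in> T" if "p \<in> D"
      using py that x0M le_less_trans[OF MS.nonneg, of x0 p R] by (auto simp: T_def)
  qed (use near_x0 in \<open>auto simp: L'_def T_def\<close>)
  \<comment> \<open>A ball near such a pair is touched at its first point, so its radius is below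
    \<open>R\<close> / 2, and the remainder of \<open>JI_core\<close> is empty for the threshold 2 *
    \<open>R\<close>.\<close>
  also have "ball x0 R \<times> ball x0 R \<inter> (\<Union>j\<in>{j \<in> I. 2 * R \<le> r j}. near_at j) = {}"
  proof -
    have False if "(p, y) \<in> ball x0 R \<times> ball x0 R" "j \<in> I" "2 * R \<le> r j" "(p, y) \<in> near_at j" for p y j
      using near_x0(1)[of p j] near_at_touched(3)[OF that(2,4)] that r_pos[of j] by auto
    then show ?thesis by blast
  qed
  also have "ennreal A1 * JI (T \<times> T) h + 2 * JI {} h = ennreal A1 * JI (T \<times> T) h"
    by (simp add: JI_eq)
  also have "\<dots> \<le> ennreal A1 * JI ((ball x0 (7 * R) \<inter> D) \<times> (ball x0 (14 * R) \<inter> D)) h"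
  proof (intro mult_left_mono JI_mono)
    have "y \<in> ball x0 (14 * R)" if "y \<in> ball x0 (7 * R)" for y
    proof -
      have "0 \<le> d x0 y" "d x0 y < 7 * R"
        using that by auto
      then have "d x0 y < 14 * R"
        by linarith
      then show ?thesis
        using that by simp
    qed
    then show "z \<in> (ball x0 (7 * R) \<inter> D) \<times> (ball x0 (14 * R) \<inter> D)" if "z \<in> T \<times> T" for z
      using that unfolding T_def by blast
  qed simp
  finally show ?thesis .
qed

lemma h_L2_le:
  assumes null: "cl - D \<in> null_sets m"
  shows "(\<integral>\<^sup>+z. ennreal ((h z)\<^sup>2) \<partial>m) \<le> ennreal (1 + NV * Cf) * (\<integral>\<^sup>+z. ennreal ((h z)\<^sup>2) * indicator D z \<partial>m)"
proof -
  have "(\<integral>\<^sup>+z. ennreal ((h z)\<^sup>2) \<partial>m) = (\<integral>\<^sup>+z. ennreal ((h z)\<^sup>2) * indicator D z + ennreal ((h z)\<^sup>2) * indicator U z \<partial>m)"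
    using AE_not_in[OF null] D_sub by (intro nn_integral_cong_AE) (auto simp: U_def indicator_def)
  also have "\<dots> = (\<integral>\<^sup>+z. ennreal ((h z)\<^sup>2) * indicator D z \<partial>m) + (\<integral>\<^sup>+z. ennreal ((h z)\<^sup>2) * indicator U z \<partial>m)"
    by (rule nn_integral_add) measurable
  also have "\<dots> \<le> (\<integral>\<^sup>+z. ennreal ((h z)\<^sup>2) * indicator D z \<partial>m)
      + ennreal (NV * Cf) * (\<integral>\<^sup>+z. ennreal ((h z)\<^sup>2) * indicator D z \<partial>m)"
    by (intro add_left_mono extension_L2)
  also have "\<dots> = ennreal (1 + NV * Cf) * (\<integral>\<^sup>+z. ennreal ((h z)\<^sup>2) * indicator D z \<partial>m)"
    using NV_ge_1 Cf_pos by (simp add: distrib_right ennreal_plus)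
  finally show ?thesis .
qed

definition A2 :: real where "A2 = 2 * (CN * NV\<^sup>2 * Cf) + 4 * CT * (1 + NV * Cf)"

text \<open>\<open>JI_core\<close> is used with threshold \<open>s\<close> for the pairs at distance
  below \<open>s\<close>. The hypothesis \<open>L_s\<close> carries the factor 17/4 because a ball
  of radius below \<open>s\<close> can have touched indices of radius up to 17/4 * \<open>s\<close>
  near it.\<close>

lemma JI_global:
  assumes null: "cl - D \<in> null_sets m" and s: "0 < s" and L_s: "\<And>i. i \<in> I \<Longrightarrow> r i < 17 / 4 * s \<Longrightarrow> i \<in> L"
  shows "JI (M \<times> M) h \<le> ennreal A1 * JI (D \<times> D) h + ennreal (A2 / \<phi> s) * (\<integral>\<^sup>+z. ennreal ((h z)\<^sup>2) * indicator D z \<partial>m)"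
    (is "_ \<le> _ + _ * ?H")
proof -
  define P where "P = {z \<in> space m2. d (fst z) (snd z) < s}"
  define far where "far = {z \<in> space m2. s \<le> d (fst z) (snd z)}"
  define large where "large = P \<inter> (\<Union>j\<in>{j \<in> I. s \<le> r j}. near_at j)"
  have [measurable]: "P \<in> sets m2" "far \<in> sets m2"
    unfolding P_def far_def by measurable
  have UN: "(\<Union>j\<in>{j \<in> I. s \<le> r j}. near_at j) \<in> sets m2"
    using countable_I by (intro sets.countable_UN' near_at_sets) (auto intro: countable_subset)
  have [measurable]: "large \<in> sets m2"
    unfolding large_def by (rule sets.Int[OF _ UN]) measurable
  have "JI (M \<times> M) h \<le> JI (P \<union> far) h"
    by (intro JI_mono) (auto simp: P_def far_def)
  also have "\<dots> \<le> JI P h + JI far h"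
    by (rule JI_Un) measurable
  also have "JI P h \<le> ennreal A1 * JI (D \<times> D) h + 2 * JI large h"
    unfolding large_def
  proof (rule JI_core[OF null order_refl])
    show "\<And>i z. i \<in> L \<Longrightarrow> z \<in> M \<Longrightarrow> g i z \<noteq> 0 \<Longrightarrow> z \<in> D"
      using g_outside by auto
    fix p y j assume j: "j \<in> I" "r j < s" "d (x j) p < 7 / 2 * r j"
    show "touched p \<subseteq> L"
    proof
      fix i assume i: "i \<in> touched p"
      then have "r i < 17 / 4 * s"
        using touched_nbr(3)[OF j(1,3) i] j by simp
      then show "i \<in> L"
        using i touched_I by (intro L_s) auto
    qed
  qed (auto simp: P_def space_pair_measure MS.commute)
  also have "JI large h \<le> ennreal (CN * NV\<^sup>2 * Cf / \<phi> s) * ?H"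
  proof (rule JI_near_large[OF _ s])
    show "large \<in> sets m2"
      by measurable
  qed (auto simp: large_def)
  also have "JI far h \<le> ennreal (4 * CT / \<phi> s) * (ennreal (1 + NV * Cf) * ?H)"
  proof -
    have "JI far h \<le> JI {z. s \<le> d (fst z) (snd z)} h"
      by (intro JI_mono) (auto simp: far_def)
    also have "\<dots> \<le> ennreal (4 * CT / \<phi> s) * (\<integral>\<^sup>+z. ennreal ((h z)\<^sup>2) \<partial>m)"
      by (rule JI_far[OF h_measurable s])
    also have "\<dots> \<le> ennreal (4 * CT / \<phi> s) * (ennreal (1 + NV * Cf) * ?H)"
      by (intro mult_left_mono h_L2_le[OF null]) simp
    finally show ?thesis .
  qed
  finally have "JI (M \<times> M) h \<le> ennreal A1 * JI (D \<times> D) h + 2 * (ennreal (CN * NV\<^sup>2 * Cf / \<phi> s) * ?H)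
      + ennreal (4 * CT / \<phi> s) * (ennreal (1 + NV * Cf) * ?H)"
    by (simp add: add_left_mono add_right_mono mult_left_mono)
  also have "\<dots> = ennreal A1 * JI (D \<times> D) h + ennreal (A2 / \<phi> s) * ?H"
  proof -
    have nonneg: "0 \<le> 2 * (CN * NV\<^sup>2 * Cf / \<phi> s)" "0 \<le> 4 * CT / \<phi> s * (1 + NV * Cf)" "0 \<le> 1 + NV * Cf"
      using CN_pos NV_ge_1 Cf_pos CT_nonneg \<phi>_pos[OF s] by auto
    have "A2 / \<phi> s = 2 * (CN * NV\<^sup>2 * Cf / \<phi> s) + 4 * CT / \<phi> s * (1 + NV * Cf)"
      by (simp add: A2_def add_divide_distrib)
    then have "ennreal (A2 / \<phi> s) = 2 * ennreal (CN * NV\<^sup>2 * Cf / \<phi> s) + ennreal (4 * CT / \<phi> s) * ennreal (1 + NV * Cf)"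
      using nonneg by (simp only: ennreal_plus ennreal_mult'' ennreal_numeral)
    then show ?thesis
      by (simp add: distrib_right mult.assoc add.assoc)
  qed
  finally show ?thesis .
qed

end

section \<open>The extension operator\<close>

text \<open>The sum in (D.1) is an \<open>infsum\<close>, while exchange of sum and integral is
  available for \<open>count_space\<close>. This inequality carries the upper bound over.\<close>

lemma nn_integral_count_space_le_infsum:
  fixes f :: "'i \<Rightarrow> ennreal"
  assumes A: "countable A"
  shows "(\<integral>\<^sup>+i. f i \<partial>count_space A) \<le> infsum f A"
proof (cases "finite A")
  case True
  then show ?thesis
    by (simp add: nn_integral_count_space_finite)
next
  case False
  have bij: "bij_betw (from_nat_into A) UNIV A"
    using A False by (rule bij_betw_from_nat_into)
  have "(\<integral>\<^sup>+i. f i \<partial>count_space A) = (\<integral>\<^sup>+n. f (from_nat_into A n) \<partial>count_space UNIV)"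
    by (rule nn_integral_bij_count_space[OF bij, symmetric])
  also have "\<dots> = (\<Sum>n. f (from_nat_into A n))"
    by (rule nn_integral_count_space_nat)
  also have "\<dots> \<le> infsum f A"
  proof (rule suminf_le_const)
    fix n
    have inj: "inj_on (from_nat_into A) {..<n}"
      using bij by (auto simp: bij_betw_def intro: inj_on_subset)
    have "(\<Sum>k<n. f (from_nat_into A k)) = sum f (from_nat_into A ` {..<n})"
      using inj by (simp add: sum.reindex)
    also have "\<dots> \<le> infsum f A"
      using bij by (subst nonneg_infsum_complete) (auto simp: bij_betw_def intro!: SUP_upper)
    finally show "(\<Sum>k<n. f (from_nat_into A k)) \<le> infsum f A" .
  qed simp
  finally show ?thesis .
qed

section \<open>Almost everywhere supports and the passage to real-valued forms\<close>

context doubling_jump_space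
begin

text \<open>The support is an intersection of possibly uncountably many closed sets, so the
  exceptional sets cannot simply be united. Separability reduces them to countably many balls with
  dense centres and radii 1/(n+1) on which \<open>f\<close> vanishes almost everywhere.\<close>

lemma AE_ae_support: "AE z in m. z \<notin> ae_support X m f \<longrightarrow> f z = 0"
proof -
  obtain Q where Q: "countable Q" "Q \<subseteq> M" "\<And>p e. p \<in> M \<Longrightarrow> 0 < e \<Longrightarrow> \<exists>q\<in>Q. d p q < e"
    by (rule countable_dense) blast
  define B where "B = {(q, n) \<in> Q \<times> (UNIV :: nat set). AE z in m. z \<in> ball q (1 / Suc n) \<longrightarrow> f z = 0}"
  have "countable (Q \<times> (UNIV :: nat set))"
    using Q by auto
  then have "countable B"
    by (rule countable_subset[rotated]) (auto simp: B_def)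
  then have "AE z in m. \<forall>(q, n)\<in>B. z \<in> ball q (1 / Suc n) \<longrightarrow> f z = 0"
    by (subst AE_ball_countable) (auto simp: B_def)
  then show ?thesis
  proof (rule AE_mp, intro AE_I2 impI)
    fix z assume z: "z \<in> space m" and B: "\<forall>(q, n)\<in>B. z \<in> ball q (1 / Suc n) \<longrightarrow> f z = 0"
      and "z \<notin> ae_support X m f"
    then obtain C where C: "closedin top C" "AE y in m. y \<notin> C \<longrightarrow> f y = 0" "z \<notin> C"
      by (auto simp: ae_support_def)
    then have "openin top (M - C)" "z \<in> M - C"
      using z by (auto simp: closedin_def)
    then obtain e where e: "0 < e" "ball z e \<subseteq> M - C"
      unfolding top_eq ball_eq MS.openin_mtopology by blast
    \<comment> \<open>The ball about \<open>q\<close> contains \<open>z\<close> and must stay within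
      distance \<open>e\<close> of \<open>z\<close>, so twice its radius has to be below
      \<open>e\<close>.\<close>
    obtain n where n: "2 / e < real (Suc n)"
      using reals_Archimedean2[of "2 / e"] by (metis less_Suc_eq of_nat_less_iff order_less_trans)
    then have n': "2 / Suc n < e"
      using e by (simp add: field_simps)
    obtain q where q: "q \<in> Q" "d z q < 1 / Suc n"
      using Q(3)[of z "1 / Suc n"] z by auto
    have "ball q (1 / Suc n) \<subseteq> ball z e"
    proof
      fix y assume y: "y \<in> ball q (1 / Suc n)"
      have "d z y \<le> d z q + d q y"
        using y z by (intro MS.triangle) auto
      also have "\<dots> < 1 / Suc n + 1 / Suc n"
        using q y by (intro add_strict_mono) auto
      finally show "y \<in> ball z e"
        using y z n' by (simp add: add_divide_distrib[symmetric])
    qed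
    then have "AE y in m. y \<in> ball q (1 / Suc n) \<longrightarrow> f y = 0"
      using C(2) e(2) by (elim AE_mp) (auto intro!: AE_I2)
    then have "(q, n) \<in> B"
      using q by (simp add: B_def)
    moreover have "z \<in> ball q (1 / Suc n)"
      using q z Q by (auto simp: MS.commute)
    ultimately show "f z = 0"
      using B by auto
  qed
qed

lemma ae_support_subset: "ae_support X m f \<subseteq> M"
proof -
  have "closedin top M"
    using closedin_topspace[of top] by simp
  then show ?thesis
    unfolding ae_support_def by (intro Inter_lower) auto
qed

text \<open>The distance to \<open>A\<close> need not be attained, so a point within
  \<open>a + e\<close> is taken and \<open>e\<close> is sent to 0.\<close>

lemma near_of_esetdist:
  assumes p: "p \<in> M" and A: "A \<subseteq> M" "esetdist X p A \<le> ennreal a" "ediam X A \<le> ennreal b"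
    and z: "z \<in> A" and nonneg: "0 \<le> a" "0 \<le> b"
  shows "d z p \<le> a + b"
proof (rule field_le_epsilon)
  fix e :: real assume e: "0 < e"
  have "(INF y\<in>A. ennreal (d p y)) < ennreal (a + e)"
    using A(2) nonneg e unfolding esetdist_def
    by (intro le_less_trans[OF _ ennreal_lessI]) auto
  then obtain y where y: "y \<in> A" "ennreal (d p y) < ennreal (a + e)"
    by (auto simp: INF_less_iff)
  have "ennreal (d y z) \<le> ediam X A"
    unfolding ediam_def using y z by (intro SUP_upper2[of y] SUP_upper2[of z]) auto
  then have "ennreal (d y z) \<le> ennreal b"
    using A(3) by (rule order_trans)
  then have "d y z \<le> b"
    using nonneg by simp
  moreover have "d p y < a + e"
    using y nonneg e by (simp add: ennreal_less_iff del: ennreal_plus)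
  moreover have "d z p \<le> d z y + d y p"
    using p y z A(1) by (intro MS.triangle) auto
  ultimately show "d z p \<le> a + b + e"
    by (simp add: MS.commute)
qed

text \<open>The \<open>ennreal\<close> bounds yield finiteness, hence membership in the domain; only
  then do they become inequalities between real integrals. The factor 2 appears on both sides of the
  energy bound, and \<kappa> dominates the coefficients of both the form and the L^2 part.\<close>

lemma form_1_le:
  assumes h [measurable]: "h \<in> borel_measurable m" and D [measurable]: "D \<in> sets m"
    and H: "(\<integral>\<^sup>+z. ennreal ((h z)\<^sup>2) * indicator D z \<partial>m) = ennreal H" "0 \<le> H"
    and JD: "JI (D \<times> D) h < \<infinity>"
    and le: "JI (M \<times> M) h \<le> ennreal \<alpha> * JI (D \<times> D) h + ennreal \<gamma> * ennreal H"
    and le2: "(\<integral>\<^sup>+z. ennreal ((h z)\<^sup>2) \<partial>m) \<le> ennreal \<omega> * ennreal H"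
    and nonneg: "0 \<le> \<alpha>" "0 \<le> \<gamma>" "0 \<le> \<omega>" and \<kappa>: "\<alpha> + \<gamma> + \<omega> \<le> \<kappa>"
  shows "h \<in> jump_domain m J" "form_1 m (energy m J) h h \<le> \<kappa> * (jump_form m J D h h + H)"
proof -
  have DM: "D \<subseteq> M"
    using sets.sets_into_space[OF D] by simp
  have [measurable]: "M \<in> sets m"
    using sets.top[of m] by simp
  have a: "JI (D \<times> D) h = ennreal (2 * jump_form m J D h h)" "0 \<le> jump_form m J D h h"
    using J_nonneg DM JD by (auto intro!: jump_integral_eq_jump_form)
  define a' where "a' = jump_form m J D h h"
  have le': "JI (M \<times> M) h \<le> ennreal (\<alpha> * (2 * a') + \<gamma> * H)"
    using le a H nonneg by (simp add: a'_def ennreal_plus ennreal_mult)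
  then have fin: "JI (M \<times> M) h < \<infinity>"
    by (rule le_less_trans) simp
  then have E: "JI (M \<times> M) h = ennreal (2 * energy m J h h)" "0 \<le> energy m J h h"
    using J_nonneg by (auto intro!: jump_integral_eq_jump_form)
  have "2 * energy m J h h \<le> \<alpha> * (2 * a') + \<gamma> * H"
    using le' a H nonneg unfolding E by (subst (asm) ennreal_le_iff) (auto simp: a'_def)
  then have energy: "energy m J h h \<le> \<alpha> * a' + \<gamma> * H"
    using nonneg H mult_nonneg_nonneg[of \<gamma> H] by linarith
  have L2: "(\<integral>\<^sup>+z. ennreal ((h z)\<^sup>2) \<partial>m) \<le> ennreal (\<omega> * H)"
    using le2 nonneg H by (simp add: ennreal_mult)
  then have "(\<integral>\<^sup>+z. ennreal ((h z)\<^sup>2) \<partial>m) < \<infinity>"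
    by (rule le_less_trans) simp
  then have int: "integrable m (\<lambda>z. (h z)\<^sup>2)"
    by (intro integrableI_nonneg) auto
  show "h \<in> jump_domain m J"
    using int fin by (simp add: jump_domain_def L2_fun_def)
  have "(\<integral>\<^sup>+z. ennreal ((h z)\<^sup>2) \<partial>m) = ennreal (LINT z|m. (h z)\<^sup>2)"
    using int by (intro nn_integral_eq_integral) auto
  then have "(LINT z|m. (h z)\<^sup>2) \<le> \<omega> * H"
    using L2 nonneg H by (simp add: ennreal_le_iff)
  then have "form_1 m (energy m J) h h \<le> \<alpha> * a' + (\<gamma> + \<omega>) * H"
    using energy by (simp add: form_1_def power2_eq_square distrib_right)
  also have "\<dots> \<le> \<kappa> * a' + \<kappa> * H"
    using a H nonneg \<kappa> by (intro add_mono mult_right_mono) (auto simp: a'_def)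
  finally show "form_1 m (energy m J) h h \<le> \<kappa> * (jump_form m J D h h + H)"
    by (simp add: a'_def distrib_left)
qed

end

section \<open>From the extension operator to the abstract extension\<close>

context whitney_partition
begin

text \<open>If \<open>D\<close> has diameter \<open>0\<close>, it is an isolated point, so the Whitney radii are bounded below.\<close>

lemma small_scale:
  assumes "ediam X D = 0"
  obtains s where "0 < s" "\<And>i. i \<in> I \<Longrightarrow> s \<le> r i"
proof (cases "D = {}")
  case True
  then have "cl = {}"
    by (simp add: metric_closure_def)
  \<comment> \<open>The distance to the empty set is \<infinity>, which differs from every
    \<open>5 * r i\<close>, so there are no Whitney balls at all.\<close>
  then have "i \<notin> I" for i
    using dist_near[of i 1] by auto
  then show ?thesis
    using that[of 1] by auto
next
  case False
  then obtain p where p: "p \<in> D" by auto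
  obtain e where e: "0 < e" "ball p e \<subseteq> D"
    using D_open p unfolding top_eq ball_eq MS.openin_mtopology by blast
  have pM: "p \<in> M"
    using p DM by auto
  have same: "y = p" if y: "y \<in> D" for y
  proof -
    have "ennreal (d y p) \<le> ediam X D"
      unfolding ediam_def using y p by (intro SUP_upper2[of y] SUP_upper2[of p]) auto
    then show ?thesis
      using assms y p DM by (metis MS.nonneg MS.zero antisym ennreal_eq_0_iff le_zero_eq subsetD)
  qed
  have "e / 5 \<le> r i" if i: "i \<in> I" for i
  proof -
    have "e \<le> 5 * r i + e'" if e': "0 < e'" for e'
    proof -
      obtain c where c: "c \<in> cl" "d (x i) c < 5 * r i + e' / 2"
        using dist_near[OF i, of "e' / 2"] e' by auto
      have "\<exists>y\<in>D. d c y < e' / 2"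
        using c(1) e' unfolding metric_closure_def top_eq MS.metric_closure_of
        by (auto simp: MS.in_mball dest!: spec[of _ "e' / 2"])
      then have cp: "d c p < e' / 2"
        using same by auto
      have "d (x i) p \<le> d (x i) c + d c p"
        using c cl_sub pM x_M[OF i] by (intro MS.triangle) auto
      then have lt: "d (x i) p < 5 * r i + e'"
        using c cp by linarith
      \<comment> \<open>Otherwise \<open>x i\<close> would lie in the closure and
        \<open>dist_ge\<close> would give 5 * \<open>r i\<close> \<le> 0.\<close>
      have "x i \<notin> ball p e"
        using e D_sub dist_ge[OF i, of "x i"] x_M[OF i] r_pos[OF i] by fastforce
      then have "e \<le> d (x i) p"
        using pM x_M[OF i] by (auto simp: MS.commute)
      then show ?thesis
        using lt by linarith
    qed
    then have "e \<le> 5 * r i"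
      by (rule field_le_epsilon)
    then show ?thesis by simp
  qed
  then show ?thesis
    using that[of "e / 5"] e by auto
qed

lemma measure_0_L2:
  assumes u: "u \<in> L2_fun (measure_0 X m D)"
  shows "(\<integral>\<^sup>+z. ennreal ((u z)\<^sup>2) * indicator D z \<partial>m) = ennreal (LINT z|measure_0 X m D. u z * u z)"
    and "0 \<le> (LINT z|measure_0 X m D. u z * u z)"
proof -
  have [measurable]: "u \<in> borel_measurable (restrict_space m cl)"
    using u by (simp add: L2_fun_def measure_0_def)
  have [measurable]: "(indicator D :: 'a \<Rightarrow> ennreal) \<in> borel_measurable (restrict_space m cl)"
    by (intro measurable_restrict_space1) measurable
  have "ennreal (LINT z|measure_0 X m D. (u z)\<^sup>2) = (\<integral>\<^sup>+z. ennreal ((u z)\<^sup>2) \<partial>measure_0 X m D)"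
    using u by (intro nn_integral_eq_integral[symmetric]) (auto simp: L2_fun_def)
  also have "\<dots> = (\<integral>\<^sup>+z. indicator D z * ennreal ((u z)\<^sup>2) \<partial>restrict_space m cl)"
    unfolding measure_0_def by (rule nn_integral_density) measurable
  also have "\<dots> = (\<integral>\<^sup>+z. indicator D z * ennreal ((u z)\<^sup>2) * indicator cl z \<partial>m)"
    by (rule nn_integral_restrict_space) simp
  also have "\<dots> = (\<integral>\<^sup>+z. ennreal ((u z)\<^sup>2) * indicator D z \<partial>m)"
    using D_sub by (intro nn_integral_cong) (auto simp: indicator_def)
  finally show "(\<integral>\<^sup>+z. ennreal ((u z)\<^sup>2) * indicator D z \<partial>m) = ennreal (LINT z|measure_0 X m D. u z * u z)"
    by (simp add: power2_eq_square)
  show "0 \<le> (LINT z|measure_0 X m D. u z * u z)"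
    by (intro integral_nonneg_AE) auto
qed

text \<open>As the index set is countable, a single null set collects the exceptions to (D.1) and to
  the support conditions for all f_i. Setting the f_i to 0 there leaves the averages [u]_i
  unchanged. The radius 9 * \<open>r i\<close> is 7 * \<open>r i\<close> from (D.3) plus 2 *
  \<open>r i\<close> from (D.2).\<close>

lemma whitney_extensionI:
  assumes f: "averaging_functions Cf X m D (small_indices X D I r) x r f"
    and u: "u \<in> reflected_domain X m J D"
  obtains g where "whitney_extension X m J \<phi> CV c1 c2 \<beta>1 \<beta>2 C1 C2 D I x r \<eta> C\<eta> (small_indices X D I r) g Cf
      (extension_operator X m D I r f \<eta> u)"
proof -
  define L where "L = small_indices X D I r"
  define h where "h = extension_operator X m D I r f \<eta> u"
  have LI: "L \<subseteq> I"
    by (auto simp: L_def small_indices_def)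
  have L_count: "countable L"
    using LI countable_I by (rule countable_subset)
  have f_meas [measurable]: "f i \<in> borel_measurable m" if "i \<in> L" for i
    using f that by (simp add: averaging_functions_def L_def L2_fun_def)
  have nn: "AE z in m. \<forall>i\<in>L. 0 \<le> f i z"
    using f L_count by (subst AE_ball_countable) (auto simp: averaging_functions_def L_def elim: AE_mp)
  have su: "AE z in m. (\<integral>\<^sup>+i. ennreal (f i z) \<partial>count_space L) \<le> indicator D z"
  proof -
    have "AE z in m. (\<Sum>\<^sub>\<infinity>i\<in>L. ennreal (f i z)) \<le> indicator D z"
      using f by (simp add: averaging_functions_def L_def)
    then show ?thesis
      by (rule AE_mp) (auto intro!: AE_I2 order_trans[OF nn_integral_count_space_le_infsum[OF L_count]])
  qed
  have supp: "AE z in m. \<forall>i\<in>L. f i z \<noteq> 0 \<longrightarrow> d z (x i) \<le> 9 * r i"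
  proof (subst AE_ball_countable[OF L_count], intro ballI)
    fix i assume i: "i \<in> L"
    have near: "d z (x i) \<le> 9 * r i" if "z \<in> ae_support X m (f i)" for z
    proof -
      have "d z (x i) \<le> 7 * r i + 2 * r i"
        using f i LI x_M[of i] r_pos[of i] ae_support_subset that
        by (intro near_of_esetdist[of "x i" "ae_support X m (f i)"]) (auto simp: averaging_functions_def L_def)
      then show ?thesis by simp
    qed
    show "AE z in m. f i z \<noteq> 0 \<longrightarrow> d z (x i) \<le> 9 * r i"
      using AE_ae_support[of "f i"] near by (elim AE_mp) (auto intro!: AE_I2)
  qed
  have "AE z in m. (\<forall>i\<in>L. 0 \<le> f i z) \<and> (\<integral>\<^sup>+i. ennreal (f i z) \<partial>count_space L) \<le> indicator D z
      \<and> (\<forall>i\<in>L. f i z \<noteq> 0 \<longrightarrow> d z (x i) \<le> 9 * r i)"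
    using nn su supp by (intro AE_conjI)
  then obtain N where N_good: "\<And>z. z \<in> space m - N \<Longrightarrow>
      (\<forall>i\<in>L. 0 \<le> f i z) \<and> (\<integral>\<^sup>+i. ennreal (f i z) \<partial>count_space L) \<le> indicator D z
      \<and> (\<forall>i\<in>L. f i z \<noteq> 0 \<longrightarrow> d z (x i) \<le> 9 * r i)" and N: "N \<in> null_sets m"
    by (rule AE_E3) blast
  have N_sets [measurable]: "N \<in> sets m"
    using N by auto
  define g where "g i z = (if z \<in> N then 0 else f i z)" for i z
  have g_meas [measurable]: "g i \<in> borel_measurable m" if "i \<in> L" for i
    unfolding g_def using that by measurable
  have f_out: "f i z = 0" if "i \<in> L" "z \<in> M - N" "z \<notin> D" for i z
  proof -
    have "ennreal (f i z) \<le> (\<integral>\<^sup>+i. ennreal (f i z) \<partial>count_space L)"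
      using nn_integral_ge_point[OF that(1), of "\<lambda>i. ennreal (f i z)"] .
    also have "\<dots> \<le> 0"
      using N_good[of z] that by auto
    finally have "f i z \<le> 0"
      by (simp add: ennreal_eq_0_iff)
    moreover have "0 \<le> f i z"
      using N_good[of z] that by simp
    ultimately show ?thesis
      by simp
  qed
  have h_D: "h y = u y" if "y \<in> cl" for y
    using that by (simp add: h_def extension_operator_def)
  have f_g: "AE z in m. indicator D z * f i z = g i z" if i: "i \<in> L" for i
    using AE_not_in[OF N] AE_space by eventually_elim (use f_out[OF i] in \<open>auto simp: g_def indicator_def\<close>)
  have F_eq: "(LINT y:D|m. f i y) = (LINT z|m. g i z)" if i: "i \<in> L" for i
  proof -
    note [measurable] = f_meas[OF i] g_meas[OF i]
    show ?thesis
      unfolding set_lebesgue_integral_def using f_g[OF i] by (intro integral_cong_AE) auto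
  qed
  have u_meas: "u \<in> borel_measurable (restrict_space m cl)"
    using u by (simp add: reflected_domain_def L2_fun_def measure_0_def)
  \<comment> \<open>\<open>u\<close> is measurable only on the closure of \<open>D\<close>; its
    extension by 0 is measurable on the whole space and agrees with \<open>h\<close> on the
    closure.\<close>
  have ucl [measurable]: "(\<lambda>z. indicator cl z *\<^sub>R u z) \<in> borel_measurable m"
    using u_meas by (subst (asm) borel_measurable_restrict_space_iff) auto
  have ext: "(\<Sum>\<^sub>\<infinity>i\<in>L. weighted_average m D (f i) u * partition_function X D I \<eta> i y)
      = (\<Sum>i\<in>touched y \<inter> L. weighted_average m D (f i) u * \<psi> i y)" if y: "y \<in> M" for y
  proof -
    have "(\<Sum>\<^sub>\<infinity>i\<in>L. weighted_average m D (f i) u * partition_function X D I \<eta> i y)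
        = (\<Sum>i\<in>touched y \<inter> L. weighted_average m D (f i) u * partition_function X D I \<eta> i y)"
    proof (rule infsum_eq_sum)
      show "weighted_average m D (f i) u * partition_function X D I \<eta> i y = 0" if "i \<in> L - touched y \<inter> L" for i
        using that LI y \<psi>_eq[of i y] \<psi>_0[of i y] by auto
    qed (use touched_finite in auto)
    then show ?thesis
      using \<psi>_eq LI y by (simp add: subset_iff)
  qed
  have h_meas [measurable]: "h \<in> borel_measurable m"
  proof -
    have [measurable]: "(\<lambda>y. \<Sum>\<^sub>\<infinity>i\<in>L. weighted_average m D (f i) u * partition_function X D I \<eta> i y) \<in> borel_measurable m"
    proof (rule borel_measurable_infsum_finite_support[OF L_count])
      fix i assume "i \<in> L"
      then have iI: "i \<in> I" and [measurable]: "\<psi> i \<in> borel_measurable m"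
        using LI by auto
      have "(\<lambda>y. weighted_average m D (f i) u * \<psi> i y) \<in> borel_measurable m"
        by measurable
      then show "(\<lambda>y. weighted_average m D (f i) u * partition_function X D I \<eta> i y) \<in> borel_measurable m"
        by (subst measurable_cong[where g = "\<lambda>y. weighted_average m D (f i) u * \<psi> i y"]) (simp_all add: \<psi>_eq iI)
    next
      fix y assume y: "y \<in> space m"
      have "{i \<in> L. weighted_average m D (f i) u * partition_function X D I \<eta> i y \<noteq> 0} \<subseteq> touched y"
        using LI y \<psi>_eq[OF _ y[unfolded space_m]] \<psi>_0[OF _ y[unfolded space_m]] by fastforce
      then show "finite {i \<in> L. weighted_average m D (f i) u * partition_function X D I \<eta> i y \<noteq> 0}"
        using touched_finite by (rule finite_subset)
    qed
    have "h = (\<lambda>y. if y \<in> cl then indicator cl y *\<^sub>R u y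
        else \<Sum>\<^sub>\<infinity>i\<in>L. weighted_average m D (f i) u * partition_function X D I \<eta> i y)"
      by (auto simp: h_def extension_operator_def L_def fun_eq_iff)
    then show ?thesis
      by simp
  qed
  have b_eq: "weighted_average m D (f i) u = (LINT z|m. g i z * h z) / (LINT z|m. g i z)" if i: "i \<in> L" for i
  proof -
    note [measurable] = f_meas[OF i] g_meas[OF i]
    have "(LINT y:D|m. f i y * u y) = (LINT y:D|m. f i y * h y)"
      unfolding set_lebesgue_integral_def using h_D D_sub by (intro Bochner_Integration.integral_cong) (auto simp: indicator_def)
    also have "\<dots> = (LINT z|m. g i z * h z)"
      unfolding set_lebesgue_integral_def
    proof (rule integral_cong_AE)
      show "AE z in m. indicator D z *\<^sub>R (f i z * h z) = g i z * h z"
        using f_g[OF i] by eventually_elim (metis mult.assoc real_scaleR_def)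
    qed measurable
    finally show ?thesis
      by (simp add: weighted_average_def F_eq[OF i])
  qed
  have "whitney_extension X m J \<phi> CV c1 c2 \<beta>1 \<beta>2 C1 C2 D I x r \<eta> C\<eta> L g Cf h"
  proof (intro whitney_extension.intro whitney_extension_axioms.intro)
    show "whitney_partition X m J \<phi> CV c1 c2 \<beta>1 \<beta>2 C1 C2 D I x r \<eta> C\<eta>"
      by unfold_locales
    show "L \<subseteq> I" by (rule LI)
    show "0 < Cf"
      using f by (simp add: averaging_functions_def)
    show "g i \<in> borel_measurable m" if "i \<in> L" for i
      using that by (rule g_meas)
    show "0 \<le> g i z" if "i \<in> L" "z \<in> M" for i z
      using that N_good[of z] by (simp add: g_def)
    show "(\<integral>\<^sup>+i. ennreal (g i z) \<partial>count_space L) \<le> indicator D z" if "z \<in> M" for z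
      using that N_good[of z] by (cases "z \<in> N") (simp_all add: g_def)
    show "d z (x i) \<le> 9 * r i" if "i \<in> L" "z \<in> M" "g i z \<noteq> 0" for i z
      using that N_good[of z] by (auto simp: g_def split: if_splits)
    show "measure m (ball (x i) (r i)) / Cf \<le> (LINT z|m. g i z)" if "i \<in> L" for i
    proof -
      have "measure m (ball (x i) (r i)) / Cf \<le> (LINT y:D|m. f i y)"
        using f that unfolding averaging_functions_def L_def by blast
      then show ?thesis
        by (simp only: F_eq[OF that])
    qed
    show "h \<in> borel_measurable m" by (rule h_meas)
    show "(\<integral>\<^sup>+z. ennreal ((h z)\<^sup>2) * indicator D z \<partial>m) < \<infinity>"
    proof -
      have "(\<integral>\<^sup>+z. ennreal ((h z)\<^sup>2) * indicator D z \<partial>m) = (\<integral>\<^sup>+z. ennreal ((u z)\<^sup>2) * indicator D z \<partial>m)"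
        using h_D D_sub by (intro nn_integral_cong) (auto simp: indicator_def)
      then show ?thesis
        using measure_0_L2(1) u by (simp add: reflected_domain_def)
    qed
    show "h y = (\<Sum>i\<in>touched y \<inter> L. (LINT z|m. g i z * h z) / (LINT z|m. g i z) * \<psi> i y)" if y: "y \<in> U" for y
    proof -
      have "h y = (\<Sum>i\<in>touched y \<inter> L. weighted_average m D (f i) u * \<psi> i y)"
        using ext[of y] y by (simp add: h_def extension_operator_def L_def U_def)
      then show ?thesis
        using b_eq by simp
    qed
  qed
  then show ?thesis
    using that by (simp add: L_def h_def)
qed

end

lemma ennreal_less_half:
  assumes "ennreal a \<le> \<delta>" "2 * t < a" "0 < t"
  shows "ennreal t < \<delta> / 2"
proof -
  have "ennreal t < ennreal (a / 2)"
    using assms by (simp add: ennreal_less_iff)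
  also have "\<dots> = ennreal a / 2"
    using assms by (simp add: ennreal_divide_numeral)
  also have "\<dots> \<le> \<delta> / 2"
    using assms(1) by (rule divide_right_mono_ennreal)
  finally show ?thesis .
qed

section \<open>Both estimates for a given function\<close>

context whitney_partition
begin

context
  fixes Cf :: real and f :: "'i \<Rightarrow> 'a \<Rightarrow> real" and u :: "'a \<Rightarrow> real" and cD :: real
  assumes regular: "ahlfors_regular cD X m D"
    and f: "averaging_functions Cf X m D (small_indices X D I r) x r f"
    and u: "u \<in> reflected_domain X m J D"
begin

abbreviation (input) ext where "ext \<equiv> extension_operator X m D I r f \<eta> u"

lemma ext_eq: "y \<in> D \<Longrightarrow> ext y = u y"
  using D_sub by (auto simp: extension_operator_def)

lemma JI_ext: "S0 \<subseteq> D \<times> D \<Longrightarrow> JI S0 ext = JI S0 u"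
  unfolding jump_integral_def by (intro nn_integral_cong) (auto simp: indicator_def ext_eq)

text \<open>\<open>A1\<close> and \<open>A2\<close> depend on numeric parameters only, not on
  \<open>g\<close> or the extension, so they can be named before the locale is interpreted and
  compared with a prescribed \<kappa>.\<close>

lemma extension_global:
  assumes s: "0 < s" and small: "\<And>i. i \<in> I \<Longrightarrow> r i < 17 / 4 * s \<Longrightarrow> i \<in> small_indices X D I r"
    and \<kappa>: "whitney_extension.A1 CV c2 \<beta>2 C1 C2 C\<eta> Cf + whitney_extension.A2 CV c1 c2 \<beta>1 \<beta>2 C2 C\<eta> Cf / \<phi> s
      + (1 + NV * Cf) \<le> \<kappa>"
  shows "ext \<in> jump_domain m J"
    "form_1 m (energy m J) ext ext \<le> \<kappa> * form_1 (measure_0 X m D) (jump_form m J D) u u"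
proof -
  obtain g where "whitney_extension X m J \<phi> CV c1 c2 \<beta>1 \<beta>2 C1 C2 D I x r \<eta> C\<eta> (small_indices X D I r) g Cf ext"
    using whitney_extensionI[OF f u] .
  then interpret E: whitney_extension X m J \<phi> CV c1 c2 \<beta>1 \<beta>2 C1 C2 D I x r \<eta> C\<eta> "small_indices X D I r" g Cf ext .
  have null: "cl - D \<in> null_sets m"
    using frontier_null[OF D_open regular] .
  define H where "H = (LINT z|measure_0 X m D. u z * u z)"
  have u2: "u \<in> L2_fun (measure_0 X m D)" and JIu: "JI (D \<times> D) u < \<infinity>"
    using u by (auto simp: reflected_domain_def)
  have "(\<integral>\<^sup>+z. ennreal ((ext z)\<^sup>2) * indicator D z \<partial>m) = (\<integral>\<^sup>+z. ennreal ((u z)\<^sup>2) * indicator D z \<partial>m)"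
    by (intro nn_integral_cong) (auto simp: ext_eq indicator_def)
  then have H: "(\<integral>\<^sup>+z. ennreal ((ext z)\<^sup>2) * indicator D z \<partial>m) = ennreal H" "0 \<le> H"
    using measure_0_L2[OF u2] by (simp_all add: H_def)
  have A: "0 \<le> E.A1" "0 \<le> E.A2 / \<phi> s" "0 \<le> 1 + NV * Cf"
    using E.CS_pos E.CN_pos E.Cf_pos NV_ge_1 CJ_pos CT_nonneg \<phi>_pos[OF s] by (simp_all add: E.A1_def E.A2_def)
  have form: "jump_form m J D ext ext = jump_form m J D u u"
    unfolding jump_form_def set_lebesgue_integral_def
    by (intro arg_cong[where f = "\<lambda>a. 1 / 2 * a"] Bochner_Integration.integral_cong) (auto simp: indicator_def ext_eq)
  have JD: "JI (D \<times> D) ext < \<infinity>"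
    using JIu by (simp add: JI_ext)
  have le: "JI (M \<times> M) ext \<le> ennreal E.A1 * JI (D \<times> D) ext + ennreal (E.A2 / \<phi> s) * ennreal H"
    using E.JI_global[OF null s small] H(1) by simp
  have le2: "(\<integral>\<^sup>+z. ennreal ((ext z)\<^sup>2) \<partial>m) \<le> ennreal (1 + NV * Cf) * ennreal H"
    using E.h_L2_le[OF null] H(1) by simp
  note * = form_1_le[OF E.h_measurable D_sets H JD le le2 A \<kappa>]
  show "ext \<in> jump_domain m J"
    by (rule *(1))
  show "form_1 m (energy m J) ext ext \<le> \<kappa> * form_1 (measure_0 X m D) (jump_form m J D) u u"
    using *(2) by (simp add: form form_1_def H_def)
qed

lemma extension_local:
  assumes x0: "x0 \<in> cl" and R: "ennreal R < ediam X D"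
  shows "JI (ball x0 R \<times> ball x0 R) ext
    \<le> ennreal (whitney_extension.A1 CV c2 \<beta>2 C1 C2 C\<eta> Cf) * JI ((ball x0 (7 * R) \<inter> D) \<times> (ball x0 (14 * R) \<inter> D)) u"
proof -
  obtain g where "whitney_extension X m J \<phi> CV c1 c2 \<beta>1 \<beta>2 C1 C2 D I x r \<eta> C\<eta> (small_indices X D I r) g Cf ext"
    using whitney_extensionI[OF f u] .
  then interpret E: whitney_extension X m J \<phi> CV c1 c2 \<beta>1 \<beta>2 C1 C2 D I x r \<eta> C\<eta> "small_indices X D I r" g Cf ext .
  have "JI (ball x0 R \<times> ball x0 R) ext \<le> ennreal E.A1 * JI ((ball x0 (7 * R) \<inter> D) \<times> (ball x0 (14 * R) \<inter> D)) ext"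
  proof (rule E.JI_local[OF frontier_null[OF D_open regular] x0])
    fix i assume "i \<in> I" "2 * r i < R"
    then show "i \<in> small_indices X D I r"
      using ennreal_less_half[OF less_imp_le[OF R]] r_pos by (auto simp: small_indices_def)
  qed
  also have "JI ((ball x0 (7 * R) \<inter> D) \<times> (ball x0 (14 * R) \<inter> D)) ext = JI ((ball x0 (7 * R) \<inter> D) \<times> (ball x0 (14 * R) \<inter> D)) u"
    by (rule JI_ext) auto
  finally show ?thesis .
qed

end

end

theorem proposition4p1:
  fixes C_VD c_Cap C1_J C2_J c1_\<phi> c2_\<phi> \<beta>1 \<beta>2 c_D C_f C_\<eta> :: real
  shows "\<exists>C>0. \<exists>A :: ennreal \<Rightarrow> real. (\<forall>\<delta>. 0 < A \<delta>) \<and> (\<forall>\<delta>\<ge>1. A \<delta> = C) \<and>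
    (\<forall>(X :: 'a metric) m J \<phi> D (I :: 'i set) x r f \<eta>.
       metric_measure_space X m \<and>
       jump_kernel m J \<and>
       symmetric_dirichlet_form m (jump_domain m J) (energy m J) \<and>
       regular_form X m (jump_domain m J) (energy m J) \<and>
       scale_function c1_\<phi> c2_\<phi> \<beta>1 \<beta>2 \<phi> \<and>
       volume_doubling C_VD X m \<and>
       capacity_upper_bound c_Cap \<phi> X m (jump_domain m J) (energy m J) \<and>
       jump_kernel_bounds C1_J C2_J \<phi> X m J \<and>
       openin (mtopology_of X) D \<and> metric_closure X D \<subset> mspace X \<and>
       ahlfors_regular c_D X m D \<and>
       whitney_cover X D I x r \<and>
       averaging_functions C_f X m D (small_indices X D I r) x r f \<and>
       cutoff_functions C_\<eta> \<phi> X m (jump_domain m J) (energy m J) I x r \<eta> \<longrightarrow>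
       (\<forall>u\<in>reflected_domain X m J D.
          extension_operator X m D I r f \<eta> u \<in> jump_domain m J) \<and>
       (\<exists>K>0. (0 < ediam X D \<longrightarrow> K = A (ediam X D)) \<and>
          (\<forall>u\<in>reflected_domain X m J D.
             form_1 m (energy m J)
                 (extension_operator X m D I r f \<eta> u) (extension_operator X m D I r f \<eta> u)
               \<le> K * form_1 (measure_0 X m D) (jump_form m J D) u u)) \<and>
       (\<forall>u\<in>reflected_domain X m J D. \<forall>x0\<in>metric_closure X D. \<forall>R>0. ennreal R < ediam X D \<longrightarrow>
          jump_integral m J (mball_of X x0 R \<times> mball_of X x0 R)
              (extension_operator X m D I r f \<eta> u)
            \<le> ennreal C * jump_integral m J
                ((mball_of X x0 (7 * R) \<inter> D) \<times> (mball_of X x0 (14 * R) \<inter> D)) u))"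
proof -
  define A1 where "A1 = whitney_extension.A1 C_VD c2_\<phi> \<beta>2 C1_J C2_J C_\<eta> C_f"
  define A2 where "A2 = whitney_extension.A2 C_VD c1_\<phi> c2_\<phi> \<beta>1 \<beta>2 C2_J C_\<eta> C_f"
  define N where "N = 1 + doubling_jump_space.NV C_VD * C_f"
  \<comment> \<open>No \<phi> is available yet: 1 / \<phi>(s) is replaced by its bound for s \<le> 1
    that follows from the upper growth bound and \<phi>(1) = 1. The parameters are still arbitrary
    reals, hence \<open>max 1\<close> for positivity and \<open>max 0\<close> for the sign of
    \<open>A2\<close>.\<close>
  define \<kappa> where "\<kappa> s = max 1 (A1 + max 0 A2 * (c2_\<phi> * (1 / s) powr \<beta>2) + N)" for s
  \<comment> \<open>The minimum keeps the scale finite, since \<open>enn2real\<close> sends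
    \<infinity> to 0, and makes \<open>A\<close> constant from 1 on. Dividing by 16 gives 17/4 *
    1/16 < 1/2, so radii below 17/4 times the scale are below half the diameter.\<close>
  define A where "A \<delta> = max A1 (\<kappa> (enn2real (min \<delta> 1) / 16))" for \<delta>
  have A_pos: "0 < A \<delta>" for \<delta>
    by (simp add: A_def \<kappa>_def less_max_iff_disj)
  have A_ge: "\<forall>\<delta>\<ge>1. A \<delta> = A 1"
    by (simp add: A_def min_absorb2)
  show ?thesis
  proof (rule exI[of _ "A 1"], rule conjI[OF A_pos], rule exI[of _ A], rule conjI, rule allI[OF A_pos],
      rule conjI[OF A_ge], (rule allI)+, rule impI, (erule conjE)+, intro conjI)
    fix X :: "'a metric" and m J \<phi> D and I :: "'i set" and x r f \<eta>
    assume mms: "metric_measure_space X m" and jk: "jump_kernel m J"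
      and scale: "scale_function c1_\<phi> c2_\<phi> \<beta>1 \<beta>2 \<phi>" and vd: "volume_doubling C_VD X m"
      and jb: "jump_kernel_bounds C1_J C2_J \<phi> X m J"
      and D: "openin (mtopology_of X) D" "metric_closure X D \<subset> mspace X"
      and reg: "ahlfors_regular c_D X m D" and wh: "whitney_cover X D I x r"
      and f: "averaging_functions C_f X m D (small_indices X D I r) x r f"
      and cut: "cutoff_functions C_\<eta> \<phi> X m (jump_domain m J) (energy m J) I x r \<eta>"
    interpret W: whitney_partition X m J \<phi> C_VD c1_\<phi> c2_\<phi> \<beta>1 \<beta>2 C1_J C2_J D I x r \<eta> C_\<eta>
      using mms jk scale vd jb D wh cut by unfold_locales
    define \<delta> where "\<delta> = ediam X D"
    have \<kappa>_ge: "A1 + A2 / \<phi> s + N \<le> \<kappa> s" if s: "0 < s" "s \<le> 1" for s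
    proof -
      have "\<phi> 1 / \<phi> s \<le> c2_\<phi> * (1 / s) powr \<beta>2" "\<phi> 1 = 1"
        using scale s unfolding scale_function_def by blast+
      then have "max 0 A2 * (1 / \<phi> s) \<le> max 0 A2 * (c2_\<phi> * (1 / s) powr \<beta>2)"
        by (intro mult_left_mono) auto
      moreover have "A2 / \<phi> s \<le> max 0 A2 * (1 / \<phi> s)"
        using W.\<phi>_pos[OF s(1)] by (simp add: divide_right_mono)
      ultimately show ?thesis
        by (simp add: \<kappa>_def)
    qed
    have global: "extension_operator X m D I r f \<eta> u \<in> jump_domain m J"
      "form_1 m (energy m J) (extension_operator X m D I r f \<eta> u) (extension_operator X m D I r f \<eta> u)
        \<le> max A1 (\<kappa> s) * form_1 (measure_0 X m D) (jump_form m J D) u u"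
      if s: "0 < s" "s \<le> 1" "\<And>i. i \<in> I \<Longrightarrow> r i < 17 / 4 * s \<Longrightarrow> i \<in> small_indices X D I r"
        and u: "u \<in> reflected_domain X m J D" for s u
      using W.extension_global[OF reg f u s(1,3), of "max A1 (\<kappa> s)"] \<kappa>_ge[OF s(1,2)]
      by (auto simp: A1_def A2_def N_def)
    have "\<exists>s. 0 < s \<and> s \<le> 1 \<and> (\<forall>i\<in>I. r i < 17 / 4 * s \<longrightarrow> i \<in> small_indices X D I r)
      \<and> (0 < \<delta> \<longrightarrow> s = enn2real (min \<delta> 1) / 16)"
    proof (cases "0 < \<delta>")
      case True
      define \<mu> where "\<mu> = enn2real (min \<delta> 1)"
      have \<mu>: "ennreal \<mu> = min \<delta> 1"
        unfolding \<mu>_def by (simp add: ennreal_enn2real min_less_iff_disj)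
      have "0 < \<mu>"
        using True by (simp add: \<mu>_def enn2real_positive_iff min_less_iff_disj)
      moreover have "\<mu> \<le> 1"
        using \<mu> by (metis ennreal_le_1 min.cobounded2)
      moreover have "i \<in> small_indices X D I r" if "i \<in> I" "r i < 17 / 4 * (\<mu> / 16)" for i
        using ennreal_less_half[of \<mu> \<delta> "r i"] \<mu> that W.r_pos[OF that(1)] by (simp add: small_indices_def \<delta>_def)
      ultimately show ?thesis
        by (intro exI[of _ "\<mu> / 16"]) (auto simp: \<mu>_def)
    next
      case False
      then have "ediam X D = 0"
        by (simp add: \<delta>_def)
      then obtain s where s: "0 < s" "\<And>i. i \<in> I \<Longrightarrow> s \<le> r i"
        using W.small_scale by blast
      \<comment> \<open>As 17/4 * (s / 5) < s, no Whitney radius lies below the threshold and the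
        condition on \<open>I\<close> holds vacuously.\<close>
      then show ?thesis
        using False by (intro exI[of _ "min 1 (s / 5)"]) (force simp: min_def)
    qed
    then obtain s where s: "0 < s" "s \<le> 1" "\<And>i. i \<in> I \<Longrightarrow> r i < 17 / 4 * s \<Longrightarrow> i \<in> small_indices X D I r"
      and s_\<delta>: "0 < \<delta> \<Longrightarrow> s = enn2real (min \<delta> 1) / 16"
      by blast
    show "\<forall>u\<in>reflected_domain X m J D. extension_operator X m D I r f \<eta> u \<in> jump_domain m J"
      using global(1)[OF s] by blast
    show "\<exists>K>0. (0 < ediam X D \<longrightarrow> K = A (ediam X D)) \<and>
      (\<forall>u\<in>reflected_domain X m J D.
         form_1 m (energy m J) (extension_operator X m D I r f \<eta> u) (extension_operator X m D I r f \<eta> u)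
           \<le> K * form_1 (measure_0 X m D) (jump_form m J D) u u)"
    proof (intro exI[of _ "max A1 (\<kappa> s)"] conjI impI ballI)
      show "0 < max A1 (\<kappa> s)"
        by (simp add: \<kappa>_def less_max_iff_disj)
      show "max A1 (\<kappa> s) = A (ediam X D)" if "0 < ediam X D"
        using s_\<delta> that unfolding A_def \<delta>_def by metis
    qed (rule global(2)[OF s])
    \<comment> \<open>The maximum with \<open>A1\<close> in the definition of \<open>A\<close> lets
      the constant \<open>A 1\<close> serve the local estimate as well.\<close>
    have "ennreal A1 \<le> ennreal (A 1)"
      by (intro ennreal_leI) (simp add: A_def)
    then show "\<forall>u\<in>reflected_domain X m J D. \<forall>x0\<in>metric_closure X D. \<forall>R>0. ennreal R < ediam X D \<longrightarrow>
      jump_integral m J (mball_of X x0 R \<times> mball_of X x0 R) (extension_operator X m D I r f \<eta> u)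
        \<le> ennreal (A 1) * jump_integral m J ((mball_of X x0 (7 * R) \<inter> D) \<times> (mball_of X x0 (14 * R) \<inter> D)) u"
      using W.extension_local[OF reg f, folded A1_def] by (meson mult_right_mono order_trans zero_le)
  qed
qed

end
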